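(* Let $(W,S)$ be a Coxeter system of finite rank, $c$ a Coxeter element and $s$ initial in $c$. Then the map $v\mapsto sv$ if $v\ge s$, and $v\mapsto s\vee v$ if $v\not\ge s$, is a bijection from the set of $c$-sortable elements $v$ such that $s\vee v$ exists to the set of all $scs$-sortable elements. The inverse map is $x\mapsto sx$ if $x\not\ge s$, and $x\mapsto x_{\langle s\rangle}$ if $x\ge s$.
   Context: $S$ finite; $T$ = reflections; $\mathrm{inv}(w)=\{t\in T:\ell(tw)<\ell(w)\}$; (right) weak order $v\le w$ iff $\mathrm{inv}(v)\subseteq\mathrm{inv}(w)$, with join $\vee$ (least upper bound, when it exists). $W_J=\langle J\rangle$, $w_J\in W_J$ defined by $\mathrm{inv}(w_J)=\mathrm{inv}(w)\cap W_J$; $\langle s\rangle=S\setminus\{s\}$. Coxeter element $c=s_1\cdots s_n$ (all of $S$ in some order); $s$ initial in $c$ if a reduced word of $c$ begins with $s$; then $scs$ is a Coxeter element. For a Coxeter element $c$ with reduced word $s_1\cdots s_n$, the $c$-sorting word of $w$ is the lexicographically first (by positions) subword of $(s_1\cdots s_n)^\infty$ that is a reduced word for $w$; $w$ is $c$-sortable if the sets of letters in successive copies of $s_1\cdots s_n$ weakly decrease under inclusion. *)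

theory Defs
  imports "HOL-Algebra.Lattice" "HOL-Algebra.Generated_Groups"
begin

definition word_prod :: "('a, 'b) monoid_scheme \<Rightarrow> 'a list \<Rightarrow> 'a"
  where "word_prod W xs = foldr (\<otimes>\<^bsub>W\<^esub>) xs \<one>\<^bsub>W\<^esub>"


section \<open>Coxeter systems\<close>

text \<open>In a Coxeter matrix the entry \<open>\<infinity>\<close> is encoded as \<open>0\<close>.\<close>

definition coxeter_matrix :: "'a set \<Rightarrow> ('a \<Rightarrow> 'a \<Rightarrow> nat) \<Rightarrow> bool"
  where "coxeter_matrix S m \<longleftrightarrow>
    (\<forall>s\<in>S. m s s = 1) \<and>
    (\<forall>s\<in>S. \<forall>t\<in>S. s \<noteq> t \<longrightarrow> m s t = m t s \<and> m s t \<noteq> 1)"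

text \<open>Deletion of one relator \<open>(st)\<^bsup>m(s,t)\<^esup>\<close> from a word over \<open>S\<close>.\<close>

inductive relator_step :: "'a set \<Rightarrow> ('a \<Rightarrow> 'a \<Rightarrow> nat) \<Rightarrow> 'a list \<Rightarrow> 'a list \<Rightarrow> bool"
  for S :: "'a set" and m :: "'a \<Rightarrow> 'a \<Rightarrow> nat"
  where "\<lbrakk>set us \<subseteq> S; set vs \<subseteq> S; s \<in> S; t \<in> S; m s t \<noteq> 0\<rbrakk> \<Longrightarrow>
    relator_step S m (us @ concat (replicate (m s t) [s, t]) @ vs) (us @ vs)"

text \<open>
  \<open>presentation\<close> says that \<open>W\<close> is \<open>\<langle>S | (st)\<^bsup>m(s,t)\<^esup> = 1\<rangle>\<close>.  Words in the generators alone
  suffice, without formal inverses: since \<open>m(s,s) = 1\<close>, the words \<open>ss\<close> are among the relators,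
  so the quotient of the free monoid is already a group.
\<close>

locale coxeter_system = group W for W (structure) and S :: "'a set" +
  assumes generators_closed: "S \<subseteq> carrier W"
    and generated: "generate W S = carrier W"
    and presentation: "\<exists>m. coxeter_matrix S m \<and>
      (\<forall>xs\<in>lists S. \<forall>ys\<in>lists S.
        word_prod W xs = word_prod W ys \<longleftrightarrow> equivclp (relator_step S m) xs ys)"

definition cox_length :: "('a, 'b) monoid_scheme \<Rightarrow> 'a set \<Rightarrow> 'a \<Rightarrow> nat"
  where "cox_length W S w = (LEAST n. \<exists>xs\<in>lists S. length xs = n \<and> word_prod W xs = w)"

definition reduced_word :: "('a, 'b) monoid_scheme \<Rightarrow> 'a set \<Rightarrow> 'a list \<Rightarrow> 'a \<Rightarrow> bool"
  where "reduced_word W S xs w \<longleftrightarrow>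
    xs \<in> lists S \<and> word_prod W xs = w \<and> length xs = cox_length W S w"

definition reflections :: "('a, 'b) monoid_scheme \<Rightarrow> 'a set \<Rightarrow> 'a set"
  where "reflections W S = {w \<otimes>\<^bsub>W\<^esub> s \<otimes>\<^bsub>W\<^esub> inv\<^bsub>W\<^esub> w | w s. w \<in> carrier W \<and> s \<in> S}"

definition inversions :: "('a, 'b) monoid_scheme \<Rightarrow> 'a set \<Rightarrow> 'a \<Rightarrow> 'a set"
  where "inversions W S w =
    {t \<in> reflections W S. cox_length W S (t \<otimes>\<^bsub>W\<^esub> w) < cox_length W S w}"

definition weak_order :: "('a, 'b) monoid_scheme \<Rightarrow> 'a set \<Rightarrow> 'a gorder"
  where "weak_order W S =
    \<lparr>carrier = carrier W, eq = (=),
     le = (\<lambda>v w. inversions W S v \<subseteq> inversions W S w)\<rparr>"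

text \<open>\<^const>\<open>join\<close> is a choice operator, so the existence of a join is a separate predicate.\<close>

definition join_exists :: "('a, 'b) monoid_scheme \<Rightarrow> 'a set \<Rightarrow> 'a \<Rightarrow> 'a \<Rightarrow> bool"
  where "join_exists W S v w \<longleftrightarrow>
    (\<exists>z. least (weak_order W S) z (Upper (weak_order W S) {v, w}))"

text \<open>The element \<open>w\<^sub>J\<close> of the standard parabolic subgroup \<open>W\<^sub>J\<close>; the inversions of \<open>w\<^sub>J\<close> are
  taken in \<open>W\<close>.\<close>

definition parabolic_part :: "('a, 'b) monoid_scheme \<Rightarrow> 'a set \<Rightarrow> 'a set \<Rightarrow> 'a \<Rightarrow> 'a"
  where "parabolic_part W S J w =
    (THE u. u \<in> generate W J \<and> inversions W S u = inversions W S w \<inter> generate W J)"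


section \<open>Coxeter elements and sortable elements\<close>

definition coxeter_element :: "('a, 'b) monoid_scheme \<Rightarrow> 'a set \<Rightarrow> 'a \<Rightarrow> bool"
  where "coxeter_element W S c \<longleftrightarrow>
    (\<exists>xs. distinct xs \<and> set xs = S \<and> word_prod W xs = c)"

definition initial_in :: "('a, 'b) monoid_scheme \<Rightarrow> 'a set \<Rightarrow> 'a \<Rightarrow> 'a \<Rightarrow> bool"
  where "initial_in W S s c \<longleftrightarrow> (\<exists>xs. reduced_word W S (s # xs) c)"

text \<open>
  Position \<open>i\<close> (counted from \<open>0\<close>) of the infinite word \<open>(s\<^sub>1\<dots>s\<^sub>n)\<^sup>\<infinity>\<close> carries the letter
  with index \<open>i mod n\<close> and lies in the copy number \<open>i div n\<close> of \<open>s\<^sub>1\<dots>s\<^sub>n\<close>.  A subword is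
  given by the strictly increasing list of its positions.
\<close>

definition reduced_positions ::
    "('a, 'b) monoid_scheme \<Rightarrow> 'a set \<Rightarrow> 'a list \<Rightarrow> 'a \<Rightarrow> nat list \<Rightarrow> bool"
  where "reduced_positions W S cs w ps \<longleftrightarrow>
    sorted_wrt (<) ps \<and> reduced_word W S (map (\<lambda>i. cs ! (i mod length cs)) ps) w"

definition sorting_positions ::
    "('a, 'b) monoid_scheme \<Rightarrow> 'a set \<Rightarrow> 'a list \<Rightarrow> 'a \<Rightarrow> nat list \<Rightarrow> bool"
  where "sorting_positions W S cs w ps \<longleftrightarrow>
    reduced_positions W S cs w ps \<and>
    (\<forall>qs. reduced_positions W S cs w qs \<longrightarrow> ps = qs \<or> (ps, qs) \<in> lexord less_than)"

definition letters_in_copy :: "'a list \<Rightarrow> nat list \<Rightarrow> nat \<Rightarrow> 'a set"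
  where "letters_in_copy cs ps k =
    {cs ! (i mod length cs) | i. i \<in> set ps \<and> i div length cs = k}"

text \<open>
  The reduced word \<open>cs\<close> of the Coxeter element \<open>c\<close> may be chosen freely: any two of them differ
  by commutations of letters, which do not affect the letter sets of the copies.
\<close>

definition sortable :: "('a, 'b) monoid_scheme \<Rightarrow> 'a set \<Rightarrow> 'a \<Rightarrow> 'a \<Rightarrow> bool"
  where "sortable W S c w \<longleftrightarrow>
    (\<exists>cs ps. reduced_word W S cs c \<and> sorting_positions W S cs w ps \<and>
      (\<forall>k. letters_in_copy cs ps (Suc k) \<subseteq> letters_in_copy cs ps k))"

end

theory Submission
  imports Defs Complex_Main
begin

text \<open>
  In the geometric representation the inversions of \<open>w\<close> are the positive roots made negative by
  \<open>w\<^sup>-\<^sup>1\<close>.  Sortable elements are built by rotating the word of \<open>c\<close> one letter at a time, and the Euler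
  form attached to that word is invariant under such a rotation.  When \<open>s\<close> is final this invariance
  has three consequences: sortability is equivalent to an alignment condition on the inversions and
  therefore passes to parabolic parts; an inversion \<open>s\<close> of a sortable element can be deleted, which
  makes bounded joins of sortable elements sortable; and the cover reflections of a sortable element
  \<open>x \<ge> s\<close> other than \<open>s\<close> lie in \<open>W\<^bsub>\<langle>s\<rangle>\<^esub>\<close>, because the skipped letters of a sorting word form an
  exceptional sequence.  The last fact gives \<open>x = s \<or> x\<^bsub>\<langle>s\<rangle>\<^esub>\<close>, and \<open>(s \<or> v)\<^bsub>\<langle>s\<rangle>\<^esub> = v\<close> follows from
  an induction over polygons in the weak order.
\<close>

section \<open>The geometric representation\<close>

text \<open>\<open>W\<close> may be infinite and its bilinear form degenerate or indefinite, so
  there is no longest element to argue with, and joins exist only under a common upper bound. Signs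
  take over the role of positive definiteness: off-diagonal entries of the form are nonpositive and
  every root is nonnegative or nonpositive, so a vanishing sum of terms of one sign has only zero
  terms. A final letter \<open>s\<close> is special in two ways. The Euler form of \<open>v\<close>
  against the simple root of \<open>s\<close> is the coefficient \<open>v s\<close>, so Euler
  orthogonality can be turned into a vanishing coefficient, that is, into membership in the
  parabolic subgroup of \<open>S - {s}\<close>. The skew part \<open>omega\<close> pairs every
  nonnegative vector with that simple root nonnegatively, so \<open>s\<close> behaves as the last of
  the inversions and can be deleted. The recursion for sortability strips letters at the front,
  whereas \<open>s\<close> sits at the end. Alignment is a condition on the inversion set alone and
  therefore restricts to parabolic subgroups, where the recursion gives no direct access.\<close>

locale finite_rank_coxeter_system = coxeter_system W S for W (structure) and S +
  fixes m :: "'a \<Rightarrow> 'a \<Rightarrow> nat"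
  assumes finite_S: "finite S"
    and matrix: "coxeter_matrix S m"
    and relations: "\<lbrakk>xs \<in> lists S; ys \<in> lists S\<rbrakk> \<Longrightarrow>
      word_prod W xs = word_prod W ys \<longleftrightarrow> equivclp (relator_step S m) xs ys"
begin

section \<open>Words, length and parity\<close>

abbreviation len :: "'a \<Rightarrow> nat" where "len \<equiv> cox_length W S"
abbreviation wd :: "'a list \<Rightarrow> 'a" where "wd \<equiv> word_prod W"

lemma gen_closed [simp]: "s \<in> S \<Longrightarrow> s \<in> carrier W"
  using generators_closed by blast

lemma wd_simps [simp]: "wd [] = \<one>" "wd (x # xs) = x \<otimes> wd xs"
  by (simp_all add: word_prod_def)

lemma wd_closed [simp]: "xs \<in> lists S \<Longrightarrow> wd xs \<in> carrier W"
  by (induction xs) auto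

lemma wd_append: "\<lbrakk>xs \<in> lists S; ys \<in> lists S\<rbrakk> \<Longrightarrow> wd (xs @ ys) = wd xs \<otimes> wd ys"
  by (induction xs) (auto simp: m_assoc)

lemma relator_wd:
  assumes "s \<in> S" "t \<in> S" "m s t \<noteq> 0"
  shows "wd (concat (replicate (m s t) [s, t])) = \<one>"
proof -
  let ?xs = "concat (replicate (m s t) [s, t])"
  have "relator_step S m ([] @ ?xs @ []) ([] @ [])"
    by (rule relator_step.intros) (use assms in auto)
  then have "equivclp (relator_step S m) ?xs []" by auto
  moreover have "?xs \<in> lists S" using assms by auto
  ultimately show ?thesis using relations[of ?xs "[]"] by simp
qed

lemma gen_square [simp]: "s \<in> S \<Longrightarrow> s \<otimes> s = \<one>"
  using relator_wd[of s s] matrix by (simp add: coxeter_matrix_def)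

lemma inv_gen [simp]: "s \<in> S \<Longrightarrow> inv s = s"
  by (simp add: inv_equality)

lemma gen_cancel [simp]: "\<lbrakk>s \<in> S; w \<in> carrier W\<rbrakk> \<Longrightarrow> s \<otimes> (s \<otimes> w) = w"
  by (simp flip: m_assoc)

lemma gen_cancel_right [simp]: "\<lbrakk>s \<in> S; w \<in> carrier W\<rbrakk> \<Longrightarrow> w \<otimes> s \<otimes> s = w"
  by (simp add: m_assoc)

lemma inv_wd: "xs \<in> lists S \<Longrightarrow> inv (wd xs) = wd (rev xs)"
proof (induction xs)
  case (Cons x xs)
  then have "rev xs \<in> lists S" "[x] \<in> lists S" by auto
  then show ?case using Cons wd_append[of "rev xs" "[x]"] by (simp add: inv_mult_group)
qed simp

lemma generate_iff_word:
  assumes "J \<subseteq> S"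
  shows "w \<in> generate W J \<longleftrightarrow> (\<exists>xs\<in>lists J. wd xs = w)"
proof
  assume "w \<in> generate W J"
  then show "\<exists>xs\<in>lists J. wd xs = w"
  proof (induction rule: generate.induct)
    case one then show ?case by (intro bexI[of _ "[]"]) auto
  next
    case (incl h) then show ?case using assms by (intro bexI[of _ "[h]"]) auto
  next
    case (inv h) then show ?case using assms by (intro bexI[of _ "[h]"]) auto
  next
    case (eng h1 h2)
    then obtain xs ys where "xs \<in> lists J" "ys \<in> lists J" "wd xs = h1" "wd ys = h2" by auto
    moreover have "xs \<in> lists S" "ys \<in> lists S" using calculation assms by auto
    ultimately show ?case by (intro bexI[of _ "xs @ ys"]) (auto simp: wd_append)
  qed
next
  assume "\<exists>xs\<in>lists J. wd xs = w"
  then obtain xs where "xs \<in> lists J" "wd xs = w" by auto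
  then show "w \<in> generate W J"
    by (induction xs arbitrary: w) (auto intro: generate.intros)
qed

lemma ex_word: "w \<in> carrier W \<Longrightarrow> \<exists>xs\<in>lists S. wd xs = w"
  using generate_iff_word[of S] generated by auto

lemma len_le: "xs \<in> lists S \<Longrightarrow> len (wd xs) \<le> length xs"
  unfolding cox_length_def by (rule Least_le) auto

lemma ex_reduced:
  assumes "w \<in> carrier W"
  obtains xs where "xs \<in> lists S" "wd xs = w" "length xs = len w"
proof -
  have "\<exists>n. \<exists>xs\<in>lists S. length xs = n \<and> wd xs = w" using ex_word[OF assms] by auto
  from LeastI_ex[OF this] show ?thesis using that unfolding cox_length_def by auto
qed

lemma len_one [simp]: "len \<one> = 0"
  using len_le[of "[]"] by simp

lemma len_mult_le: "\<lbrakk>v \<in> carrier W; w \<in> carrier W\<rbrakk> \<Longrightarrow> len (v \<otimes> w) \<le> len v + len w"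
  by (metis ex_reduced len_le length_append wd_append append_in_lists_conv)

lemma len_inv: 
  assumes "w \<in> carrier W" shows "len (inv w) = len w"
proof -
  have "len (inv w) \<le> len w" if "w \<in> carrier W" for w
    using ex_reduced[OF that] inv_wd len_le
    by (metis in_lists_conv_set length_rev set_rev)
  then show ?thesis using assms by (metis inv_closed inv_inv le_antisym)
qed

text \<open>Relators have even length, so the parity of a word depends only on its product. This is
  what makes a generator change the length by exactly one.\<close>

lemma relator_step_parity: "relator_step S m xs ys \<Longrightarrow> even (length xs) = even (length ys)"
  by (induction rule: relator_step.induct) (auto simp: length_concat sum_list_replicate)

lemma word_parity:
  assumes "xs \<in> lists S" "ys \<in> lists S" "wd xs = wd ys"
  shows "even (length xs) = even (length ys)"
proof -
  have "equivclp (relator_step S m) xs ys" using relations assms by blast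
  then show ?thesis
    by (induction rule: equivclp_induct) (auto dest: relator_step_parity)
qed

lemma len_gen_right:
  assumes "w \<in> carrier W" "s \<in> S"
  shows "len (w \<otimes> s) = Suc (len w) \<or> len w = Suc (len (w \<otimes> s))"
proof -
  obtain xs where xs: "xs \<in> lists S" "wd xs = w" "length xs = len w" using assms ex_reduced by blast
  obtain ys where ys: "ys \<in> lists S" "wd ys = w \<otimes> s" "length ys = len (w \<otimes> s)"
    using assms ex_reduced by (metis gen_closed m_closed)
  have "wd (xs @ [s]) = wd ys" using xs ys assms by (simp add: wd_append)
  then have "even (length ys) \<noteq> even (length xs)" using word_parity[of "xs @ [s]" ys] xs ys assms by auto
  moreover have "len s \<le> 1" using len_le[of "[s]"] assms by simp
  moreover have "len (w \<otimes> s) \<le> len w + len s" using len_mult_le assms by simp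
  moreover have "len (w \<otimes> s \<otimes> s) \<le> len (w \<otimes> s) + len s" using len_mult_le assms by (metis gen_closed m_closed)
  then have "len w \<le> len (w \<otimes> s) + len s" using assms by simp
  ultimately show ?thesis using xs ys by (cases "len (w \<otimes> s) = len w") auto
qed

lemma len_gen_left:
  assumes "w \<in> carrier W" "s \<in> S"
  shows "len (s \<otimes> w) = Suc (len w) \<or> len w = Suc (len (s \<otimes> w))"
  using len_gen_right[of "inv w" s] len_inv[of w] len_inv[of "s \<otimes> w"] assms
  by (simp add: inv_mult_group)

section \<open>The bilinear form and the simple reflections\<close>

text \<open>Twice the usual Tits form: simple roots get norm 2 and reflections need no division. The
  entry -2 is the limit of \<open>- 2 * cos (pi / m)\<close> for large \<open>m\<close>, since 0
  encodes infinity.\<close>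

definition cartan :: "'a \<Rightarrow> 'a \<Rightarrow> real"
  where "cartan s t = (if m s t = 0 then - 2 else - 2 * cos (pi / m s t))"

definition form :: "('a \<Rightarrow> real) \<Rightarrow> ('a \<Rightarrow> real) \<Rightarrow> real"
  where "form u v = (\<Sum>s\<in>S. \<Sum>t\<in>S. cartan s t * u s * v t)"

definition simple :: "'a \<Rightarrow> 'a \<Rightarrow> real"
  where "simple s = (\<lambda>t. if t = s then 1 else 0)"

definition reflect :: "'a \<Rightarrow> ('a \<Rightarrow> real) \<Rightarrow> 'a \<Rightarrow> real"
  where "reflect s v = v(s := v s - form v (simple s))"

definition act :: "'a list \<Rightarrow> ('a \<Rightarrow> real) \<Rightarrow> 'a \<Rightarrow> real"
  where "act xs = foldr reflect xs"

lemma act_simps [simp]: "act [] v = v" "act (x # xs) v = reflect x (act xs v)"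
  "act (xs @ ys) v = act xs (act ys v)"
  by (simp_all add: act_def)

lemma cartan_sym: "\<lbrakk>s \<in> S; t \<in> S\<rbrakk> \<Longrightarrow> cartan s t = cartan t s"
  using matrix by (cases "s = t") (auto simp: coxeter_matrix_def cartan_def)

lemma cartan_diag [simp]: "s \<in> S \<Longrightarrow> cartan s s = 2"
  using matrix by (simp add: coxeter_matrix_def cartan_def)

lemma m_ge2: "\<lbrakk>s \<in> S; t \<in> S; s \<noteq> t; m s t \<noteq> 0\<rbrakk> \<Longrightarrow> m s t \<ge> 2"
proof -
  assume *: "s \<in> S" "t \<in> S" "s \<noteq> t" "m s t \<noteq> 0"
  then have "m s t \<noteq> 1" using matrix unfolding coxeter_matrix_def by blast
  then show ?thesis using * by linarith
qed

lemma cartan_nonpos: 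
  assumes "s \<in> S" "t \<in> S" "s \<noteq> t" shows "cartan s t \<le> 0"
proof (cases "m s t = 0")
  case False
  then have "m s t \<ge> 2" using m_ge2 assms by blast
  then have "pi / m s t \<le> pi / 2" by (intro divide_left_mono) auto
  moreover have "pi / m s t \<ge> 0" by simp
  ultimately have "cos (pi / m s t) \<ge> 0" using cos_ge_zero[of "pi / m s t"]
    by linarith
  then show ?thesis by (simp add: cartan_def)
qed (simp add: cartan_def)

lemma form_sym: "form u v = form v u"
proof -
  have "form u v = (\<Sum>t\<in>S. \<Sum>s\<in>S. cartan s t * u s * v t)"
    unfolding form_def by (rule sum.swap)
  also have "\<dots> = form v u"
    unfolding form_def by (intro sum.cong refl) (auto simp: cartan_sym)
  finally show ?thesis .
qed

lemma form_lin_left: "form (\<lambda>x. a * u x + b * v x) w = a * form u w + b * form v w"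
  unfolding form_def by (simp add: algebra_simps sum.distrib sum_distrib_left)

lemma form_lin_right: "form w (\<lambda>x. a * u x + b * v x) = a * form w u + b * form w v"
  using form_lin_left form_sym by metis

lemma form_simple_right: 
  assumes "s \<in> S" shows "form v (simple s) = (\<Sum>t\<in>S. cartan t s * v t)"
proof -
  have "(\<Sum>u\<in>S. cartan t u * v t * simple s u) = cartan t s * v t" for t
    using finite_S assms by (simp add: simple_def if_distrib cong: if_cong)
  then show ?thesis unfolding form_def by simp
qed

lemma form_simple_simple [simp]: 
  assumes "s \<in> S" "t \<in> S" shows "form (simple t) (simple s) = cartan t s"
  using finite_S assms by (subst form_simple_right) (auto simp: simple_def if_distrib cong: if_cong)

lemma form_simple_expand: 
  assumes "s \<in> S" shows "form v (simple s) = 2 * v s + (\<Sum>t\<in>S-{s}. cartan t s * v t)"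
  using finite_S assms by (simp add: form_simple_right sum.remove)

lemma reflect_eq: "reflect s v = (\<lambda>x. 1 * v x + (- form v (simple s)) * simple s x)"
  by (auto simp: reflect_def simple_def)

lemma reflect_lin: "reflect s (\<lambda>x. a * u x + b * v x) = (\<lambda>x. a * reflect s u x + b * reflect s v x)"
  unfolding reflect_eq form_lin_left by (auto simp: algebra_simps)

lemma act_lin: "act xs (\<lambda>x. a * u x + b * v x) = (\<lambda>x. a * act xs u x + b * act xs v x)"
  by (induction xs) (auto simp: reflect_lin)

lemma reflect_other [simp]: "t \<noteq> s \<Longrightarrow> reflect s v t = v t"
  by (simp add: reflect_def)

lemma form_reflect: 
  assumes "s \<in> S" shows "form (reflect s u) (reflect s v) = form u v"
  unfolding reflect_eq form_lin_left form_lin_right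
  using assms form_sym[of u "simple s"] form_sym[of v "simple s"] by (simp add: algebra_simps)

lemma form_act: "xs \<in> lists S \<Longrightarrow> form (act xs u) (act xs v) = form u v"
  by (induction xs) (auto simp: form_reflect)

lemma reflect_simple_self: "s \<in> S \<Longrightarrow> reflect s (simple s) = (\<lambda>x. - simple s x)"
  by (auto simp: reflect_eq)

lemma reflect_reflect [simp]: "s \<in> S \<Longrightarrow> reflect s (reflect s v) = v"
  unfolding reflect_eq form_lin_left by (auto simp: algebra_simps)

section \<open>Alternating words and the braid relations\<close>

text \<open>Letters are added in front, so every nonempty word ends in \<open>t\<close> and the new
  letter acts last. Both the cancellations in \<open>alt_braid\<close> and the recurrence in
  \<open>act_alt\<close> thereby become inductions on the length.\<close>

primrec alt :: "'a \<Rightarrow> 'a \<Rightarrow> nat \<Rightarrow> 'a list" where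
  "alt s t 0 = []"
| "alt s t (Suc k) = (if even k then t else s) # alt s t k"

lemma length_alt [simp]: "length (alt s t k) = k"
  by (induction k) auto

lemma alt_lists [simp]: "\<lbrakk>s \<in> S; t \<in> S\<rbrakk> \<Longrightarrow> alt s t k \<in> lists S"
  by (induction k) auto

lemma alt_even: "alt s t (2 * k) = concat (replicate k [s, t])"
  by (induction k) auto

lemma alt_snoc: "alt s t k @ [s] = alt t s (Suc k)"
  by (induction k) auto

text \<open>Cancel letters one by one from the left of the relator. For \<open>j = m s t\<close>
  this is the braid relation; \<open>j = Suc (m s t)\<close> shortens a word that is one letter too
  long.\<close>

lemma alt_braid:
  assumes "s \<in> S" "t \<in> S" "m s t \<noteq> 0" "j \<le> 2 * m s t"
  shows "wd (alt s t (2 * m s t - j)) = wd (alt t s j)"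
  using assms(4)
proof (induction j)
  case 0
  then show ?case using alt_even[of s t "m s t"] relator_wd assms by simp
next
  case (Suc j)
  define n where "n = 2 * m s t - Suc j"
  have n: "2 * m s t - j = Suc n" "even n \<longleftrightarrow> odd j" using Suc.prems by (auto simp: n_def)
  let ?l = "if even n then t else s"
  have "?l \<otimes> wd (alt s t n) = wd (alt t s j)" using Suc n by simp
  then have "wd (alt s t n) = ?l \<otimes> wd (alt t s j)"
    using assms gen_cancel[of ?l "wd (alt s t n)"] by (auto split: if_splits)
  then show ?case using n unfolding n_def by auto
qed

text \<open>Letting an alternating word in \<open>s\<close>, \<open>t\<close> act on a vector, the successive values of the
  coordinates \<open>s\<close>, \<open>t\<close> form one sequence satisfying a second order linear recurrence.\<close>

lemma act_alt:
  assumes "s \<in> S" "t \<in> S" "s \<noteq> t"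
    and c: "c = - cartan s t"
    and z: "z 0 = v t" "z 1 = v s" "\<And>n. z (Suc (Suc n)) = c * z (Suc n) - z n - (if even n then q else p)"
    and p: "p = (\<Sum>u\<in>S-{s,t}. cartan u s * v u)"
    and q: "q = (\<Sum>u\<in>S-{s,t}. cartan u t * v u)"
  shows "act (alt s t k) v = (if even k then v(t := z k, s := z (Suc k)) else v(s := z k, t := z (Suc k)))"
proof -
  have t: "reflect t (v(s := x, t := y)) = v(s := x, t := c * x - y - q)" for x y
  proof -
    have eq: "S - {t} = insert s (S - {s,t})" using assms by blast
    have "(\<Sum>u\<in>S-{t}. cartan u t * (v(s := x, t := y)) u) =
      cartan s t * x + (\<Sum>u\<in>S-{s,t}. cartan u t * (v(s := x, t := y)) u)"
      unfolding eq using finite_S assms(3) by (subst sum.insert) simp_all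
    also have "(\<Sum>u\<in>S-{s,t}. cartan u t * (v(s := x, t := y)) u) = q"
      unfolding q by (rule sum.cong) simp_all
    finally show ?thesis using assms(2,3) unfolding reflect_def form_simple_expand[OF assms(2)] c by auto
  qed
  have s: "reflect s (v(t := y, s := x)) = v(t := y, s := c * y - x - p)" for x y
  proof -
    have eq: "S - {s} = insert t (S - {s,t})" using assms by blast
    have "(\<Sum>u\<in>S-{s}. cartan u s * (v(t := y, s := x)) u) =
      cartan t s * y + (\<Sum>u\<in>S-{s,t}. cartan u s * (v(t := y, s := x)) u)"
      unfolding eq using finite_S assms(3) by (subst sum.insert) simp_all
    also have "(\<Sum>u\<in>S-{s,t}. cartan u s * (v(t := y, s := x)) u) = p"
      unfolding p by (rule sum.cong) simp_all
    finally show ?thesis using assms(1,3) cartan_sym[OF assms(1,2)]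
      unfolding reflect_def form_simple_expand[OF assms(1)] c by auto
  qed
  show ?thesis
  proof (induction k)
    case 0 show ?case using z(1,2) by auto
  next
    case (Suc k)
    show ?case
    proof (cases "even k")
      case True
      then have "act (alt s t k) v = v(s := z (Suc k), t := z k)" using Suc assms(3) by (auto simp: fun_eq_iff)
      then show ?thesis using True t[of "z (Suc k)" "z k"] z(3)[of k] assms(3) by (simp add: fun_upd_twist)
    next
      case False
      then have "act (alt s t k) v = v(t := z (Suc k), s := z k)" using Suc assms(3) by (auto simp: fun_eq_iff)
      then show ?thesis using False s[of "z (Suc k)" "z k"] z(3)[of k] assms(3) by (simp add: fun_upd_twist)
    qed
  qed
qed

text \<open>The other coordinates enter the recurrence of \<open>act_alt\<close> only through the
  constants \<open>p\<close> and \<open>q\<close>, so the plane of the two simple roots need not be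
  split off. Subtracting a solution of period two leaves a homogeneous recurrence, whose solutions
  are combinations of sines of multiples of \<open>h = pi / m s t\<close> and hence have period
  \<open>2 * m s t\<close>.\<close>

lemma act_relator:
  assumes st: "s \<in> S" "t \<in> S" and m0: "m s t \<noteq> 0"
  shows "act (concat (replicate (m s t) [s, t])) v = v"
proof (cases "s = t")
  case True
  then show ?thesis using matrix st by (simp add: coxeter_matrix_def)
next
  case False
  define h where "h = pi / m s t"
  have m2: "m s t \<ge> 2" using m_ge2 st m0 False by blast
  have "h > 0" "h < pi" using m2 by (auto simp: h_def divide_less_eq)
  then have s0: "sin h > 0" by (rule sin_gt_zero)
  define c where "c = 2 * cos h"
  have c: "c = - cartan s t" using m0 by (simp add: c_def cartan_def h_def)
  define p where "p = (\<Sum>u\<in>S-{s,t}. cartan u s * v u)"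
  define q where "q = (\<Sum>u\<in>S-{s,t}. cartan u t * v u)"
  have "c * c \<noteq> 4"
  proof
    assume "c * c = 4"
    then have "cos h * cos h = 1" by (simp add: c_def)
    then show False using s0 sin_cos_squared_add[of h] by (simp add: power2_eq_square)
  qed
  then have d: "4 - c * c \<noteq> 0" by simp
  \<comment> \<open>Cramer's rule for \<open>2 * x0 = c * y0 - p\<close> and
    \<open>2 * y0 = c * x0 - q\<close>, the equations for a solution alternating between
    \<open>y0\<close> and \<open>x0\<close>.\<close>
  define x0 where "x0 = - (2 * p + c * q) / (4 - c * c)"
  define y0 where "y0 = - (2 * q + c * p) / (4 - c * c)"
  have d': "(4 - c * c) * x0 = - (2 * p + c * q)" "(4 - c * c) * y0 = - (2 * q + c * p)"
    using d by (auto simp: x0_def y0_def)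
  have "(4 - c * c) * (c * x0 - 2 * y0 - q) = c * ((4 - c * c) * x0) - 2 * ((4 - c * c) * y0) - (4 - c * c) * q"
    by (simp add: algebra_simps)
  also have "\<dots> = 0" unfolding d' by (simp add: algebra_simps)
  finally have f1: "c * x0 - y0 - q = y0" using d by simp
  have "(4 - c * c) * (c * y0 - 2 * x0 - p) = c * ((4 - c * c) * y0) - 2 * ((4 - c * c) * x0) - (4 - c * c) * p"
    by (simp add: algebra_simps)
  also have "\<dots> = 0" unfolding d' by (simp add: algebra_simps)
  finally have f2: "c * y0 - x0 - p = x0" using d by simp
  define X where "X = v s - x0"
  define Y where "Y = v t - y0"
  \<comment> \<open>The solution of the homogeneous recurrence with \<open>r 0 = Y\<close> and
    \<open>r 1 = X\<close>.\<close>
  define r where "r n = (X * sin (real n * h) - Y * sin ((real n - 1) * h)) / sin h" for n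
  define z where "z n = r n + (if even n then y0 else x0)" for n
  have rr: "r (Suc (Suc n)) = c * r (Suc n) - r n" for n
  proof -
    have a: "sin ((x + 2) * h) = 2 * cos h * sin ((x + 1) * h) - sin (x * h)" for x
    proof -
      have "sin ((x + 2) * h) + sin (x * h) = 2 * sin ((x + 1) * h) * cos h"
      proof -
        have "sin ((x + 1) * h + h) + sin ((x + 1) * h - h) = 2 * sin ((x + 1) * h) * cos h"
          by (simp only: sin_add[of "(x + 1) * h" h] sin_diff[of "(x + 1) * h" h])
        moreover have "(x + 1) * h + h = (x + 2) * h" "(x + 1) * h - h = x * h" by (simp_all add: algebra_simps)
        ultimately show ?thesis by (simp only:)
      qed
      then show ?thesis by (simp only: eq_diff_eq mult.assoc mult.commute)
    qed
    have "X * sin ((real n + 2) * h) - Y * sin ((real n - 1 + 2) * h) =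
      c * (X * sin ((real n + 1) * h) - Y * sin ((real n - 1 + 1) * h)) - (X * sin (real n * h) - Y * sin ((real n - 1) * h))"
      (is "?a = c * ?b - ?d")
      unfolding a[of "real n"] a[of "real n - 1"] c_def by (simp add: algebra_simps)
    then have "?a / sin h = c * (?b / sin h) - ?d / sin h"
      by (simp only: diff_divide_distrib[of "c * ?b" ?d] times_divide_eq_right)
    moreover have "real (Suc (Suc n)) = real n + 2" "real (Suc (Suc n)) - 1 = real n - 1 + 2"
      "real (Suc n) = real n + 1" "real (Suc n) - 1 = real n - 1 + 1" by simp_all
    ultimately show ?thesis unfolding r_def by (simp only:)
  qed
  have r0: "r 0 = Y" and r1: "r 1 = X" using s0 by (auto simp: r_def)
  have zz: "z (Suc (Suc n)) = c * z (Suc n) - z n - (if even n then q else p)" for n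
    using f1 f2 unfolding z_def rr by (auto simp: algebra_simps)
  have z0: "z 0 = v t" and z1: "z 1 = v s" using r0 r1 by (auto simp: z_def X_def Y_def)
  have "real (2 * m s t) * h = 2 * pi" using m0 by (simp add: h_def)
  then have per: "r (2 * m s t + n) = r n" for n
  proof -
    assume *: "real (2 * m s t) * h = 2 * pi"
    have "real (2 * m s t + n) * h = real n * h + 2 * pi"
      "(real (2 * m s t + n) - 1) * h = (real n - 1) * h + 2 * pi"
      unfolding *[symmetric] by (simp_all add: algebra_simps)
    then have "sin (real (2 * m s t + n) * h) = sin (real n * h)"
      "sin ((real (2 * m s t + n) - 1) * h) = sin ((real n - 1) * h)"
      by (simp_all only: sin_periodic)
    then show ?thesis by (simp add: r_def)
  qed
  have "z (2 * m s t) = v t" "z (Suc (2 * m s t)) = v s"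
    using per[of 0] per[of 1] z0 z1 by (auto simp: z_def)
  then have "act (alt s t (2 * m s t)) v = v"
    unfolding act_alt[OF st False c z0 z1 zz p_def q_def] by auto
  then show ?thesis by (simp add: alt_even)
qed

lemma act_relator_step:
  assumes "relator_step S m xs ys" shows "act xs = act ys"
  using assms by (induction rule: relator_step.induct) (auto simp: fun_eq_iff act_relator)

lemma act_wd:
  assumes "xs \<in> lists S" "ys \<in> lists S" "wd xs = wd ys"
  shows "act xs = act ys"
proof -
  have "equivclp (relator_step S m) xs ys" using relations assms by blast
  then show ?thesis by (induction rule: equivclp_induct) (auto dest: act_relator_step)
qed

section \<open>The action of the group and the sign of a root\<close>

definition rep :: "'a \<Rightarrow> ('a \<Rightarrow> real) \<Rightarrow> 'a \<Rightarrow> real"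
  where "rep w = act (SOME xs. xs \<in> lists S \<and> wd xs = w)"

lemma rep_wd: "xs \<in> lists S \<Longrightarrow> rep (wd xs) = act xs"
  unfolding rep_def by (rule someI2[where a = xs]) (auto intro: act_wd)

lemma rep_gen [simp]: "s \<in> S \<Longrightarrow> rep s = reflect s"
  using rep_wd[of "[s]"] by (auto simp: fun_eq_iff)

lemma rep_one [simp]: "rep \<one> v = v"
  using rep_wd[of "[]"] by simp

lemma rep_mult: 
  assumes "x \<in> carrier W" "y \<in> carrier W" shows "rep (x \<otimes> y) v = rep x (rep y v)"
proof -
  obtain xs ys where "xs \<in> lists S" "wd xs = x" "ys \<in> lists S" "wd ys = y"
    using ex_word assms by metis
  then show ?thesis using wd_append[of xs ys] rep_wd[of xs] rep_wd[of ys] rep_wd[of "xs @ ys"] by simp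
qed

lemma rep_inv [simp]: 
  assumes "w \<in> carrier W" shows "rep (inv w) (rep w v) = v" "rep w (rep (inv w) v) = v"
  using rep_mult[of "inv w" w v] rep_mult[of w "inv w" v] assms by auto

lemma rep_lin: 
  assumes "w \<in> carrier W"
  shows "rep w (\<lambda>x. a * u x + b * v x) = (\<lambda>x. a * rep w u x + b * rep w v x)"
  using ex_word[OF assms] rep_wd act_lin by metis

lemma rep_uminus: 
  assumes "w \<in> carrier W" shows "rep w (\<lambda>x. - v x) = (\<lambda>x. - rep w v x)"
  using rep_lin[OF assms, of "-1" v 0 v] by simp

lemma rep_form: 
  assumes "w \<in> carrier W" shows "form (rep w u) (rep w v) = form u v"
  using ex_word[OF assms] rep_wd form_act by metis

text \<open>For a simple root \<open>s\<close> the constants in \<open>act_alt\<close> vanish, and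
  the coordinates are \<open>sin (n * h) / sin h\<close>, or \<open>n\<close> in the limiting case
  of infinite order. For \<open>k < m s t\<close> both arguments \<open>k * h\<close> and
  \<open>(k + 1) * h\<close> lie between 0 and \<pi>.\<close>

lemma alt_act_nonneg:
  assumes st: "s \<in> S" "t \<in> S" "s \<noteq> t" and k: "k < m s t \<or> m s t = 0"
  obtains p q where "p \<ge> 0" "q \<ge> 0" "act (alt s t k) (simple s) = (\<lambda>x. p * simple s x + q * simple t x)"
proof -
  define h where "h = pi / m s t"
  define z where "z n = (if m s t = 0 then real n else sin (real n * h) / sin h)" for n
  have s0: "m s t = 0 \<or> sin h > 0"
  proof (cases "m s t = 0")
    case False
    then have "m s t \<ge> 2" using m_ge2 st by blast
    then have "h > 0" "h < pi" by (auto simp: h_def divide_less_eq)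
    then show ?thesis using sin_gt_zero by blast
  qed simp
  have z0: "z 0 = simple s t" and z1: "z 1 = simple s s" using s0 st by (auto simp: z_def simple_def)
  have zz: "z (Suc (Suc n)) = - cartan s t * z (Suc n) - z n - (if even n then 0 else 0)" for n
  proof (cases "m s t = 0")
    case False
    have "sin ((real n + 1) * h + h) + sin ((real n + 1) * h - h) = 2 * sin ((real n + 1) * h) * cos h"
      by (simp only: sin_add[of "(real n + 1) * h" h] sin_diff[of "(real n + 1) * h" h])
    moreover have "(real n + 1) * h + h = (real n + 2) * h" "(real n + 1) * h - h = real n * h"
      by (simp_all add: algebra_simps)
    ultimately have "sin ((real n + 2) * h) = 2 * cos h * sin ((real n + 1) * h) - sin (real n * h)"
      by (simp only: eq_diff_eq mult.assoc mult.commute)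
    then show ?thesis using False s0 unfolding z_def cartan_def h_def[symmetric]
      by (simp add: field_simps)
  qed (simp add: z_def cartan_def)
  have "(0::real) = (\<Sum>u\<in>S-{s,t}. cartan u s * simple s u)" "(0::real) = (\<Sum>u\<in>S-{s,t}. cartan u t * simple s u)"
    by (auto simp: simple_def intro!: sum.neutral)
  note * = act_alt[OF st refl z0 z1 zz this]
  have z_nonneg: "z n \<ge> 0" if "n \<le> m s t \<or> m s t = 0" for n
  proof (cases "m s t = 0")
    case False
    then have "real n * h \<le> real (m s t) * h" using that by (intro mult_right_mono) (auto simp: h_def)
    then have "real n * h \<le> pi" using False by (simp add: h_def)
    moreover have "0 \<le> real n * h" by (simp add: h_def)
    ultimately show ?thesis using s0 False sin_ge_zero[of "real n * h"] by (simp add: z_def)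
  qed (simp add: z_def)
  have zk: "z k \<ge> 0" "z (Suc k) \<ge> 0" using k by (auto intro: z_nonneg)
  show ?thesis
  proof (cases "even k")
    case True
    then show ?thesis using that[of "z (Suc k)" "z k"] *[of k] zk st by (auto simp: simple_def fun_eq_iff)
  next
    case False
    then show ?thesis using that[of "z k" "z (Suc k)"] *[of k] zk st by (auto simp: simple_def fun_eq_iff)
  qed
qed

text \<open>Splitting off from the right end of \<open>w\<close> a longest alternating word in \<open>s\<close> and a right
  descent \<open>t\<close> reduces the claim to the shorter left factor and a dihedral computation.\<close>

theorem rep_simple_nonneg:
  assumes "w \<in> carrier W" "s \<in> S" "len w < len (w \<otimes> s)"
  shows "0 \<le> rep w (simple s) x"
  using assms
proof (induction "len w" arbitrary: w s x rule: less_induct)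
  case less
  show ?case
  proof (cases "w = \<one>")
    case True then show ?thesis by (simp add: simple_def)
  next
    case False
    obtain xs where xs: "xs \<in> lists S" "wd xs = w" "length xs = len w" using less.prems ex_reduced by blast
    then have "xs \<noteq> []" using False by auto
    then obtain ys t where ys: "xs = ys @ [t]" by (metis append_butlast_last_id)
    then have t: "t \<in> S" "ys \<in> lists S" using xs by auto
    have wt: "w = wd ys \<otimes> t" using xs ys t wd_append[of ys "[t]"] by simp
    have lw: "len w = Suc (len (wd ys))"
      using len_gen_right[of "wd ys" t] len_le[of ys] t xs ys wt by auto
    have ts: "t \<noteq> s"
    proof
      assume "t = s"
      then have "w \<otimes> s = wd ys" using wt t by simp
      then show False using less.prems lw by simp
    qed
    \<comment> \<open>\<open>Q k\<close>: the alternating word of length \<open>k\<close> splits off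
      from the right of \<open>w\<close> with lengths adding up.\<close>
    define Q where "Q k \<longleftrightarrow> (\<exists>v\<in>carrier W. w = v \<otimes> wd (alt s t k) \<and> len w = len v + k)" for k
    have Q1: "Q 1" unfolding Q_def using wt lw t by (intro bexI[of _ "wd ys"]) auto
    have Qle: "k \<le> len w" if "Q k" for k using that by (auto simp: Q_def)
    \<comment> \<open>Downward closure is needed for \<open>Km\<close>, where the word of length
      exactly \<open>m s t\<close> must split off even if the maximal one is longer.\<close>
    have Qdown: "Q k" if q: "Q (Suc k)" for k
    proof -
      obtain v where v: "v \<in> carrier W" "w = v \<otimes> wd (alt s t (Suc k))" "len w = len v + Suc k"
        using q unfolding Q_def by blast
      define l where "l = (if even k then t else s)"
      have l: "l \<in> S" using t less.prems by (simp add: l_def)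
      have al: "alt s t k \<in> lists S" using t less.prems by simp
      have w: "w = (v \<otimes> l) \<otimes> wd (alt s t k)" using v(1,2) l al by (simp add: m_assoc l_def)
      have "len w \<le> len (v \<otimes> l) + k"
        using len_mult_le[of "v \<otimes> l" "wd (alt s t k)"] len_le[OF al] w v(1) l al by simp
      moreover have "len (v \<otimes> l) \<le> Suc (len v)" using len_gen_right[OF v(1) l] by auto
      ultimately show ?thesis unfolding Q_def using w v l by (intro bexI[of _ "v \<otimes> l"]) auto
    qed
    obtain K where K: "Q K" "\<And>k. Q k \<Longrightarrow> k \<le> K"
      using Q1 Qle by (metis GreatestI_nat Greatest_le_nat)
    have "K \<ge> 1" using K(2)[OF Q1] .
    then obtain K' where K': "K = Suc K'" by (cases K) auto
    obtain v where v: "v \<in> carrier W" "w = v \<otimes> wd (alt s t K)" "len w = len v + K"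
      using K(1) unfolding Q_def by blast
    have al: "alt s t k \<in> lists S" for k using t less.prems by simp
    define l where "l = (if even K then t else s)"
    define l' where "l' = (if even K' then t else s)"
    have l: "l \<in> S" "l' \<in> S" using t less.prems by (auto simp: l_def l'_def)
    \<comment> \<open>Neither letter is a descent of \<open>v\<close>: the letter \<open>l\<close>
      would prolong the split-off word against the maximality of \<open>K\<close>, and the first
      letter \<open>l'\<close> of that word would make \<open>w\<close> too short.\<close>
    have asc: "len v < len (v \<otimes> l)"
    proof (rule ccontr)
      assume "\<not> ?thesis"
      then have "len v = Suc (len (v \<otimes> l))" using len_gen_right[OF v(1) l(1)] by auto
      moreover have "w = (v \<otimes> l) \<otimes> wd (alt s t (Suc K))"
        using v l al by (simp add: m_assoc l_def split: if_splits)
      ultimately have "Q (Suc K)" unfolding Q_def using v l by (intro bexI[of _ "v \<otimes> l"]) auto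
      then show False using K(2) by fastforce
    qed
    have asc': "len v < len (v \<otimes> l')"
    proof (rule ccontr)
      assume "\<not> ?thesis"
      then have "len v = Suc (len (v \<otimes> l'))" using len_gen_right[OF v(1) l(2)] by auto
      moreover have "w = (v \<otimes> l') \<otimes> wd (alt s t K')"
        using v(1,2) l al[of K'] K' by (simp add: m_assoc l'_def)
      then have "len w \<le> len (v \<otimes> l') + K'"
        using len_mult_le[of "v \<otimes> l'" "wd (alt s t K')"] len_le[OF al[of K']] v(1) l al[of K'] by simp
      ultimately show False using v K' by simp
    qed
    have "{l, l'} = {s, t}" by (auto simp: l_def l'_def K')
    then have asc2: "len v < len (v \<otimes> s)" "len v < len (v \<otimes> t)" using asc asc' by (auto simp: doubleton_eq_iff)
    \<comment> \<open>Otherwise the word of length \<open>m s t\<close> followed by \<open>s\<close>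
      equals an alternating word of length \<open>m s t - 1\<close>, so \<open>w \<otimes> s\<close>
      would be shorter than \<open>w\<close>.\<close>
    have Km: "K < m s t \<or> m s t = 0"
    proof (rule ccontr)
      assume "\<not> ?thesis"
      then have *: "m s t \<le> K" "m s t \<noteq> 0" by auto
      have "Q (m s t)" using *(1) K(1) by (induction rule: inc_induct) (auto intro: Qdown)
      then obtain v where v: "v \<in> carrier W" "w = v \<otimes> wd (alt s t (m s t))" "len w = len v + m s t"
        unfolding Q_def by blast
      have "w \<otimes> s = v \<otimes> wd (alt s t (m s t) @ [s])"
        using v less.prems t al by (simp add: wd_append m_assoc)
      also have "wd (alt s t (m s t) @ [s]) = wd (alt s t (2 * m s t - Suc (m s t)))"
        unfolding alt_snoc using alt_braid[of s t "Suc (m s t)"] less.prems t * by simp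
      finally have "len (w \<otimes> s) \<le> len v + (2 * m s t - Suc (m s t))"
        using len_mult_le[OF v(1) wd_closed[OF al[of "2 * m s t - Suc (m s t)"]]]
          len_le[OF al[of "2 * m s t - Suc (m s t)"]] by simp
      then show False using v less.prems * by simp
    qed
    obtain p q where pq: "p \<ge> 0" "q \<ge> 0" "act (alt s t K) (simple s) = (\<lambda>x. p * simple s x + q * simple t x)"
      using alt_act_nonneg[OF less.prems(2) t(1) ts[symmetric] Km] by blast
    have "rep w (simple s) = rep v (act (alt s t K) (simple s))"
      using v al rep_mult rep_wd by simp
    also have "\<dots> = (\<lambda>x. p * rep v (simple s) x + q * rep v (simple t) x)"
      unfolding pq(3) using rep_lin v by simp
    finally have e: "rep w (simple s) = (\<lambda>x. p * rep v (simple s) x + q * rep v (simple t) x)" .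
    have "len v < len w" using v K' by simp
    then have "0 \<le> rep v (simple s) x" "0 \<le> rep v (simple t) x"
      using less.hyps[of v] v asc2 less.prems t by auto
    then show ?thesis using e pq by simp
  qed
qed

lemma rep_simple_nonpos:
  assumes w: "w \<in> carrier W" "s \<in> S" "len (w \<otimes> s) < len w"
  shows "rep w (simple s) x \<le> 0"
proof -
  have "0 \<le> rep (w \<otimes> s) (simple s) x"
    using rep_simple_nonneg[of "w \<otimes> s" s] w by simp
  also have "rep (w \<otimes> s) (simple s) x = - rep w (simple s) x"
    using w by (simp add: rep_mult reflect_simple_self rep_uminus)
  finally show ?thesis by simp
qed


section \<open>Roots and inversions\<close>

definition roots :: "('a \<Rightarrow> real) set"
  where "roots = {rep w (simple s) | w s. w \<in> carrier W \<and> s \<in> S}"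

definition pos_roots :: "('a \<Rightarrow> real) set"
  where "pos_roots = {\<beta> \<in> roots. \<forall>x. 0 \<le> \<beta> x}"

definition inv_roots :: "'a \<Rightarrow> ('a \<Rightarrow> real) set"
  where "inv_roots w = {\<beta> \<in> pos_roots. rep (inv w) \<beta> \<notin> pos_roots}"

lemma rep_roots: "\<lbrakk>w \<in> carrier W; \<beta> \<in> roots\<rbrakk> \<Longrightarrow> rep w \<beta> \<in> roots"
  unfolding roots_def using rep_mult[symmetric] m_closed by (smt (verit) mem_Collect_eq)

lemma simple_roots: "s \<in> S \<Longrightarrow> simple s \<in> roots"
  unfolding roots_def using rep_one[of "simple s", symmetric] by blast

lemma simple_pos [simp]: "s \<in> S \<Longrightarrow> simple s \<in> pos_roots"
  using simple_roots[of s] unfolding pos_roots_def simple_def by auto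

lemma uminus_roots: "\<beta> \<in> roots \<Longrightarrow> (\<lambda>x. - \<beta> x) \<in> roots"
proof -
  assume "\<beta> \<in> roots"
  then obtain w s where w: "w \<in> carrier W" "s \<in> S" "\<beta> = rep w (simple s)" by (auto simp: roots_def)
  then have "(\<lambda>x. - \<beta> x) = rep (w \<otimes> s) (simple s)"
    by (simp add: rep_mult reflect_simple_self rep_uminus)
  moreover have "w \<otimes> s \<in> carrier W" using w by simp
  ultimately show ?thesis unfolding roots_def using w by blast
qed

lemma root_cases: 
  assumes "\<beta> \<in> roots" shows "\<beta> \<in> pos_roots \<or> (\<lambda>x. - \<beta> x) \<in> pos_roots"
proof -
  obtain w s where w: "w \<in> carrier W" "s \<in> S" "\<beta> = rep w (simple s)" using assms by (auto simp: roots_def)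
  consider "len w < len (w \<otimes> s)" | "len (w \<otimes> s) < len w" using len_gen_right[OF w(1,2)] by linarith
  then show ?thesis
    using rep_simple_nonneg[OF w(1,2)] rep_simple_nonpos[OF w(1,2)] w assms uminus_roots
    by cases (auto simp: pos_roots_def)
qed

lemma pos_rootsD: "\<beta> \<in> pos_roots \<Longrightarrow> \<beta> \<in> roots" "\<beta> \<in> pos_roots \<Longrightarrow> 0 \<le> \<beta> x"
  by (auto simp: pos_roots_def)

lemma pos_rootsI: "\<lbrakk>\<beta> \<in> roots; \<And>x. 0 \<le> \<beta> x\<rbrakk> \<Longrightarrow> \<beta> \<in> pos_roots"
  by (simp add: pos_roots_def)

lemma root_norm: "\<beta> \<in> roots \<Longrightarrow> form \<beta> \<beta> = 2"
  by (auto simp: roots_def rep_form)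

lemma not_pos_uminus: "\<beta> \<in> pos_roots \<Longrightarrow> (\<lambda>x. - \<beta> x) \<notin> pos_roots"
proof
  assume "\<beta> \<in> pos_roots" "(\<lambda>x. - \<beta> x) \<in> pos_roots"
  then have "\<beta> x = 0" for x using pos_rootsD(2)[of _ x] by (metis neg_0_le_iff_le order_antisym)
  then have "form \<beta> \<beta> = 0" by (simp add: form_def)
  then show False using root_norm[of \<beta>] pos_rootsD(1) \<open>\<beta> \<in> pos_roots\<close> by fastforce
qed

lemma not_pos_iff: "\<beta> \<in> roots \<Longrightarrow> \<beta> \<notin> pos_roots \<longleftrightarrow> (\<lambda>x. - \<beta> x) \<in> pos_roots"
  using root_cases not_pos_uminus by blast

lemma not_pos_nonpos: "\<lbrakk>\<beta> \<in> roots; \<beta> \<notin> pos_roots\<rbrakk> \<Longrightarrow> \<beta> x \<le> 0"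
  using not_pos_iff pos_rootsD(2) by fastforce

lemma pos_if_coeff: "\<lbrakk>\<beta> \<in> roots; 0 < \<beta> x\<rbrakk> \<Longrightarrow> \<beta> \<in> pos_roots"
  using not_pos_nonpos[of \<beta> x] by fastforce

lemma act_support: "\<lbrakk>xs \<in> lists J; x \<notin> J\<rbrakk> \<Longrightarrow> act xs v x = v x"
  by (induction xs) (auto simp: reflect_def)

lemma root_support: "\<lbrakk>\<beta> \<in> roots; x \<notin> S\<rbrakk> \<Longrightarrow> \<beta> x = 0"
proof -
  assume "\<beta> \<in> roots" "x \<notin> S"
  then obtain w s where w: "w \<in> carrier W" "s \<in> S" "\<beta> = rep w (simple s)" by (auto simp: roots_def)
  obtain xs where "xs \<in> lists S" "wd xs = w" using ex_word w by auto
  then have "\<beta> x = simple s x" using w rep_wd[of xs] act_support \<open>x \<notin> S\<close> by metis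
  then show ?thesis using w \<open>x \<notin> S\<close> by (auto simp: simple_def)
qed

text \<open>Norm 2 leaves only the multiples 1 and -1 of a simple root, and the sign
  decides.\<close>

lemma pos_root_eq_simple:
  assumes "\<beta> \<in> pos_roots" "s \<in> S" "\<And>x. x \<noteq> s \<Longrightarrow> \<beta> x = 0"
  shows "\<beta> = simple s"
proof -
  have b: "\<beta> = (\<lambda>x. \<beta> s * simple s x + 0 * simple s x)" using assms(3) by (auto simp: simple_def)
  then have "form \<beta> \<beta> = \<beta> s * form (simple s) \<beta>" by (metis form_lin_left mult_zero_left add.right_neutral)
  also have "form (simple s) \<beta> = 2 * \<beta> s"
    using form_lin_right[of "simple s" "\<beta> s" "simple s" 0 "simple s"] b assms(2) by simp
  finally have "\<beta> s * \<beta> s = 1" using root_norm[of \<beta>] assms(1) pos_rootsD(1) by simp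
  moreover have "\<beta> s \<ge> 0" using assms pos_rootsD by blast
  ultimately have "\<beta> s = 1" by (metis abs_of_nonneg abs_square_eq_1 power2_eq_square)
  then show ?thesis using b by simp
qed

text \<open>A positive root other than the simple one has a positive coefficient away from
  \<open>s\<close>; the reflection does not touch it, and one positive coefficient decides the sign
  of a root.\<close>

lemma reflect_pos: 
  assumes "s \<in> S" "\<beta> \<in> pos_roots" "\<beta> \<noteq> simple s" shows "reflect s \<beta> \<in> pos_roots"
proof -
  obtain x where x: "x \<noteq> s" "\<beta> x \<noteq> 0" using pos_root_eq_simple assms by blast
  then have "0 < reflect s \<beta> x" using pos_rootsD(2)[OF assms(2), of x] by simp
  moreover have "reflect s \<beta> \<in> roots" using rep_roots[of s \<beta>] assms pos_rootsD by simp
  ultimately show ?thesis by (rule pos_if_coeff[rotated])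
qed

lemma reflect_simple_not_pos: "s \<in> S \<Longrightarrow> reflect s (simple s) \<notin> pos_roots"
  using not_pos_uminus[of "simple s"] reflect_simple_self by simp

lemma descent_right_iff:
  assumes "w \<in> carrier W" "s \<in> S"
  shows "len (w \<otimes> s) < len w \<longleftrightarrow> rep w (simple s) \<notin> pos_roots"
proof -
  have r: "rep w (simple s) \<in> roots" using assms by (auto simp: roots_def)
  consider "len w < len (w \<otimes> s)" | "len (w \<otimes> s) < len w" using len_gen_right[OF assms] by linarith
  then show ?thesis
  proof cases
    case 1 then show ?thesis using rep_simple_nonneg[OF assms] r by (auto simp: pos_roots_def)
  next
    case 2 
    then have "(\<lambda>x. - rep w (simple s) x) \<in> pos_roots"
      using rep_simple_nonpos[OF assms] uminus_roots[OF r] by (auto simp: pos_roots_def)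
    then show ?thesis using 2 not_pos_iff[OF r] by simp
  qed
qed

lemma simple_in_inv_roots_iff:
  assumes "w \<in> carrier W" "s \<in> S"
  shows "simple s \<in> inv_roots w \<longleftrightarrow> len (s \<otimes> w) < len w"
  using descent_right_iff[of "inv w" s] assms len_inv[of w] len_inv[of "s \<otimes> w"]
  by (simp add: inv_roots_def inv_mult_group)

lemma inv_roots_one [simp]: "inv_roots \<one> = {}"
  by (simp add: inv_roots_def)

lemma inv_roots_pos: "\<beta> \<in> inv_roots w \<Longrightarrow> \<beta> \<in> pos_roots"
  by (simp add: inv_roots_def)

lemma inv_roots_gen_mult:
  assumes "w \<in> carrier W" "s \<in> S" "\<beta> \<in> pos_roots" "\<beta> \<noteq> simple s"
  shows "\<beta> \<in> inv_roots (s \<otimes> w) \<longleftrightarrow> reflect s \<beta> \<in> inv_roots w"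
  using assms reflect_pos by (simp add: inv_roots_def inv_mult_group rep_mult)

lemma inv_roots_gen_simple:
  assumes "w \<in> carrier W" "s \<in> S"
  shows "simple s \<in> inv_roots (s \<otimes> w) \<longleftrightarrow> simple s \<notin> inv_roots w"
  using assms len_gen_left[of w s] by (auto simp: simple_in_inv_roots_iff)

lemma inv_roots_mult_gen:
  assumes w: "w \<in> carrier W" "q \<in> S" "rep w (simple q) \<in> pos_roots"
  shows "inv_roots (w \<otimes> q) = insert (rep w (simple q)) (inv_roots w)"
    and "rep w (simple q) \<notin> inv_roots w"
proof -
  show "rep w (simple q) \<notin> inv_roots w" using w by (simp add: inv_roots_def)
  show "inv_roots (w \<otimes> q) = insert (rep w (simple q)) (inv_roots w)"
  proof (rule Set.set_eqI)
    fix \<beta>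
    show "\<beta> \<in> inv_roots (w \<otimes> q) \<longleftrightarrow> \<beta> \<in> insert (rep w (simple q)) (inv_roots w)"
    proof (cases "\<beta> \<in> pos_roots")
      case True
      have *: "\<beta> \<in> inv_roots (w \<otimes> q) \<longleftrightarrow> reflect q (rep (inv w) \<beta>) \<notin> pos_roots"
        using w True by (simp add: inv_roots_def inv_mult_group rep_mult)
      define \<gamma> where "\<gamma> = rep (inv w) \<beta>"
      have \<gamma>: "\<gamma> \<in> roots" "\<beta> = rep w \<gamma>" using w True rep_roots pos_rootsD by (auto simp: \<gamma>_def)
      show ?thesis
      proof (cases "\<gamma> = simple q")
        case True
        then have "\<beta> \<in> inv_roots (w \<otimes> q)"
          using * reflect_simple_not_pos[OF w(2)] unfolding \<gamma>_def by metis
        moreover have "\<beta> = rep w (simple q)" using \<gamma>(2) True by metis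
        ultimately show ?thesis by blast
      next
        case False
        then have ne: "\<beta> \<noteq> rep w (simple q)" using w rep_inv(1) unfolding \<gamma>_def by metis
        have "reflect q \<gamma> \<in> pos_roots \<longleftrightarrow> \<gamma> \<in> pos_roots"
        proof
          assume "\<gamma> \<in> pos_roots" then show "reflect q \<gamma> \<in> pos_roots" using reflect_pos w False by blast
        next
          assume a: "reflect q \<gamma> \<in> pos_roots"
          have "reflect q \<gamma> \<noteq> simple q"
          proof
            assume "reflect q \<gamma> = simple q"
            then have "\<gamma> = (\<lambda>x. - simple q x)" using reflect_simple_self reflect_reflect w by metis
            then have "\<beta> = (\<lambda>x. - rep w (simple q) x)" using \<gamma> w rep_uminus by simp
            then show False using not_pos_uminus w True by blast
          qed
          then show "\<gamma> \<in> pos_roots" using reflect_pos[of q "reflect q \<gamma>"] a w by simp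
        qed
        then show ?thesis using * ne True by (simp add: \<gamma>_def inv_roots_def)
      qed
    next
      case False then show ?thesis using w by (auto simp: inv_roots_def)
    qed
  qed
qed

lemma ex_left_descent:
  assumes "w \<in> carrier W" "w \<noteq> \<one>"
  obtains s where "s \<in> S" "simple s \<in> inv_roots w" "len w = Suc (len (s \<otimes> w))"
proof -
  obtain xs where xs: "xs \<in> lists S" "wd xs = w" "length xs = len w" using assms ex_reduced by blast
  then obtain s ys where ys: "xs = s # ys" using assms(2) by (cases xs) auto
  then have s: "s \<in> S" "ys \<in> lists S" "w = s \<otimes> wd ys" using xs by auto
  then have "s \<otimes> w = wd ys" by simp
  then have "len (s \<otimes> w) < len w" using xs ys len_le[of ys] by simp
  then show ?thesis using that[of s] s simple_in_inv_roots_iff[of w s] assms len_gen_left[of w s] by auto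
qed

text \<open>A nontrivial element has a left descent, whose simple root is made negative by the
  inverse; so it cannot act as the identity.\<close>

lemma rep_faithful:
  assumes "x \<in> carrier W" "y \<in> carrier W" "\<And>v. rep x v = rep y v"
  shows "x = y"
proof (rule ccontr)
  assume "x \<noteq> y"
  define u where "u = inv x \<otimes> y"
  have u: "u \<in> carrier W" using assms by (simp add: u_def)
  have "y = x \<otimes> u" using assms unfolding u_def by (simp flip: m_assoc)
  then have "u \<noteq> \<one>" using \<open>x \<noteq> y\<close> assms by auto
  then obtain s where "s \<in> S" "simple s \<in> inv_roots u" using ex_left_descent u by blast
  moreover have "rep (inv u) v = v" for v
    using assms by (simp add: u_def inv_mult_group rep_mult)
  ultimately show False by (simp add: inv_roots_def)
qed

lemma rep_reflection:
  assumes "u \<in> carrier W" "s \<in> S"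
  shows "rep (u \<otimes> s \<otimes> inv u) v = (\<lambda>x. 1 * v x + (- form v (rep u (simple s))) * rep u (simple s) x)"
proof -
  have "rep (u \<otimes> s \<otimes> inv u) v = rep u (reflect s (rep (inv u) v))" using assms by (simp add: rep_mult)
  also have "\<dots> = (\<lambda>x. 1 * rep u (rep (inv u) v) x + (- form (rep (inv u) v) (simple s)) * rep u (simple s) x)"
    using assms unfolding reflect_eq by (simp only: rep_lin)
  also have "form (rep (inv u) v) (simple s) = form v (rep u (simple s))"
    using rep_form[of u "rep (inv u) v" "simple s"] assms by simp
  finally show ?thesis using assms by simp
qed

section \<open>Reflections, and inversions as roots\<close>

definition reflection_of :: "('a \<Rightarrow> real) \<Rightarrow> 'a"
  where "reflection_of \<beta> = (THE t. \<exists>u\<in>carrier W. \<exists>s\<in>S. \<beta> = rep u (simple s) \<and> t = u \<otimes> s \<otimes> inv u)"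

text \<open>The choice of \<open>u\<close> and \<open>s\<close> does not matter: the reflection acts
  by a formula in the root alone, and the action is faithful.\<close>

lemma reflection_of_rep:
  assumes "u \<in> carrier W" "s \<in> S"
  shows "reflection_of (rep u (simple s)) = u \<otimes> s \<otimes> inv u"
  unfolding reflection_of_def
proof (rule the_equality)
  show "\<exists>u'\<in>carrier W. \<exists>s'\<in>S. rep u (simple s) = rep u' (simple s') \<and> u \<otimes> s \<otimes> inv u = u' \<otimes> s' \<otimes> inv u'"
    using assms by blast
next
  fix t assume "\<exists>u'\<in>carrier W. \<exists>s'\<in>S. rep u (simple s) = rep u' (simple s') \<and> t = u' \<otimes> s' \<otimes> inv u'"
  then obtain u' s' where *: "u' \<in> carrier W" "s' \<in> S" "rep u (simple s) = rep u' (simple s')" "t = u' \<otimes> s' \<otimes> inv u'"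
    by blast
  show "t = u \<otimes> s \<otimes> inv u"
    using * assms rep_reflection[of u s] rep_reflection[of u' s'] by (intro rep_faithful) auto
qed

lemma rep_reflection_of:
  assumes "\<beta> \<in> roots" shows "rep (reflection_of \<beta>) v = (\<lambda>x. v x - form v \<beta> * \<beta> x)"
  using assms reflection_of_rep rep_reflection by (auto simp: roots_def)

lemma reflection_of_closed [simp]: "\<beta> \<in> roots \<Longrightarrow> reflection_of \<beta> \<in> carrier W"
  using reflection_of_rep by (auto simp: roots_def)

lemma reflection_of_simple [simp]: "s \<in> S \<Longrightarrow> reflection_of (simple s) = s"
  using reflection_of_rep[of "\<one>" s] by simp

lemma reflection_of_conj:
  assumes "\<beta> \<in> roots" "w \<in> carrier W"
  shows "reflection_of (rep w \<beta>) = w \<otimes> reflection_of \<beta> \<otimes> inv w"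
proof -
  obtain u s where u: "u \<in> carrier W" "s \<in> S" "\<beta> = rep u (simple s)" using assms by (auto simp: roots_def)
  then have "rep w \<beta> = rep (w \<otimes> u) (simple s)" using assms rep_mult by simp
  then show ?thesis using u assms by (simp add: reflection_of_rep inv_mult_group m_assoc)
qed

lemma reflection_of_square: 
  assumes "\<beta> \<in> roots" shows "reflection_of \<beta> \<otimes> reflection_of \<beta> = \<one>"
proof -
  obtain u s where u: "u \<in> carrier W" "s \<in> S" "\<beta> = rep u (simple s)" using assms by (auto simp: roots_def)
  have "inv u \<otimes> (u \<otimes> (s \<otimes> inv u)) = s \<otimes> inv u"
    using u by (simp flip: m_assoc)
  then show ?thesis using u by (simp add: reflection_of_rep m_assoc)
qed

lemma reflection_of_inj: "inj_on reflection_of pos_roots"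
proof (rule inj_onI)
  fix \<beta> \<gamma> assume *: "\<beta> \<in> pos_roots" "\<gamma> \<in> pos_roots" "reflection_of \<beta> = reflection_of \<gamma>"
  then have r: "\<beta> \<in> roots" "\<gamma> \<in> roots" using pos_rootsD by auto
  have "\<beta> x - form \<beta> \<beta> * \<beta> x = \<beta> x - form \<beta> \<gamma> * \<gamma> x" for x
    using rep_reflection_of[OF r(1), of \<beta>] rep_reflection_of[OF r(2), of \<beta>] *(3) by (metis)
  then have e: "2 * \<beta> x = form \<beta> \<gamma> * \<gamma> x" for x using root_norm[OF r(1)] by simp
  define c where "c = form \<beta> \<gamma> / 2"
  have b: "\<beta> = (\<lambda>x. c * \<gamma> x + 0 * \<gamma> x)" using e by (auto simp: c_def field_simps)
  have "form \<beta> \<beta> = c * c * 2" using b form_lin_left form_lin_right root_norm[OF r(2)]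
    by (metis add.right_neutral mult.assoc mult_zero_left)
  then have "c * c = 1" using root_norm[OF r(1)] by simp
  then consider "c = 1" | "c = -1" by (metis square_eq_1_iff)
  then show "\<beta> = \<gamma>"
  proof cases
    case 2
    then have "\<beta> = (\<lambda>x. - \<gamma> x)" using b by auto
    then show ?thesis using * not_pos_uminus by blast
  qed (use b in auto)
qed

lemma reflections_eq: "reflections W S = reflection_of ` pos_roots"
proof (intro equalityI subsetI)
  fix t assume "t \<in> reflections W S"
  then obtain u s where u: "u \<in> carrier W" "s \<in> S" "t = u \<otimes> s \<otimes> inv u" by (auto simp: reflections_def)
  let ?\<beta> = "rep u (simple s)"
  have r: "?\<beta> \<in> roots" using u by (auto simp: roots_def)
  have "reflection_of (\<lambda>x. - ?\<beta> x) = t"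
  proof -
    have "(\<lambda>x. - ?\<beta> x) = rep (u \<otimes> s) (simple s)"
      using u by (simp add: rep_mult reflect_simple_self rep_uminus)
    then show ?thesis using u by (simp add: reflection_of_rep inv_mult_group m_assoc)
  qed
  then show "t \<in> reflection_of ` pos_roots"
    using root_cases[OF r] reflection_of_rep[OF u(1,2)] u by (metis image_eqI)
next
  fix t assume "t \<in> reflection_of ` pos_roots"
  then show "t \<in> reflections W S"
    using reflection_of_rep by (auto simp: pos_roots_def roots_def reflections_def)
qed

text \<open>Strip a left descent \<open>s\<close> of \<open>w\<close>: another inversion is carried
  to an inversion of \<open>s \<otimes> w\<close>, and its reflection is conjugated by
  \<open>s\<close>. Putting \<open>s\<close> back costs at most one on the left-hand side and adds
  exactly one to the length of \<open>s \<otimes> w\<close>.\<close>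

lemma reflection_shortens:
  assumes "w \<in> carrier W" "\<beta> \<in> inv_roots w"
  shows "len (reflection_of \<beta> \<otimes> w) < len w"
  using assms
proof (induction "len w" arbitrary: w \<beta> rule: less_induct)
  case less
  have "w \<noteq> \<one>" using less.prems by auto
  then obtain s where s: "s \<in> S" "simple s \<in> inv_roots w" "len w = Suc (len (s \<otimes> w))"
    using ex_left_descent less.prems by blast
  have b: "\<beta> \<in> pos_roots" "\<beta> \<in> roots" using less.prems inv_roots_pos pos_rootsD by auto
  show ?case
  proof (cases "\<beta> = simple s")
    case True then show ?thesis using s by simp
  next
    case False
    then have "reflect s \<beta> \<in> inv_roots (s \<otimes> w)"
      using inv_roots_gen_mult[of "s \<otimes> w" s \<beta>] less.prems s b by simp
    then have "len (reflection_of (reflect s \<beta>) \<otimes> (s \<otimes> w)) < len (s \<otimes> w)"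
      using less.hyps[of "s \<otimes> w"] s less.prems by simp
    moreover have "reflection_of (reflect s \<beta>) = s \<otimes> reflection_of \<beta> \<otimes> s"
      using reflection_of_conj[of \<beta> s] b s by simp
    then have "reflection_of (reflect s \<beta>) \<otimes> (s \<otimes> w) = s \<otimes> (reflection_of \<beta> \<otimes> w)"
      using s b less.prems by (simp add: m_assoc)
    ultimately have "len (s \<otimes> (reflection_of \<beta> \<otimes> w)) < len (s \<otimes> w)" by simp
    then show ?thesis using s len_gen_left[of "reflection_of \<beta> \<otimes> w" s] b less.prems by auto
  qed
qed

text \<open>If the root is not an inversion of \<open>w\<close>, it is one of its reflection times
  \<open>w\<close>, and the first direction applied there reverses the inequality of lengths. This
  connects the definition of inversions by length with the roots.\<close>

lemma reflection_shortens_iff: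
  assumes "w \<in> carrier W" "\<beta> \<in> pos_roots"
  shows "len (reflection_of \<beta> \<otimes> w) < len w \<longleftrightarrow> \<beta> \<in> inv_roots w"
proof
  assume *: "len (reflection_of \<beta> \<otimes> w) < len w"
  let ?t = "reflection_of \<beta>"
  have r: "\<beta> \<in> roots" using assms pos_rootsD by blast
  show "\<beta> \<in> inv_roots w"
  proof (rule ccontr)
    assume "\<beta> \<notin> inv_roots w"
    then have p: "rep (inv w) \<beta> \<in> pos_roots" using assms by (simp add: inv_roots_def)
    have "inv ?t = ?t" using reflection_of_square[OF r] r by (simp add: inv_equality)
    then have "rep (inv (?t \<otimes> w)) \<beta> = rep (inv w) (rep ?t \<beta>)"
      using assms r by (simp add: inv_mult_group rep_mult)
    also have "rep ?t \<beta> = (\<lambda>x. - \<beta> x)" using rep_reflection_of[OF r] root_norm[OF r] by auto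
    also have "rep (inv w) \<dots> = (\<lambda>x. - rep (inv w) \<beta> x)" using rep_uminus assms by simp
    finally have "\<beta> \<in> inv_roots (?t \<otimes> w)" using assms p not_pos_uminus by (simp add: inv_roots_def)
    then have "len (?t \<otimes> (?t \<otimes> w)) < len (?t \<otimes> w)" using reflection_shortens r assms by simp
    moreover have "?t \<otimes> (?t \<otimes> w) = w" using reflection_of_square[OF r] r assms by (simp flip: m_assoc)
    ultimately show False using * by simp
  qed
qed (use reflection_shortens assms in blast)

lemma inversions_eq:
  assumes "w \<in> carrier W" shows "inversions W S w = reflection_of ` inv_roots w"
  unfolding inversions_def reflections_eq using reflection_shortens_iff[OF assms] inv_roots_pos by auto

lemma inversions_subset_iff:
  assumes "v \<in> carrier W" "w \<in> carrier W"
  shows "inversions W S v \<subseteq> inversions W S w \<longleftrightarrow> inv_roots v \<subseteq> inv_roots w"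
  unfolding inversions_eq[OF assms(1)] inversions_eq[OF assms(2)]
  using inj_onD[OF reflection_of_inj] inv_roots_pos by blast

section \<open>Climbing by covers in the weak order\<close>

text \<open>The element \<open>y \<otimes> q\<close> is a cover of \<open>y\<close> still below
  \<open>x\<close>: if \<open>y\<close> made the simple root of \<open>q\<close> negative, the
  opposite root would be an inversion of \<open>y\<close> but not of \<open>x\<close>.\<close>

lemma le_extend:
  assumes "x \<in> carrier W" "y \<in> carrier W" "inv_roots y \<subseteq> inv_roots x"
    and q: "q \<in> S" "simple q \<in> inv_roots (inv y \<otimes> x)"
  shows "rep y (simple q) \<in> pos_roots" "rep y (simple q) \<in> inv_roots x"
proof -
  let ?\<beta> = "rep y (simple q)"
  have r: "?\<beta> \<in> roots" using assms by (auto simp: roots_def)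
  have "rep (inv x) ?\<beta> = rep (inv (inv y \<otimes> x)) (simple q)"
    using assms by (simp add: inv_mult_group rep_mult)
  then have n: "rep (inv x) ?\<beta> \<notin> pos_roots" using q by (simp add: inv_roots_def)
  show p: "?\<beta> \<in> pos_roots"
  proof (rule ccontr)
    assume "?\<beta> \<notin> pos_roots"
    then have "(\<lambda>x. - ?\<beta> x) \<in> pos_roots" using not_pos_iff r by blast
    moreover have "rep (inv y) (\<lambda>x. - ?\<beta> x) = (\<lambda>x. - simple q x)" using rep_uminus assms by simp
    ultimately have "(\<lambda>x. - ?\<beta> x) \<in> inv_roots y" using not_pos_uminus q by (simp add: inv_roots_def)
    then have "(\<lambda>x. - ?\<beta> x) \<in> inv_roots x" using assms by blast
    then have "(\<lambda>z. - rep (inv x) ?\<beta> z) \<notin> pos_roots" using assms rep_uminus by (simp add: inv_roots_def)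
    then show False using n not_pos_iff rep_roots[of "inv x" ?\<beta>] r assms by simp
  qed
  show "?\<beta> \<in> inv_roots x" using p n by (simp add: inv_roots_def)
qed

text \<open>The last equation provides the measure for inductions that climb from \<open>y\<close>
  to \<open>x\<close>.\<close>

lemma le_cover:
  assumes "x \<in> carrier W" "y \<in> carrier W" "inv_roots y \<subseteq> inv_roots x" "y \<noteq> x"
  obtains q where "q \<in> S" "rep y (simple q) \<in> pos_roots" "rep y (simple q) \<in> inv_roots x"
    "len (inv y \<otimes> x) = Suc (len (inv (y \<otimes> q) \<otimes> x))"
proof -
  have "x = y \<otimes> (inv y \<otimes> x)" using assms by (simp flip: m_assoc)
  then have "inv y \<otimes> x \<noteq> \<one>" using assms by auto
  then obtain q where q: "q \<in> S" "simple q \<in> inv_roots (inv y \<otimes> x)"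
    "len (inv y \<otimes> x) = Suc (len (q \<otimes> (inv y \<otimes> x)))"
    using ex_left_descent assms by blast
  moreover have "inv (y \<otimes> q) \<otimes> x = q \<otimes> (inv y \<otimes> x)" using assms q by (simp add: inv_mult_group m_assoc)
  ultimately show ?thesis using that[of q] le_extend[OF assms(1-3)] by simp
qed

lemma inv_roots_inj:
  assumes "x \<in> carrier W" "y \<in> carrier W" "inv_roots y = inv_roots x" shows "x = y"
proof (rule ccontr)
  assume "x \<noteq> y"
  then obtain q where "q \<in> S" "rep y (simple q) \<in> pos_roots" "rep y (simple q) \<in> inv_roots x"
    using le_cover assms by (metis order_refl)
  then show False using inv_roots_mult_gen(2)[of y q] assms by simp
qed

lemma len_le_if_le:
  assumes "x \<in> carrier W" "y \<in> carrier W" "inv_roots y \<subseteq> inv_roots x"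
  shows "len y \<le> len x \<and> (y \<noteq> x \<longrightarrow> len y < len x)"
  using assms
proof (induction "len (inv y \<otimes> x)" arbitrary: y rule: less_induct)
  case less
  show ?case
  proof (cases "y = x")
    case False
    then obtain q where q: "q \<in> S" "rep y (simple q) \<in> pos_roots" "rep y (simple q) \<in> inv_roots x"
      "len (inv y \<otimes> x) = Suc (len (inv (y \<otimes> q) \<otimes> x))" using le_cover less.prems by blast
    have "inv_roots (y \<otimes> q) \<subseteq> inv_roots x"
      using inv_roots_mult_gen(1)[OF less.prems(2) q(1,2)] q less.prems by simp
    then have "len (y \<otimes> q) \<le> len x" using less.hyps[of "y \<otimes> q"] q less.prems by simp
    moreover have "len y < len (y \<otimes> q)" 
      using descent_right_iff[OF less.prems(2) q(1)] q len_gen_right[OF less.prems(2) q(1)] by auto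
    ultimately show ?thesis by simp
  qed simp
qed

section \<open>Parabolic subgroups and joins in the weak order\<close>

abbreviation below :: "'a \<Rightarrow> 'a \<Rightarrow> bool" (infix "\<preceq>" 50)
  where "v \<preceq> w \<equiv> inv_roots v \<subseteq> inv_roots w"

definition supp :: "'a set \<Rightarrow> ('a \<Rightarrow> real) \<Rightarrow> bool"
  where "supp J v \<longleftrightarrow> (\<forall>x. x \<notin> J \<longrightarrow> v x = 0)"

text \<open>Stated through inversions because supports of roots are what later arguments control;
  \<open>para_eq_generate\<close> identifies it with the subgroup generated by
  \<open>J\<close>.\<close>

definition para :: "'a set \<Rightarrow> 'a set"
  where "para J = {w \<in> carrier W. \<forall>\<beta>\<in>inv_roots w. supp J \<beta>}"

lemma paraD: "w \<in> para J \<Longrightarrow> w \<in> carrier W" "\<lbrakk>w \<in> para J; \<beta> \<in> inv_roots w\<rbrakk> \<Longrightarrow> supp J \<beta>"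
  by (auto simp: para_def)

lemma suppD: "\<lbrakk>supp J v; x \<notin> J\<rbrakk> \<Longrightarrow> v x = 0"
  by (simp add: supp_def)

lemma supp_mono: "\<lbrakk>supp J v; J \<subseteq> K\<rbrakk> \<Longrightarrow> supp K v"
  by (auto simp: supp_def)

lemma para_mono: "J \<subseteq> K \<Longrightarrow> para J \<subseteq> para K"
  using supp_mono by (auto simp: para_def)

lemma supp_simple [simp]: "supp J (simple s) \<longleftrightarrow> s \<in> J"
  by (auto simp: supp_def simple_def)

lemma supp_reflect: "s \<in> J \<Longrightarrow> supp J (reflect s v) \<longleftrightarrow> supp J v"
  by (auto simp: supp_def reflect_def)

lemma para_one [simp]: "\<one> \<in> para J"
  by (simp add: para_def)

lemma para_gen_mult:
  assumes "w \<in> para J" "s \<in> J" "s \<in> S" shows "s \<otimes> w \<in> para J"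
proof -
  have "supp J \<beta>" if b: "\<beta> \<in> inv_roots (s \<otimes> w)" for \<beta>
  proof (cases "\<beta> = simple s")
    case False
    then have "reflect s \<beta> \<in> inv_roots w"
      using inv_roots_gen_mult b inv_roots_pos paraD(1) assms by blast
    then show ?thesis using paraD(2) supp_reflect assms by blast
  qed (use assms in simp)
  then show ?thesis using assms by (simp add: para_def)
qed

lemma para_gen: "\<lbrakk>s \<in> J; s \<in> S\<rbrakk> \<Longrightarrow> s \<in> para J"
  using para_gen_mult[OF para_one, of s J] by simp

lemma para_word:
  assumes "w \<in> para J"
  obtains xs where "xs \<in> lists (J \<inter> S)" "wd xs = w" "length xs = len w"
proof -
  have "\<exists>xs\<in>lists (J \<inter> S). wd xs = w \<and> length xs = len w"
    using assms
  proof (induction "len w" arbitrary: w rule: less_induct)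
    case less
    show ?case
    proof (cases "w = \<one>")
      case True then show ?thesis by (intro bexI[of _ "[]"]) auto
    next
      case False
      obtain s where s: "s \<in> S" "simple s \<in> inv_roots w" "len w = Suc (len (s \<otimes> w))"
        using ex_left_descent False less.prems paraD by metis
      then have "s \<in> J" using less.prems paraD by fastforce
      then have "s \<otimes> w \<in> para J" using para_gen_mult less.prems s by blast
      then obtain xs where "xs \<in> lists (J \<inter> S)" "wd xs = s \<otimes> w" "length xs = len (s \<otimes> w)"
        using less.hyps[of "s \<otimes> w"] s by auto
      then show ?thesis using s \<open>s \<in> J\<close> less.prems paraD(1) by (intro bexI[of _ "s # xs"]) auto
    qed
  qed
  then show ?thesis using that by blast
qed

lemma word_para: 
  assumes "xs \<in> lists J" "J \<subseteq> S" shows "wd xs \<in> para J"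
  using assms by (induction xs) (auto intro: para_gen_mult)

lemma para_eq_generate: "J \<subseteq> S \<Longrightarrow> para J = generate W J"
  using generate_iff_word[of J] word_para para_word by (metis inf.absorb1 subsetI subset_antisym)

lemma rep_para: 
  assumes "w \<in> para J" "x \<notin> J" shows "rep w v x = v x"
proof -
  obtain xs where xs: "xs \<in> lists (J \<inter> S)" "wd xs = w" using para_word assms by metis
  then show ?thesis using act_support[OF xs(1), of x v] rep_wd[of xs] assms by auto
qed

lemma para_inv:
  assumes "w \<in> para J" shows "inv w \<in> para J"
proof -
  obtain xs where xs: "xs \<in> lists (J \<inter> S)" "wd xs = w" using para_word assms by metis
  then have "rev xs \<in> lists (J \<inter> S)" by (auto simp: in_lists_conv_set)
  moreover have "xs \<in> lists S" using xs by auto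
  ultimately have "inv w \<in> para (J \<inter> S)" using word_para[of "rev xs" "J \<inter> S"] inv_wd[of xs] xs(2) by simp
  then show ?thesis using para_mono by blast
qed

lemma supp_rep: "w \<in> para J \<Longrightarrow> supp J (rep w v) \<longleftrightarrow> supp J v"
  by (simp add: supp_def rep_para)

lemma para_mult_gen:
  assumes "w \<in> para J" "s \<in> J" "s \<in> S" shows "w \<otimes> s \<in> para J"
proof -
  have "s \<otimes> inv w \<in> para J" using para_gen_mult para_inv assms by blast
  then have "inv (s \<otimes> inv w) \<in> para J" by (rule para_inv)
  then show ?thesis using assms paraD(1) by (simp add: inv_mult_group)
qed

lemma rep_sum:
  assumes "w \<in> carrier W" "finite A"
  shows "rep w (\<lambda>x. \<Sum>t\<in>A. c t * f t x) = (\<lambda>x. \<Sum>t\<in>A. c t * rep w (f t) x)"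
  using assms(2)
proof (induction A rule: finite_induct)
  case empty
  then show ?case using rep_lin[OF assms(1), of 0 "\<lambda>x. 0" 0 "\<lambda>x. 0"] by simp
next
  case (insert a A)
  then show ?case 
    using rep_lin[OF assms(1), of "c a" "f a" 1 "\<lambda>x. \<Sum>t\<in>A. c t * f t x"] by simp
qed

lemma expand_simple:
  assumes "supp J v" "finite J" shows "v = (\<lambda>x. \<Sum>t\<in>J. v t * simple t x)"
proof
  fix x
  have "(\<Sum>t\<in>J. v t * simple t x) = (\<Sum>t\<in>J. if t = x then v t else 0)"
    by (rule sum.cong) (auto simp: simple_def)
  then show "v x = (\<Sum>t\<in>J. v t * simple t x)" using assms by (auto simp: supp_def)
qed

lemma rep_expand:
  assumes "supp J v" "finite J" "w \<in> carrier W"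
  shows "rep w v x = (\<Sum>t\<in>J. v t * rep w (simple t) x)"
  using rep_sum[OF assms(3,2), of v simple] expand_simple[OF assms(1,2)] by metis

lemma finite_sub: "J \<subseteq> S \<Longrightarrow> finite J"
  using finite_S finite_subset by blast

lemma rep_pos_if_simple_pos:
  assumes "w \<in> carrier W" "J \<subseteq> S" "\<And>q. q \<in> J \<Longrightarrow> rep w (simple q) \<in> pos_roots"
    and "\<beta> \<in> pos_roots" "supp J \<beta>"
  shows "rep w \<beta> \<in> pos_roots"
proof -
  have "0 \<le> rep w \<beta> x" for x
    using rep_expand[OF assms(5) finite_sub[OF assms(2)] assms(1)] assms(3,4) pos_rootsD(2)
    by (auto intro!: sum_nonneg)
  then show ?thesis using pos_rootsI rep_roots[OF assms(1) pos_rootsD(1)[OF assms(4)]] by blast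
qed

lemma nonpos_not_pos: "\<lbrakk>\<beta> \<in> roots; \<And>x. \<beta> x \<le> 0\<rbrakk> \<Longrightarrow> \<beta> \<notin> pos_roots"
  using not_pos_uminus[of "\<lambda>x. - \<beta> x"] uminus_roots[of \<beta>] by (auto simp: pos_roots_def)

lemma inv_roots_if_descents:
  assumes "w \<in> carrier W" "J \<subseteq> S" "\<And>q. q \<in> J \<Longrightarrow> simple q \<in> inv_roots w"
    and "\<beta> \<in> pos_roots" "supp J \<beta>"
  shows "\<beta> \<in> inv_roots w"
proof -
  have "rep (inv w) (simple q) x \<le> 0" if "q \<in> J" for q x
    using assms(3)[OF that] not_pos_nonpos rep_roots[of "inv w" "simple q"] assms(1) simple_roots[of q] that assms(2)
    by (auto simp: inv_roots_def)
  then have "rep (inv w) \<beta> x \<le> 0" for x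
    using rep_expand[OF assms(5) finite_sub[OF assms(2)]] assms(1) pos_rootsD(2)[OF assms(4)]
    by (auto intro!: sum_nonpos mult_nonneg_nonpos)
  then show ?thesis using nonpos_not_pos rep_roots[of "inv w" \<beta>] assms(1,4) pos_rootsD(1) by (simp add: inv_roots_def)
qed

definition restr :: "'a set \<Rightarrow> 'a \<Rightarrow> ('a \<Rightarrow> real) set"
  where "restr J w = {\<beta> \<in> inv_roots w. supp J \<beta>}"

lemma restr_mono: "v \<preceq> w \<Longrightarrow> restr J v \<subseteq> restr J w"
  by (auto simp: restr_def)

text \<open>Take a longest \<open>v\<close> in the parabolic subgroup below \<open>w\<close>;
  lengths are bounded by that of \<open>w\<close>. In \<open>w = v \<otimes> u\<close> maximality
  leaves \<open>u\<close> without left descents in \<open>J\<close>, so \<open>inv u\<close> keeps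
  positive roots supported on \<open>J\<close> positive. An inversion of \<open>w\<close> supported
  on \<open>J\<close> must then already be one of \<open>v\<close>.\<close>

lemma parabolic_part_exists:
  assumes w: "w \<in> carrier W" and J: "J \<subseteq> S"
  obtains v where "v \<in> para J" "inv_roots v = restr J w"
proof -
  define P where "P v \<longleftrightarrow> v \<in> para J \<and> v \<preceq> w" for v
  have bd: "\<forall>v. P v \<longrightarrow> len v < Suc (len w)"
    using len_le_if_le[OF w] paraD(1) unfolding P_def less_Suc_eq_le by blast
  have "P \<one>" by (simp add: P_def)
  then obtain v where v: "P v" "\<And>v'. P v' \<Longrightarrow> len v' \<le> len v"
    using ex_has_greatest_nat[of P \<one> len "Suc (len w)"] bd by blast
  have vp: "v \<in> para J" "v \<in> carrier W" "v \<preceq> w" using v paraD by (auto simp: P_def)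
  define u where "u = inv v \<otimes> w"
  have u: "u \<in> carrier W" "w = v \<otimes> u" using vp w by (auto simp: u_def simp flip: m_assoc)
  have nod: "simple q \<notin> inv_roots u" if "q \<in> J" for q
  proof
    assume a: "simple q \<in> inv_roots u"
    have q: "q \<in> S" using that J by auto
    note e = le_extend[OF w vp(2,3) q a[unfolded u_def]]
    have "P (v \<otimes> q)" using para_mult_gen[OF vp(1) that q] inv_roots_mult_gen(1)[OF vp(2) q e(1)] e vp
      by (simp add: P_def)
    moreover have "len v < len (v \<otimes> q)" 
      using descent_right_iff[OF vp(2) q] e len_gen_right[OF vp(2) q] by auto
    ultimately show False using v(2) by fastforce
  qed
  have "\<beta> \<in> inv_roots v" if b: "\<beta> \<in> inv_roots w" "supp J \<beta>" for \<beta>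
  proof (rule ccontr)
    assume "\<beta> \<notin> inv_roots v"
    define \<gamma> where "\<gamma> = rep (inv v) \<beta>"
    have "\<gamma> \<in> pos_roots" using \<open>\<beta> \<notin> inv_roots v\<close> b(1) unfolding inv_roots_def \<gamma>_def by blast
    moreover have "supp J \<gamma>" using b supp_rep para_inv vp by (simp add: \<gamma>_def)
    moreover have "rep (inv u) (simple q) \<in> pos_roots" if "q \<in> J" for q
      using nod[OF that] simple_pos[of q] that J unfolding inv_roots_def by blast
    ultimately have "rep (inv u) \<gamma> \<in> pos_roots" using rep_pos_if_simple_pos[of "inv u" J] u J by simp
    moreover have "rep (inv u) \<gamma> = rep (inv w) \<beta>" using u vp by (simp add: \<gamma>_def rep_mult inv_mult_group)
    ultimately show False using b by (simp add: inv_roots_def)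
  qed
  then have "inv_roots v = restr J w" using vp paraD by (auto simp: restr_def)
  then show ?thesis using that vp by blast
qed

lemma inv_roots_mult:
  assumes "y \<in> carrier W" "v \<in> carrier W" "\<And>\<beta>. \<beta> \<in> inv_roots v \<Longrightarrow> rep y \<beta> \<in> pos_roots"
  shows "inv_roots (y \<otimes> v) = inv_roots y \<union> rep y ` inv_roots v"
proof (rule Set.set_eqI)
  fix \<beta>
  show "\<beta> \<in> inv_roots (y \<otimes> v) \<longleftrightarrow> \<beta> \<in> inv_roots y \<union> rep y ` inv_roots v"
  proof (cases "\<beta> \<in> pos_roots")
    case True
    define \<gamma> where "\<gamma> = rep (inv y) \<beta>"
    have b: "\<beta> = rep y \<gamma>" using assms(1) by (simp add: \<gamma>_def)
    have r: "\<gamma> \<in> roots" using True assms rep_roots pos_rootsD by (simp add: \<gamma>_def)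
    have 1: "\<beta> \<in> inv_roots (y \<otimes> v) \<longleftrightarrow> rep (inv v) \<gamma> \<notin> pos_roots"
      using True assms by (simp add: inv_roots_def inv_mult_group rep_mult \<gamma>_def)
    have 2: "\<beta> \<in> inv_roots y \<longleftrightarrow> \<gamma> \<notin> pos_roots" using True by (simp add: inv_roots_def \<gamma>_def)
    have 3: "\<beta> \<in> rep y ` inv_roots v \<longleftrightarrow> \<gamma> \<in> inv_roots v"
    proof
      assume "\<beta> \<in> rep y ` inv_roots v"
      then show "\<gamma> \<in> inv_roots v" using assms(1) by (auto simp: \<gamma>_def)
    qed (use b in blast)
    show ?thesis
    proof (cases "\<gamma> \<in> pos_roots")
      case True then show ?thesis using 1 2 3 by (simp add: inv_roots_def[of v])
    next
      case False
      then have n: "(\<lambda>x. - \<gamma> x) \<in> pos_roots" using not_pos_iff r by blast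
      have "rep (inv v) \<gamma> \<notin> pos_roots"
      proof
        assume "rep (inv v) \<gamma> \<in> pos_roots"
        then have "(\<lambda>x. - \<gamma> x) \<in> inv_roots v"
          using n rep_uminus not_pos_uminus assms(2) by (simp add: inv_roots_def)
        then have "(\<lambda>x. - \<beta> x) \<in> pos_roots" using assms(3) rep_uminus b assms(1) by fastforce
        then show False using not_pos_uminus True by blast
      qed
      then show ?thesis using 1 2 False by simp
    qed
  next
    case False
    then show ?thesis using assms(3) by (auto simp: inv_roots_def[of y] inv_roots_def[of "y \<otimes> v"])
  qed
qed

text \<open>Induction over the polygon spanned by two covers of \<open>y\<^sub>0\<close>.  Keeping track of the inversions
  in a parabolic subgroup yields besides the existence of bounded joins also that passing to
  the parabolic part commutes with certain joins.\<close>

lemma interpolation: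
  assumes "J \<subseteq> S" "X \<subseteq> carrier W" "X \<noteq> {}" "y0 \<in> carrier W" "y1 \<in> carrier W" "y2 \<in> carrier W"
    and "y0 \<preceq> y1" "y0 \<preceq> y2" "\<And>x. x \<in> X \<Longrightarrow> y1 \<preceq> x" "\<And>x. x \<in> X \<Longrightarrow> y2 \<preceq> x"
    and "restr J y0 = restr J y1"
  shows "\<exists>y\<in>carrier W. y1 \<preceq> y \<and> y2 \<preceq> y \<and> (\<forall>x\<in>X. y \<preceq> x) \<and> restr J y = restr J y2"
proof -
  \<comment> \<open>Any member of \<open>X\<close> bounds the climb; its distance in length from
    \<open>y0\<close> is the measure.\<close>
  obtain x0 where x0: "x0 \<in> X" "x0 \<in> carrier W" using assms by auto
  show ?thesis using assms(4-)
  proof (induction "len x0 - len y0" arbitrary: y0 y1 y2 rule: less_induct)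
    case less
    show ?case
    proof (cases "y1 = y0 \<or> y2 = y0")
      case True
      then show ?thesis using less.prems by (metis order_refl)
    next
      case False
      note c = less.prems(1-3) and b1 = less.prems(6) and b2 = less.prems(7)
      obtain q1 where q1: "q1 \<in> S" "rep y0 (simple q1) \<in> pos_roots" "rep y0 (simple q1) \<in> inv_roots y1"
        using le_cover[OF c(2,1) less.prems(4)] False by metis
      obtain q2 where q2: "q2 \<in> S" "rep y0 (simple q2) \<in> pos_roots" "rep y0 (simple q2) \<in> inv_roots y2"
        using le_cover[OF c(3,1) less.prems(5)] False by metis
      define z1 where "z1 = y0 \<otimes> q1"
      define z2 where "z2 = y0 \<otimes> q2"
      let ?b1 = "rep y0 (simple q1)" and ?b2 = "rep y0 (simple q2)"
      have zc: "z1 \<in> carrier W" "z2 \<in> carrier W" using c q1 q2 by (auto simp: z1_def z2_def)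
      have n1: "inv_roots z1 = insert ?b1 (inv_roots y0)" "?b1 \<notin> inv_roots y0"
        using inv_roots_mult_gen[OF c(1) q1(1,2)] by (auto simp: z1_def)
      have n2: "inv_roots z2 = insert ?b2 (inv_roots y0)" "?b2 \<notin> inv_roots y0"
        using inv_roots_mult_gen[OF c(1) q2(1,2)] by (auto simp: z2_def)
      have le: "z1 \<preceq> y1" "z2 \<preceq> y2" using n1 n2 q1 q2 less.prems by auto
      have ns: "\<not> supp J ?b1" using less.prems(8) n1(2) q1(3) by (auto simp: restr_def)
      then have r1: "restr J z1 = restr J y1" using less.prems(8) n1 by (auto simp: restr_def)
      have "z1 \<preceq> x0" "z2 \<preceq> x0" using le b1 b2 x0 by blast+
      then have "len z1 \<le> len x0" "len z2 \<le> len x0" using len_le_if_le zc x0 by auto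
      moreover have "len y0 < len z1" "len y0 < len z2"
        using len_le_if_le[of z1 y0] len_le_if_le[of z2 y0] zc c n1 n2 by auto
      ultimately have dec: "len x0 - len z1 < len x0 - len y0" "len x0 - len z2 < len x0 - len y0" by auto
      show ?thesis
      proof (cases "q1 = q2")
        case True
        then have "z1 = z2" by (simp add: z1_def z2_def)
        then show ?thesis using less.hyps[OF dec(1) zc(1) c(2,3) le(1) _ b1 b2 r1] le by simp
      next
        case False
        define I where "I = {q1, q2}"
        have I: "I \<subseteq> S" "finite I" using q1 q2 by (auto simp: I_def)
        have isI: "simple q \<in> inv_roots (inv y0 \<otimes> x0)" if "q \<in> I" for q
        proof -
          have "rep y0 (simple q) \<in> inv_roots x0" using that q1 q2 b1 b2 x0 by (auto simp: I_def)
          then show ?thesis using that I c x0 simple_pos[of q]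
            by (auto simp: inv_roots_def inv_mult_group rep_mult)
        qed
        \<comment> \<open>Both \<open>q1\<close> and \<open>q2\<close> are descents of
          \<open>inv y0 \<otimes> x0\<close>, so every positive root supported on \<open>I\<close>
          becomes an inversion of \<open>p\<close>. Thus \<open>p\<close> is the longest element of
          the dihedral group, whose finiteness is forced by the upper bound, and
          \<open>y0 \<otimes> p\<close> is the top of the polygon.\<close>
        obtain p where p: "p \<in> para I" "inv_roots p = restr I (inv y0 \<otimes> x0)"
          using parabolic_part_exists[of "inv y0 \<otimes> x0" I] I c x0 by auto
        have p_in: "\<beta> \<in> inv_roots p" if "\<beta> \<in> pos_roots" "supp I \<beta>" for \<beta>
          using inv_roots_if_descents[of "inv y0 \<otimes> x0" I] isI I c x0 p that by (auto simp: restr_def)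
        have ex: "rep w \<beta> x = \<beta> q1 * rep w (simple q1) x + \<beta> q2 * rep w (simple q2) x"
          if "w \<in> carrier W" "\<beta> \<in> inv_roots p" for w \<beta> x
          using rep_expand[of I \<beta> w x] I paraD(2)[OF p(1) that(2)] that False by (simp add: I_def)
        have nn: "0 \<le> \<beta> x" if "\<beta> \<in> inv_roots p" for \<beta> x
          using that inv_roots_pos pos_rootsD by blast
        have pos: "rep y0 \<beta> \<in> pos_roots" if b: "\<beta> \<in> inv_roots p" for \<beta>
        proof -
          have "0 \<le> rep y0 \<beta> x" for x
            using ex[OF c(1) b] nn[OF b] pos_rootsD(2)[OF q1(2)] pos_rootsD(2)[OF q2(2)] by simp
          then show ?thesis
            using pos_rootsI rep_roots[OF c(1) pos_rootsD(1)[OF inv_roots_pos[OF b]]] by blast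
        qed
        define y where "y = y0 \<otimes> p"
        have yc: "y \<in> carrier W" using c p paraD by (simp add: y_def)
        have ny: "inv_roots y = inv_roots y0 \<union> rep y0 ` inv_roots p"
          unfolding y_def using inv_roots_mult[of y0 p] c p paraD(1) pos by blast
        have zy: "z1 \<preceq> y" "z2 \<preceq> y"
          using p_in[of "simple q1"] p_in[of "simple q2"] q1 q2 unfolding ny n1(1) n2(1) by (auto simp: I_def)
        have yx: "y \<preceq> x" if x: "x \<in> X" for x
        proof -
          have xc: "x \<in> carrier W" using x assms by auto
          have "rep y0 \<beta> \<in> inv_roots x" if b: "\<beta> \<in> inv_roots p" for \<beta>
          proof -
            have "?b1 \<in> inv_roots x" "?b2 \<in> inv_roots x" using q1 q2 b1 b2 x by auto
            then have "rep (inv x) ?b1 z \<le> 0" "rep (inv x) ?b2 z \<le> 0" for z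
              using not_pos_nonpos rep_roots xc pos_rootsD(1) by (auto simp: inv_roots_def)
            then have "rep (inv x \<otimes> y0) \<beta> z \<le> 0" for z
              using ex[of "inv x \<otimes> y0", OF _ b] nn[OF b] xc c
              by (simp add: rep_mult add_nonpos_nonpos mult_nonneg_nonpos)
            moreover have "rep (inv x \<otimes> y0) \<beta> \<in> roots" using rep_roots xc c b inv_roots_pos pos_rootsD(1) by simp
            ultimately have "rep (inv x \<otimes> y0) \<beta> \<notin> pos_roots" using nonpos_not_pos by blast
            then show ?thesis using pos[OF b] xc c by (simp add: rep_mult inv_roots_def)
          qed
          then show ?thesis unfolding ny using less.prems(4) b1[OF x] by blast
        qed
        \<comment> \<open>Climbing from \<open>z2\<close> to the top adds no inversion supported on
          \<open>J\<close>: each new one has a positive share of \<open>?b1\<close>, which has a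
          coordinate outside \<open>J\<close> that cannot be cancelled.\<close>
        have ry: "restr J y = restr J z2"
        proof
          show "restr J z2 \<subseteq> restr J y" using restr_mono zy by blast
          show "restr J y \<subseteq> restr J z2"
          proof
            fix \<beta> assume "\<beta> \<in> restr J y"
            then have b: "\<beta> \<in> inv_roots y" "supp J \<beta>" by (auto simp: restr_def)
            show "\<beta> \<in> restr J z2"
            proof (cases "\<beta> \<in> inv_roots y0")
              case True then show ?thesis using b n2 by (auto simp: restr_def)
            next
              case False
              then obtain \<gamma> where g: "\<gamma> \<in> inv_roots p" "\<beta> = rep y0 \<gamma>" using b ny by auto
              have "\<gamma> q1 = 0"
              proof (rule ccontr)
                assume "\<gamma> q1 \<noteq> 0"
                have "?b1 x = 0" if x: "x \<notin> J" for x
                proof -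
                  have "\<gamma> q1 * ?b1 x + \<gamma> q2 * ?b2 x = 0" using ex[OF c(1) g(1)] g(2) suppD[OF b(2) x] by simp
                  moreover have "0 \<le> \<gamma> q1 * ?b1 x" "0 \<le> \<gamma> q2 * ?b2 x"
                    using nn[OF g(1)] q1 q2 pos_rootsD(2) by auto
                  ultimately show ?thesis using \<open>\<gamma> q1 \<noteq> 0\<close> by (simp add: add_nonneg_eq_0_iff)
                qed
                then show False using ns by (simp add: supp_def)
              qed
              then have "\<gamma> = simple q2"
                using paraD(2)[OF p(1) g(1)] inv_roots_pos[OF g(1)] q2(1)
                by (intro pos_root_eq_simple) (auto simp: supp_def I_def)
              then show ?thesis using g b n2 by (auto simp: restr_def)
            qed
          qed
        qed
        \<comment> \<open>The top \<open>y\<close> is joined with \<open>y2\<close> above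
          \<open>z2\<close>, and the result with \<open>y1\<close> above \<open>z1\<close>. In both
          applications the first element to be joined adds no inversion supported on
          \<open>J\<close>.\<close>
        obtain y3 where y3: "y3 \<in> carrier W" "y \<preceq> y3" "y2 \<preceq> y3" "\<forall>x\<in>X. y3 \<preceq> x" "restr J y3 = restr J y2"
          using less.hyps[OF dec(2) zc(2) yc c(3) zy(2) le(2) yx b2 ry[symmetric]] by auto
        have "z1 \<preceq> y3" using zy y3 by blast
        then obtain y4 where "y4 \<in> carrier W" "y1 \<preceq> y4" "y3 \<preceq> y4" "\<forall>x\<in>X. y4 \<preceq> x" "restr J y4 = restr J y3"
          using less.hyps[OF dec(1) zc(1) c(2) y3(1) le(1) _ b1 _ r1] y3(4) by blast
        then show ?thesis using y3 by (intro bexI[of _ y4]) auto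
      qed
    qed
  qed
qed

section \<open>Least upper bounds\<close>

definition is_lub :: "'a \<Rightarrow> 'a \<Rightarrow> 'a \<Rightarrow> bool"
  where "is_lub x y z \<longleftrightarrow> z \<in> carrier W \<and> x \<preceq> z \<and> y \<preceq> z \<and>
    (\<forall>u\<in>carrier W. x \<preceq> u \<longrightarrow> y \<preceq> u \<longrightarrow> z \<preceq> u)"

lemma is_lubD:
  assumes "is_lub x y z"
  shows "z \<in> carrier W" "x \<preceq> z" "y \<preceq> z" "\<lbrakk>u \<in> carrier W; x \<preceq> u; y \<preceq> u\<rbrakk> \<Longrightarrow> z \<preceq> u"
  using assms by (auto simp: is_lub_def)

lemma is_lub_unique: "\<lbrakk>is_lub x y z; is_lub x y z'\<rbrakk> \<Longrightarrow> z = z'"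
  by (meson inv_roots_inj is_lubD subset_antisym)

lemma is_lub_commute: "is_lub x y z \<Longrightarrow> is_lub y x z"
  by (simp add: is_lub_def)

lemma restr_one [simp]: "restr J \<one> = {}"
  by (simp add: restr_def)

lemma restr_empty: "restr {} w = {}"
proof -
  have False if "\<beta> \<in> inv_roots w" "supp {} \<beta>" for \<beta>
  proof -
    have "form \<beta> \<beta> = 0" using that(2) by (simp add: form_def supp_def)
    then show False using root_norm[of \<beta>] that inv_roots_pos pos_rootsD(1) by fastforce
  qed
  then show ?thesis by (auto simp: restr_def)
qed

text \<open>A shortest common upper bound is least: interpolation against any other one gives a
  common upper bound below both, which cannot be strictly shorter. The empty \<open>J\<close> makes
  the clause on restrictions vacuous.\<close>

lemma lub_exists:
  assumes "x \<in> carrier W" "y \<in> carrier W" "u \<in> carrier W" "x \<preceq> u" "y \<preceq> u"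
  obtains z where "is_lub x y z" "z \<preceq> u"
proof -
  define P where "P z \<longleftrightarrow> z \<in> carrier W \<and> x \<preceq> z \<and> y \<preceq> z" for z
  have "P u" using assms by (simp add: P_def)
  then obtain z where z: "P z" "\<And>z'. P z' \<Longrightarrow> len z \<le> len z'" by (metis exists_least_iff not_le ex_has_least_nat)
  have "z \<preceq> u'" if u': "u' \<in> carrier W" "x \<preceq> u'" "y \<preceq> u'" for u'
  proof -
    have "\<exists>y'\<in>carrier W. x \<preceq> y' \<and> y \<preceq> y' \<and> (\<forall>v\<in>{z,u'}. y' \<preceq> v) \<and> restr {} y' = restr {} y"
    proof (rule interpolation[where ?y0.0 = "\<one>" and J = "{}"])
      show "\<And>v. v \<in> {z, u'} \<Longrightarrow> x \<preceq> v" "\<And>v. v \<in> {z, u'} \<Longrightarrow> y \<preceq> v" "{z, u'} \<subseteq> carrier W"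
        using z(1) u' by (auto simp: P_def)
    qed (use assms in \<open>simp_all add: restr_empty\<close>)
    then obtain y' where "y' \<in> carrier W" "x \<preceq> y'" "y \<preceq> y'" "y' \<preceq> z" "y' \<preceq> u'" by auto
    moreover from this have "len z \<le> len y'" using z(2)[of y'] unfolding P_def by blast
    ultimately have "y' = z" using z(1) len_le_if_le[of z y'] unfolding P_def by fastforce
    then show ?thesis using \<open>y' \<preceq> u'\<close> by simp
  qed
  then have "is_lub x y z" using z by (simp add: is_lub_def P_def)
  then show ?thesis using that is_lubD(4) assms by blast
qed

text \<open>Interpolation from the identity below the single bound \<open>z\<close> produces an
  upper bound with the restricted inversions of \<open>y\<close>; leastness identifies it with
  \<open>z\<close>.\<close>

lemma restr_lub:
  assumes "is_lub x y z" "x \<in> carrier W" "y \<in> carrier W" "J \<subseteq> S" "restr J x = {}"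
  shows "restr J z = restr J y"
proof -
  obtain y' where y': "y' \<in> carrier W" "x \<preceq> y'" "y \<preceq> y'" "y' \<preceq> z" "restr J y' = restr J y"
    using interpolation[of J "{z}" "\<one>" x y] assms is_lubD[OF assms(1)] by auto
  have "z \<preceq> y'" using is_lubD(4)[OF assms(1) y'(1-3)] .
  then have "z = y'" using y'(4) by (intro inv_roots_inj[OF is_lubD(1)[OF assms(1)] y'(1)] subset_antisym)
  then show ?thesis using y' by simp
qed

lemma gen_mult_mono:
  assumes "x \<preceq> y" "x \<in> carrier W" "y \<in> carrier W" "s \<in> S"
    and "simple s \<in> inv_roots x \<longleftrightarrow> simple s \<in> inv_roots y"
  shows "s \<otimes> x \<preceq> s \<otimes> y"
proof
  fix \<beta> assume b: "\<beta> \<in> inv_roots (s \<otimes> x)"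
  show "\<beta> \<in> inv_roots (s \<otimes> y)"
  proof (cases "\<beta> = simple s")
    case True then show ?thesis using b inv_roots_gen_simple assms by simp
  next
    case False
    then show ?thesis using b inv_roots_gen_mult[of _ s \<beta>] inv_roots_pos[OF b] assms by blast
  qed
qed

text \<open>Multiplication by \<open>s\<close> is an order isomorphism from the elements above
  \<open>s\<close> to those not above \<open>s\<close>. An upper bound \<open>u\<close> of the
  products may itself lie above \<open>s\<close>; passing to the join \<open>z'\<close>, which is
  also below \<open>s \<otimes> z\<close>, avoids this.\<close>

lemma is_lub_gen_mult:
  assumes lub: "is_lub x y z" and c: "x \<in> carrier W" "y \<in> carrier W" "s \<in> S"
    and s: "simple s \<in> inv_roots x" "simple s \<in> inv_roots y"
  shows "is_lub (s \<otimes> x) (s \<otimes> y) (s \<otimes> z)"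
proof -
  note z = is_lubD[OF lub]
  have sz: "simple s \<in> inv_roots z" using s z by auto
  have up: "s \<otimes> x \<preceq> s \<otimes> z" "s \<otimes> y \<preceq> s \<otimes> z" using gen_mult_mono c z s sz by blast+
  have "s \<otimes> z \<preceq> u" if u: "u \<in> carrier W" "s \<otimes> x \<preceq> u" "s \<otimes> y \<preceq> u" for u
  proof -
    obtain z' where z': "is_lub (s \<otimes> x) (s \<otimes> y) z'" "z' \<preceq> u"
      using lub_exists[of "s \<otimes> x" "s \<otimes> y" u] u c by auto
    note z'D = is_lubD[OF z'(1)]
    have "z' \<preceq> s \<otimes> z" using z'D(4) up z(1) c by simp
    moreover have "simple s \<notin> inv_roots (s \<otimes> z)" using sz inv_roots_gen_simple z c by simp
    ultimately have nz': "simple s \<notin> inv_roots z'" by blast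
    then have sz': "simple s \<in> inv_roots (s \<otimes> z')" using inv_roots_gen_simple z'D c by simp
    have nx: "simple s \<notin> inv_roots (s \<otimes> x)" "simple s \<notin> inv_roots (s \<otimes> y)"
      using inv_roots_gen_simple s c by auto
    have "x \<preceq> s \<otimes> z'" using gen_mult_mono[of "s \<otimes> x" z' s] z'D nx nz' c by simp
    moreover have "y \<preceq> s \<otimes> z'" using gen_mult_mono[of "s \<otimes> y" z' s] z'D nx nz' c by simp
    ultimately have "z \<preceq> s \<otimes> z'" using z(4) z'D c by simp
    then have "s \<otimes> z \<preceq> s \<otimes> (s \<otimes> z')" using gen_mult_mono[of z "s \<otimes> z'" s] z z'D c sz sz' by simp
    then show ?thesis using z'D c z' by auto
  qed
  then show ?thesis using up z c by (simp add: is_lub_def)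
qed

section \<open>The Euler form\<close>

text \<open>Of two letters, the later one has to be in the first argument for \<open>euler\<close> not to vanish on the
  simple roots.\<close>

primrec euler :: "'a list \<Rightarrow> ('a \<Rightarrow> real) \<Rightarrow> ('a \<Rightarrow> real) \<Rightarrow> real" where
  "euler [] u v = 0"
| "euler (s # cs) u v = u s * v s + v s * (\<Sum>t\<in>set cs. cartan t s * u t) + euler cs u v"

definition omega :: "'a list \<Rightarrow> ('a \<Rightarrow> real) \<Rightarrow> ('a \<Rightarrow> real) \<Rightarrow> real"
  where "omega cs u v = euler cs u v - euler cs v u"

lemma euler_lin_left: "euler cs (\<lambda>x. a * u x + b * v x) w = a * euler cs u w + b * euler cs v w"
  by (induction cs) (simp_all add: algebra_simps sum.distrib sum_distrib_left)

lemma euler_lin_right: "euler cs w (\<lambda>x. a * u x + b * v x) = a * euler cs w u + b * euler cs w v"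
  by (induction cs) (simp_all add: algebra_simps sum.distrib sum_distrib_left)

lemma omega_lin_right: "omega cs w (\<lambda>x. a * u x + b * v x) = a * omega cs w u + b * omega cs w v"
  by (simp add: omega_def euler_lin_left euler_lin_right algebra_simps)

lemma omega_antisym: "omega cs u v = - omega cs v u"
  by (simp add: omega_def)

lemma euler_cong: "\<lbrakk>\<And>x. x \<in> set cs \<Longrightarrow> u x = u' x; \<And>x. x \<in> set cs \<Longrightarrow> v x = v' x\<rbrakk> \<Longrightarrow> euler cs u v = euler cs u' v'"
proof (induction cs)
  case (Cons s cs)
  have "(\<Sum>t\<in>set cs. cartan t s * u t) = (\<Sum>t\<in>set cs. cartan t s * u' t)"
    using Cons.prems by (intro sum.cong) auto
  then show ?case using Cons by simp
qed simp

lemma euler_skip: "\<lbrakk>u s = 0; v s = 0\<rbrakk> \<Longrightarrow> euler (s # cs) u v = euler cs u v"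
  by simp

lemma euler_zero_left: "(\<And>x. x \<in> set cs \<Longrightarrow> u x = 0) \<Longrightarrow> euler cs u v = 0"
  by (induction cs) auto

lemma euler_zero_right: "(\<And>x. x \<in> set cs \<Longrightarrow> v x = 0) \<Longrightarrow> euler cs u v = 0"
  by (induction cs) auto

lemma euler_snoc: 
  assumes "distinct (cs @ [s])" "set (cs @ [s]) \<subseteq> S"
  shows "euler (cs @ [s]) u v = euler cs u v + u s * v s + u s * (\<Sum>t\<in>set cs. cartan t s * v t)"
  using assms
proof (induction cs)
  case (Cons a cs)
  have "(\<Sum>t\<in>insert s (set cs). cartan t a * u t) = cartan s a * u s + (\<Sum>t\<in>set cs. cartan t a * u t)"
    using Cons.prems by (subst sum.insert) auto
  moreover have "(\<Sum>t\<in>insert a (set cs). cartan t s * v t) = cartan a s * v a + (\<Sum>t\<in>set cs. cartan t s * v t)"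
    using Cons.prems by (subst sum.insert) auto
  ultimately show ?case using Cons cartan_sym[of a s] by (simp add: algebra_simps)
qed simp

lemma euler_form:
  assumes "distinct cs" "set cs \<subseteq> S" "supp (set cs) u" "supp (set cs) v"
  shows "euler cs u v + euler cs v u = form u v"
proof -
  have "euler cs u v + euler cs v u = (\<Sum>s\<in>set cs. \<Sum>t\<in>set cs. cartan s t * u s * v t)"
    using assms(1,2)
  proof (induction cs)
    case (Cons s cs)
    let ?K = "set cs"
    have "(\<Sum>a\<in>insert s ?K. \<Sum>b\<in>insert s ?K. cartan a b * u a * v b)
      = (\<Sum>b\<in>insert s ?K. cartan s b * u s * v b) + (\<Sum>a\<in>?K. \<Sum>b\<in>insert s ?K. cartan a b * u a * v b)"
      using Cons.prems by (subst sum.insert) auto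
    also have "(\<Sum>b\<in>insert s ?K. cartan s b * u s * v b) = 2 * u s * v s + u s * (\<Sum>b\<in>?K. cartan b s * v b)"
    proof -
      have "(\<Sum>b\<in>insert s ?K. cartan s b * u s * v b) = cartan s s * u s * v s + (\<Sum>b\<in>?K. cartan s b * u s * v b)"
        using Cons.prems by (subst sum.insert) auto
      also have "(\<Sum>b\<in>?K. cartan s b * u s * v b) = u s * (\<Sum>b\<in>?K. cartan b s * v b)"
        using Cons.prems cartan_sym[of s] by (auto simp: sum_distrib_left intro!: sum.cong)
      finally show ?thesis using Cons.prems by simp
    qed
    also have "(\<Sum>a\<in>?K. \<Sum>b\<in>insert s ?K. cartan a b * u a * v b)
      = v s * (\<Sum>a\<in>?K. cartan a s * u a) + (\<Sum>a\<in>?K. \<Sum>b\<in>?K. cartan a b * u a * v b)"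
    proof -
      have "(\<Sum>b\<in>insert s ?K. cartan a b * u a * v b) = v s * (cartan a s * u a) + (\<Sum>b\<in>?K. cartan a b * u a * v b)" for a
        using Cons.prems by (subst sum.insert) auto
      then show ?thesis by (simp add: sum.distrib sum_distrib_left)
    qed
    finally show ?case using Cons by (simp add: algebra_simps)
  qed simp
  also have "\<dots> = (\<Sum>s\<in>set cs. \<Sum>t\<in>S. cartan s t * u s * v t)"
    using assms finite_S by (intro sum.cong refl sum.mono_neutral_left) (auto simp: supp_def)
  also have "\<dots> = form u v" unfolding form_def
    using assms finite_S by (intro sum.mono_neutral_left) (auto simp: supp_def)
  finally show ?thesis .
qed

lemma euler_initial:
  assumes "distinct (s # cs)" shows "euler (s # cs) (simple s) v = v s"
proof -
  have "x \<in> set cs \<Longrightarrow> simple s x = 0" for x using assms by (auto simp: simple_def)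
  then have "(\<Sum>t\<in>set cs. cartan t s * simple s t) = 0" "euler cs (simple s) v = 0"
    by (auto intro!: euler_zero_left sum.neutral)
  then show ?thesis by (simp add: simple_def)
qed

lemma euler_final:
  assumes "distinct (cs @ [s])" "set (cs @ [s]) \<subseteq> S" shows "euler (cs @ [s]) v (simple s) = v s"
proof -
  have "x \<in> set cs \<Longrightarrow> simple s x = 0" for x using assms by (auto simp: simple_def)
  then have "(\<Sum>t\<in>set cs. cartan t s * simple s t) = 0" "euler cs v (simple s) = 0"
    by (auto intro!: euler_zero_right sum.neutral)
  then show ?thesis using euler_snoc[OF assms] by (simp add: simple_def)
qed

lemma omega_initial:
  assumes "distinct (s # cs)" shows "omega (s # cs) (simple s) v = - (\<Sum>t\<in>set cs. cartan t s * v t)"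
proof -
  have "x \<in> set cs \<Longrightarrow> simple s x = 0" for x using assms by (auto simp: simple_def)
  then have "euler cs v (simple s) = 0" by (auto intro!: euler_zero_right)
  then show ?thesis using euler_initial[OF assms] by (simp add: omega_def simple_def)
qed

lemma omega_final:
  assumes "distinct (cs @ [s])" "set (cs @ [s]) \<subseteq> S"
  shows "omega (cs @ [s]) v (simple s) = - (\<Sum>t\<in>set cs. cartan t s * v t)"
proof -
  have "x \<in> set cs \<Longrightarrow> simple s x = 0" for x using assms by (auto simp: simple_def)
  then have "euler cs (simple s) v = 0" by (auto intro!: euler_zero_left)
  then show ?thesis using euler_final[OF assms] euler_snoc[OF assms, of "simple s" v] by (simp add: omega_def simple_def)
qed

text \<open>Let A(u) be the sum of \<open>cartan t s * u t\<close> over \<open>cs\<close>. The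
  reflection replaces \<open>u s\<close> by \<open>- u s - A(u)\<close> and changes no other
  coordinate. The contribution of \<open>s\<close> as last letter is then
  \<open>(- u s - A(u)) * (- v s)\<close>, its former contribution as first letter.\<close>

lemma euler_rotate:
  assumes "distinct (s # cs)" "set (s # cs) \<subseteq> S" "supp (set (s # cs)) u" "supp (set (s # cs)) v"
  shows "euler (cs @ [s]) (reflect s u) (reflect s v) = euler (s # cs) u v"
proof -
  have f: "form w (simple s) = 2 * w s + (\<Sum>t\<in>set cs. cartan t s * w t)" if "supp (set (s # cs)) w" for w
  proof -
    have "(\<Sum>t\<in>S-{s}. cartan t s * w t) = (\<Sum>t\<in>set cs. cartan t s * w t)"
      using assms that finite_S by (intro sum.mono_neutral_right) (auto simp: supp_def)
    then show ?thesis using form_simple_expand[of s w] assms by simp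
  qed
  have o: "x \<in> set cs \<Longrightarrow> reflect s w x = w x" for x w using assms(1) by (auto simp: reflect_def)
  have "(\<Sum>t\<in>set cs. cartan t s * reflect s v t) = (\<Sum>t\<in>set cs. cartan t s * v t)"
    using o by (intro sum.cong) auto
  moreover have "euler cs (reflect s u) (reflect s v) = euler cs u v" using o by (intro euler_cong) auto
  moreover have "distinct (cs @ [s])" "set (cs @ [s]) \<subseteq> S" using assms by auto
  ultimately have "euler (cs @ [s]) (reflect s u) (reflect s v) = euler cs u v + reflect s u s * reflect s v s 
     + reflect s u s * (\<Sum>t\<in>set cs. cartan t s * v t)"
    using euler_snoc[of cs s "reflect s u" "reflect s v"] by simp
  then show ?thesis using f[OF assms(3)] f[OF assms(4)] by (simp add: reflect_def algebra_simps)
qed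

lemma omega_rotate:
  assumes "distinct (s # cs)" "set (s # cs) \<subseteq> S" "supp (set (s # cs)) u" "supp (set (s # cs)) v"
  shows "omega (cs @ [s]) (reflect s u) (reflect s v) = omega (s # cs) u v"
  using euler_rotate assms unfolding omega_def by presburger

section \<open>Sortable elements\<close>

text \<open>One letter of the infinite word is processed at a time: an initial letter \<open>s\<close> that is not
  used is discarded for good, a used one is moved to the end.\<close>

inductive srt :: "'a list \<Rightarrow> 'a \<Rightarrow> bool" where
  nil: "srt [] \<one>"
| skip: "srt cs w \<Longrightarrow> srt (s # cs) w"
| take: "\<lbrakk>srt (cs @ [s]) u; simple s \<notin> inv_roots u\<rbrakk> \<Longrightarrow> srt (s # cs) (s \<otimes> u)"

definition letters :: "'a list \<Rightarrow> bool"
  where "letters cs \<longleftrightarrow> distinct cs \<and> set cs \<subseteq> S"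

lemma letters_Cons [simp]: "letters (s # cs) \<longleftrightarrow> s \<in> S \<and> s \<notin> set cs \<and> letters cs"
  by (auto simp: letters_def)

lemma letters_snoc [simp]: "letters (cs @ [s]) \<longleftrightarrow> s \<in> S \<and> s \<notin> set cs \<and> letters cs"
  by (auto simp: letters_def)

lemma lettersD: "letters cs \<Longrightarrow> distinct cs" "letters cs \<Longrightarrow> set cs \<subseteq> S"
  by (auto simp: letters_def)

lemma srt_para:
  assumes "srt cs w" "letters cs" shows "w \<in> para (set cs)"
  using assms
proof (induction rule: srt.induct)
  case (skip cs w s)
  then show ?case using para_mono[of "set cs" "set (s # cs)"] by auto
next
  case (take cs s u)
  then show ?case by (auto intro!: para_gen_mult)
qed simp

lemma srt_carrier: "\<lbrakk>srt cs w; letters cs\<rbrakk> \<Longrightarrow> w \<in> carrier W"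
  using srt_para paraD(1) by blast

lemma simple_not_inv_para: "\<lbrakk>w \<in> para J; s \<notin> J\<rbrakk> \<Longrightarrow> simple s \<notin> inv_roots w"
  using paraD(2) supp_simple by blast

text \<open>The rules exclude each other: after \<open>skip\<close> the element lies in a parabolic
  subgroup without \<open>s\<close>, after \<open>take\<close> it has \<open>s\<close> as a descent.
  So \<open>srt\<close> is a deterministic recursion, decreasing in the pair of length and number of
  letters.\<close>

lemma srt_Cons:
  assumes "letters (s # cs)" "w \<in> carrier W"
  shows "srt (s # cs) w \<longleftrightarrow> (if simple s \<in> inv_roots w then srt (cs @ [s]) (s \<otimes> w) else srt cs w)"
proof
  assume "srt (s # cs) w"
  then show "if simple s \<in> inv_roots w then srt (cs @ [s]) (s \<otimes> w) else srt cs w"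
  proof cases
    case skip
    then have "simple s \<notin> inv_roots w" using srt_para[of cs w] assms simple_not_inv_para by auto
    then show ?thesis using skip by simp
  next
    case (take u)
    then have "u \<in> carrier W" using srt_carrier[of "cs @ [s]" u] assms by simp
    then show ?thesis using take assms inv_roots_gen_simple by simp
  qed
next
  assume *: "if simple s \<in> inv_roots w then srt (cs @ [s]) (s \<otimes> w) else srt cs w"
  show "srt (s # cs) w"
  proof (cases "simple s \<in> inv_roots w")
    case True
    then have "srt (s # cs) (s \<otimes> (s \<otimes> w))" using * True assms inv_roots_gen_simple[of w s] by (intro srt.take) auto
    then show ?thesis using assms by simp
  qed (use * in \<open>auto intro: srt.skip\<close>)
qed

lemma len_gen_descent: "\<lbrakk>w \<in> carrier W; s \<in> S; simple s \<in> inv_roots w\<rbrakk> \<Longrightarrow> len w = Suc (len (s \<otimes> w))"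
  using simple_in_inv_roots_iff[of w s] len_gen_left[of w s] by auto

lemma para_empty: "w \<in> para {} \<Longrightarrow> w = \<one>"
  using ex_left_descent[of w] simple_not_inv_para[of w "{}"] paraD(1)[of w "{}"] by auto

lemma srt_Nil: "srt [] w \<longleftrightarrow> w = \<one>"
  by (auto elim: srt.cases intro: srt.nil)

lemma srt_one: "srt cs \<one>"
  by (induction cs) (auto intro: srt.intros)

lemma reflect_simple_commute:
  assumes "p \<in> S" "q \<in> S" "p \<noteq> q" "p \<otimes> q = q \<otimes> p"
  shows "reflect p (simple q) = simple q"
proof (rule inj_onD[OF reflection_of_inj])
  have "simple q \<noteq> simple p" using assms by (auto simp: simple_def fun_eq_iff)
  then show "reflect p (simple q) \<in> pos_roots" using reflect_pos assms by simp
  have "reflection_of (reflect p (simple q)) = p \<otimes> q \<otimes> p"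
    using reflection_of_conj[of "simple q" p] assms simple_roots by simp
  also have "\<dots> = q" using assms by (simp add: m_assoc)
  finally show "reflection_of (reflect p (simple q)) = reflection_of (simple q)" using assms by simp
qed (use assms in simp)

text \<open>With the pair in front, commutation makes the two descent tests independent. If both
  letters are taken, they are adjacent again at the end and the element has become shorter.\<close>

lemma srt_swap:
  assumes "letters (as @ [p, q] @ bs)" "p \<otimes> q = q \<otimes> p" "w \<in> carrier W"
  shows "srt (as @ [p, q] @ bs) w \<longleftrightarrow> srt (as @ [q, p] @ bs) w"
  using assms
proof (induction "(len w, length (as @ bs))" arbitrary: w as bs
    rule: wf_induct_rule[OF wf_lex_prod[OF wf_less_than wf_less_than]])
  case less: 1
  have pq: "p \<in> S" "q \<in> S" "p \<noteq> q" using less.prems by (auto simp: letters_def)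
  show ?case
  proof (cases as)
    case Nil
    have L: "letters (p # q # bs)" "letters (q # p # bs)" using less.prems Nil by (auto simp: letters_def)
    have L': "letters (q # bs @ [p])" "letters (p # bs @ [q])" using L by auto
    have sp: "simple p \<noteq> simple q" "simple q \<noteq> simple p" using pq by (auto simp: simple_def fun_eq_iff)
    have 1: "simple q \<in> inv_roots (p \<otimes> w) \<longleftrightarrow> simple q \<in> inv_roots w"
      using inv_roots_gen_mult[of w p "simple q"] reflect_simple_commute[of p q] pq less.prems sp by simp
    have 2: "simple p \<in> inv_roots (q \<otimes> w) \<longleftrightarrow> simple p \<in> inv_roots w"
      using inv_roots_gen_mult[of w q "simple p"] reflect_simple_commute[of q p] pq less.prems sp by simp
    have e: "p \<otimes> (q \<otimes> w) = q \<otimes> (p \<otimes> w)" using less.prems pq by (simp flip: m_assoc)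
    have c: "p \<otimes> w \<in> carrier W" "q \<otimes> w \<in> carrier W" using less.prems pq by auto
    have IH: "srt (bs @ [p, q] @ []) (q \<otimes> (p \<otimes> w)) \<longleftrightarrow> srt (bs @ [q, p] @ []) (q \<otimes> (p \<otimes> w))"
      if "simple p \<in> inv_roots w" "simple q \<in> inv_roots w"
    proof (rule less.hyps)
      have "len w = Suc (len (p \<otimes> w))" using that pq less.prems by (intro len_gen_descent) auto
      moreover have "len (p \<otimes> w) = Suc (len (q \<otimes> (p \<otimes> w)))"
        using that 1 pq c by (intro len_gen_descent) auto
      ultimately show "((len (q \<otimes> (p \<otimes> w)), length (bs @ [])), len w, length (as @ bs)) \<in> less_than <*lex*> less_than"
        by simp
    qed (use less.prems L pq in \<open>auto simp: letters_def\<close>)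
    show ?thesis
      using IH 1 2 e srt_Cons[OF L(1)] srt_Cons[OF L(2)] srt_Cons[OF L'(1) c(1)] srt_Cons[OF L'(2) c(2)]
        srt_Cons[of q bs w] srt_Cons[of p bs w] L less.prems Nil
      by (simp split: if_splits)
  next
    case (Cons a as')
    have L: "letters (a # as' @ [p, q] @ bs)" "letters (a # as' @ [q, p] @ bs)"
      using less.prems Cons by (auto simp: letters_def)
    show ?thesis
    proof (cases "simple a \<in> inv_roots w")
      case True
      have "len w = Suc (len (a \<otimes> w))" using True L less.prems by (intro len_gen_descent) auto
      then have "srt (as' @ [p, q] @ (bs @ [a])) (a \<otimes> w) \<longleftrightarrow> srt (as' @ [q, p] @ (bs @ [a])) (a \<otimes> w)"
        using L less.prems by (intro less.hyps) (auto simp: letters_def)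
      then show ?thesis using srt_Cons[OF L(1)] srt_Cons[OF L(2)] less.prems Cons True by simp
    next
      case False
      have "srt (as' @ [p, q] @ bs) w \<longleftrightarrow> srt (as' @ [q, p] @ bs) w"
        using L less.prems Cons by (intro less.hyps) (auto simp: letters_def)
      then show ?thesis using srt_Cons[OF L(1)] srt_Cons[OF L(2)] less.prems Cons False by simp
    qed
  qed
qed

lemma srt_move_to_front:
  assumes "letters (as @ s # bs)" "\<forall>a\<in>set as. a \<otimes> s = s \<otimes> a" "w \<in> carrier W"
  shows "srt (as @ s # bs) w \<longleftrightarrow> srt (s # as @ bs) w"
  using assms
proof (induction as arbitrary: bs rule: rev_induct)
  case (snoc a as)
  have "srt ((as @ [a]) @ s # bs) w \<longleftrightarrow> srt (as @ [s, a] @ bs) w"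
    using srt_swap[of as a s bs w] snoc.prems by simp
  also have "\<dots> \<longleftrightarrow> srt (s # as @ (a # bs)) w"
    using snoc.IH[of "a # bs"] snoc.prems by (auto simp: letters_def)
  finally show ?case by simp
qed simp

text \<open>A letter outside \<open>P\<close> is never a descent of an element of the parabolic
  subgroup, and the recursion stays in that subgroup; so such letters are discarded when
  met.\<close>

lemma srt_filter:
  assumes "letters cs" "w \<in> para P"
  shows "srt cs w \<longleftrightarrow> srt (filter (\<lambda>x. x \<in> P) cs) w"
  using assms
proof (induction "(len w, length cs)" arbitrary: w cs
    rule: wf_induct_rule[OF wf_lex_prod[OF wf_less_than wf_less_than]])
  case less: 1
  have wc: "w \<in> carrier W" using less.prems paraD by blast
  show ?case
  proof (cases cs)
    case (Cons a cs')
    have L: "letters (a # cs')" using less.prems Cons by simp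
    show ?thesis
    proof (cases "simple a \<in> inv_roots w")
      case True
      then have a: "a \<in> P" using simple_not_inv_para less.prems by blast
      have L': "letters (a # filter (\<lambda>x. x \<in> P) cs')" using L by (auto simp: letters_def)
      have "len w = Suc (len (a \<otimes> w))" using True L wc by (intro len_gen_descent) auto
      then have "srt (cs' @ [a]) (a \<otimes> w) \<longleftrightarrow> srt (filter (\<lambda>x. x \<in> P) (cs' @ [a])) (a \<otimes> w)"
        using L less.prems a by (intro less.hyps para_gen_mult) auto
      then show ?thesis using srt_Cons[OF L wc] srt_Cons[OF L' wc] True a Cons by simp
    next
      case False
      have L': "letters (a # filter (\<lambda>x. x \<in> P) cs')" using L by (auto simp: letters_def)
      have "srt cs' w \<longleftrightarrow> srt (filter (\<lambda>x. x \<in> P) cs') w"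
        using L less.prems Cons by (intro less.hyps) auto
      then show ?thesis using srt_Cons[OF L wc] srt_Cons[OF L' wc] False Cons by simp
    qed
  qed simp
qed

lemma srt_insert:
  assumes "letters (as @ s # bs)" "w \<in> para (set (as @ bs))"
  shows "srt (as @ s # bs) w \<longleftrightarrow> srt (as @ bs) w"
proof -
  have "filter (\<lambda>x. x \<in> set (as @ bs)) (as @ s # bs) = as @ bs"
    using assms(1) by (auto simp: letters_def filter_id_conv)
  then show ?thesis using srt_filter[OF assms] by simp
qed

text \<open>Since \<open>q\<close> is not a left descent, letters are taken alternately starting
  with \<open>p\<close>, exactly as they come in the infinite word.\<close>

lemma srt_rank_two:
  assumes "p \<in> S" "q \<in> S" "p \<noteq> q" "w \<in> para {p, q}" "simple q \<notin> inv_roots w"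
  shows "srt [p, q] w"
  using assms
proof (induction "len w" arbitrary: w p q rule: less_induct)
  case less
  have wc: "w \<in> carrier W" using less.prems paraD by blast
  have L: "letters [p, q]" "letters [q]" using less.prems by (auto simp: letters_def)
  show ?case
  proof (cases "simple p \<in> inv_roots w")
    case True
    have "len w = Suc (len (p \<otimes> w))" using True less.prems wc by (intro len_gen_descent) auto
    then have "srt [q, p] (p \<otimes> w)"
      using less.prems True wc inv_roots_gen_simple[OF wc, of p] para_gen_mult[of w "{q, p}" p]
      by (intro less.hyps) (auto simp: insert_commute)
    then show ?thesis using srt_Cons[OF L(1) wc] True by simp
  next
    case False
    have "w = \<one>"
    proof (rule ccontr)
      assume "w \<noteq> \<one>"
      then obtain s where "s \<in> S" "simple s \<in> inv_roots w" using ex_left_descent wc by blast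
      then show False using False less.prems simple_not_inv_para[of w "{p, q}" s] by auto
    qed
    then show ?thesis by (simp add: srt_one)
  qed
qed

section \<open>Root sequences and their order under the skew form\<close>

text \<open>The root sequence of a word. For a reduced word it enumerates the inversions, see
  \<open>inv_roots_rseq\<close>.\<close>

primrec rseq :: "'a list \<Rightarrow> ('a \<Rightarrow> real) list" where
  "rseq [] = []"
| "rseq (a # xs) = simple a # map (reflect a) (rseq xs)"

lemma length_rseq [simp]: "length (rseq xs) = length xs"
  by (induction xs) auto

lemma rseq_nth: "i < length xs \<Longrightarrow> rseq xs ! i = act (take i xs) (simple (xs ! i))"
  by (induction xs arbitrary: i) (auto simp: nth_Cons split: nat.splits)

lemma inv_roots_gen: "s \<in> S \<Longrightarrow> inv_roots s = {simple s}"
  using inv_roots_mult_gen(1)[of "\<one>" s] by simp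

lemma inv_roots_gen_mult_eq:
  assumes "u \<in> carrier W" "s \<in> S" "simple s \<notin> inv_roots u"
  shows "inv_roots (s \<otimes> u) = insert (simple s) (reflect s ` inv_roots u)"
proof -
  have "reflect s \<beta> \<in> pos_roots" if "\<beta> \<in> inv_roots u" for \<beta>
    using that assms inv_roots_pos by (intro reflect_pos) auto
  then show ?thesis using inv_roots_mult[of s u] inv_roots_gen assms by simp
qed

lemma inv_roots_rseq:
  assumes "xs \<in> lists S" "length xs = len (wd xs)"
  shows "inv_roots (wd xs) = set (rseq xs)"
  using assms
proof (induction xs)
  case (Cons a xs)
  then have c: "a \<in> S" "xs \<in> lists S" "wd xs \<in> carrier W" by auto
  have "len (a \<otimes> wd xs) = Suc (len (wd xs))" "length xs = len (wd xs)"
    using Cons.prems c len_le[of xs] len_gen_left[of "wd xs" a] by auto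
  then have "simple a \<notin> inv_roots (wd xs)" using simple_in_inv_roots_iff c by simp
  then show ?case using inv_roots_gen_mult_eq c Cons \<open>length xs = len (wd xs)\<close> by simp
qed simp

lemma lin_sum:
  assumes "finite A" "\<And>a u b v. f (\<lambda>x. a * u x + b * v x) = a * f u + b * (f v :: real)"
  shows "f (\<lambda>x. \<Sum>t\<in>A. c t * g t x) = (\<Sum>t\<in>A. c t * f (g t))"
  using assms(1)
proof (induction A rule: finite_induct)
  case empty
  then show ?case using assms(2)[of 0 "\<lambda>x. 0" 0 "\<lambda>x. 0"] by simp
next
  case (insert a A)
  then show ?case using assms(2)[of "c a" "g a" 1 "\<lambda>x. \<Sum>t\<in>A. c t * g t x"] by simp
qed

text \<open>Each letter subtracts a multiple of its simple root, and the letters before it carry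
  this root to the corresponding entry of the root sequence. The later uses have \<open>r\<close>
  outside \<open>xs\<close>, where all coefficients are nonnegative.\<close>

lemma act_simple_expand:
  assumes "xs \<in> lists S" "r \<in> S"
  shows "act xs (simple r) = (\<lambda>x. 1 * simple r x + 1 * (\<Sum>j<length xs. - cartan r (xs ! j) * (rseq xs ! j) x))"
  using assms(1)
proof (induction xs)
  case (Cons a xs)
  then have a: "a \<in> S" by simp
  have "act (a # xs) (simple r) = reflect a (\<lambda>x. 1 * simple r x + 1 * (\<Sum>j<length xs. - cartan r (xs ! j) * (rseq xs ! j) x))"
    using Cons by simp
  also have "\<dots> = (\<lambda>x. 1 * reflect a (simple r) x + 1 * reflect a (\<lambda>x. \<Sum>j<length xs. - cartan r (xs ! j) * (rseq xs ! j) x) x)"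
    by (rule reflect_lin)
  also have "reflect a (\<lambda>x. \<Sum>j<length xs. - cartan r (xs ! j) * (rseq xs ! j) x)
    = (\<lambda>x. \<Sum>j<length xs. - cartan r (xs ! j) * reflect a (rseq xs ! j) x)"
    using rep_sum[of a "{..<length xs}" "\<lambda>j. - cartan r (xs ! j)" "\<lambda>j. rseq xs ! j"] a by simp
  also have "reflect a (simple r) = (\<lambda>x. simple r x - cartan r a * simple a x)"
    using a assms(2) unfolding reflect_eq by simp
  finally show ?case by (auto simp: sum.lessThan_Suc_shift fun_eq_iff simp del: sum.lessThan_Suc)
qed simp

lemma cartan_sum_nonpos:
  assumes "s \<in> S" "s \<notin> K" "K \<subseteq> S" "\<And>x. 0 \<le> v x"
  shows "(\<Sum>t\<in>K. cartan t s * v t) \<le> 0"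
proof (rule sum_nonpos)
  fix t assume "t \<in> K"
  then have "cartan t s \<le> 0" using assms by (intro cartan_nonpos) auto
  then show "cartan t s * v t \<le> 0" using assms(4) by (rule mult_nonpos_nonneg)
qed

lemma form_simple_supp:
  assumes "letters (s # cs)" "supp (set (s # cs)) v"
  shows "form v (simple s) = 2 * v s + (\<Sum>t\<in>set cs. cartan t s * v t)"
proof -
  have "(\<Sum>t\<in>S-{s}. cartan t s * v t) = (\<Sum>t\<in>set cs. cartan t s * v t)"
    using assms finite_S by (intro sum.mono_neutral_right) (auto simp: supp_def letters_def)
  then show ?thesis using form_simple_expand[of s v] assms by simp
qed

text \<open>The reflection now turns the coefficient at \<open>s\<close> into its negative; both
  roots are positive, so it is zero.\<close>

lemma coeff_zero:
  assumes "letters (s # cs)" "supp (set (s # cs)) \<beta>" "\<beta> \<in> pos_roots" "\<beta> \<noteq> simple s"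
    and "(\<Sum>t\<in>set cs. cartan t s * \<beta> t) = 0"
  shows "\<beta> s = 0" "reflect s \<beta> = \<beta>"
proof -
  have f: "form \<beta> (simple s) = 2 * \<beta> s" using form_simple_supp[OF assms(1,2)] assms(5) by simp
  have "reflect s \<beta> \<in> pos_roots" using assms by (intro reflect_pos) auto
  then have "0 \<le> reflect s \<beta> s" by (rule pos_rootsD)
  moreover have "0 \<le> \<beta> s" using assms(3) by (rule pos_rootsD)
  ultimately show "\<beta> s = 0" using f by (simp add: reflect_def)
  then show "reflect s \<beta> = \<beta>" using f by (auto simp: reflect_def)
qed

lemma euler_Cons_supp: "\<lbrakk>supp (set cs) u; supp (set cs) v; s \<notin> set cs\<rbrakk> \<Longrightarrow> euler (s # cs) u v = euler cs u v"
  using suppD by (intro euler_skip) auto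

lemma omega_Cons_supp: "\<lbrakk>supp (set cs) u; supp (set cs) v; s \<notin> set cs\<rbrakk> \<Longrightarrow> omega (s # cs) u v = omega cs u v"
  using euler_Cons_supp[of cs u v s] euler_Cons_supp[of cs v u s] by (simp add: omega_def del: euler.simps)

lemma omega_snoc_supp:
  assumes "supp (set cs) u" "supp (set cs) v" "letters (cs @ [s])"
  shows "omega (cs @ [s]) u v = omega cs u v"
proof -
  have "u s = 0" "v s = 0" using assms suppD by auto
  then show ?thesis using assms euler_snoc[of cs s] unfolding omega_def by (simp add: letters_def)
qed

lemma omega_initial_nonneg:
  assumes "letters (s # cs)" "\<And>x. 0 \<le> v x" shows "0 \<le> omega (s # cs) (simple s) v"
  using omega_initial[of s cs v] cartan_sum_nonpos[of s "set cs" v] assms by (simp add: letters_def)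

lemma omega_final_nonneg:
  assumes "letters (cs @ [s])" "\<And>x. 0 \<le> v x" shows "0 \<le> omega (cs @ [s]) v (simple s)"
  using omega_final[of cs s v] cartan_sum_nonpos[of s "set cs" v] assms by (simp add: letters_def)

text \<open>A \<open>skip\<close> does not change \<open>omega\<close> on the roots concerned. A
  \<open>take\<close> carries the old sequence over by \<open>omega_rotate\<close> and puts an
  initial simple root in front, which pairs nonnegatively with all positive roots. The clause on
  vanishing pairings is kept for the strict inequality in \<open>omega_prefix_neg\<close>.\<close>

lemma srt_word:
  assumes "srt cs w" "letters cs"
  obtains xs where "xs \<in> lists (set cs)" "wd xs = w" "set (rseq xs) = inv_roots w"
    "sorted_wrt (\<lambda>\<beta> \<gamma>. 0 \<le> omega cs \<beta> \<gamma> \<and> (omega cs \<beta> \<gamma> = 0 \<longrightarrow> form \<beta> \<gamma> = 0)) (rseq xs)"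
proof -
  have "\<exists>xs\<in>lists (set cs). wd xs = w \<and> set (rseq xs) = inv_roots w \<and>
    sorted_wrt (\<lambda>\<beta> \<gamma>. 0 \<le> omega cs \<beta> \<gamma> \<and> (omega cs \<beta> \<gamma> = 0 \<longrightarrow> form \<beta> \<gamma> = 0)) (rseq xs)"
    using assms
  proof (induction rule: srt.induct)
    case nil
    then show ?case by (intro bexI[of _ "[]"]) auto
  next
    case (skip cs w s)
    then obtain xs where xs: "xs \<in> lists (set cs)" "wd xs = w" "set (rseq xs) = inv_roots w"
      "sorted_wrt (\<lambda>\<beta> \<gamma>. 0 \<le> omega cs \<beta> \<gamma> \<and> (omega cs \<beta> \<gamma> = 0 \<longrightarrow> form \<beta> \<gamma> = 0)) (rseq xs)" by auto
    have "w \<in> para (set cs)" using srt_para skip by simp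
    then have "omega (s # cs) \<beta> \<gamma> = omega cs \<beta> \<gamma>" if "\<beta> \<in> set (rseq xs)" "\<gamma> \<in> set (rseq xs)" for \<beta> \<gamma>
      using that xs(3) skip.prems paraD(2) omega_Cons_supp by simp
    then have "sorted_wrt (\<lambda>\<beta> \<gamma>. 0 \<le> omega (s # cs) \<beta> \<gamma> \<and> (omega (s # cs) \<beta> \<gamma> = 0 \<longrightarrow> form \<beta> \<gamma> = 0)) (rseq xs)"
      using xs(4) by (auto intro: sorted_wrt_mono_rel[rotated])
    moreover have "xs \<in> lists (set (s # cs))" using xs(1) by auto
    ultimately show ?case using xs by blast
  next
    case (take cs s u)
    have L: "letters (cs @ [s])" using take by simp
    obtain xs where xs: "xs \<in> lists (set (cs @ [s]))" "wd xs = u" "set (rseq xs) = inv_roots u"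
      "sorted_wrt (\<lambda>\<beta> \<gamma>. 0 \<le> omega (cs @ [s]) \<beta> \<gamma> \<and> (omega (cs @ [s]) \<beta> \<gamma> = 0 \<longrightarrow> form \<beta> \<gamma> = 0)) (rseq xs)"
      using take.IH L by auto
    have s: "s \<in> S" using take by simp
    have up: "u \<in> para (set (s # cs))" using srt_para[OF take.hyps(1) L] by simp
    have uc: "u \<in> carrier W" using up paraD by blast
    have inv: "inv_roots (s \<otimes> u) = set (rseq (s # xs))"
      using inv_roots_gen_mult_eq[OF uc s take.hyps(2)] xs by simp
    have "sorted_wrt (\<lambda>\<beta> \<gamma>. 0 \<le> omega (s # cs) \<beta> \<gamma> \<and> (omega (s # cs) \<beta> \<gamma> = 0 \<longrightarrow> form \<beta> \<gamma> = 0)) (map (reflect s) (rseq xs))"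
    proof -
      have "omega (s # cs) (reflect s \<beta>) (reflect s \<gamma>) = omega (cs @ [s]) \<beta> \<gamma>"
        "form (reflect s \<beta>) (reflect s \<gamma>) = form \<beta> \<gamma>"
        if "\<beta> \<in> set (rseq xs)" "\<gamma> \<in> set (rseq xs)" for \<beta> \<gamma>
      proof -
        have "supp (set (s # cs)) (reflect s \<beta>)" "supp (set (s # cs)) (reflect s \<gamma>)"
          using that paraD(2)[OF up] xs(3) supp_reflect by auto
        then show "omega (s # cs) (reflect s \<beta>) (reflect s \<gamma>) = omega (cs @ [s]) \<beta> \<gamma>"
          using omega_rotate[of s cs "reflect s \<beta>" "reflect s \<gamma>"] take.prems s by (simp add: letters_def)
      qed (simp add: form_reflect s)
      then show ?thesis unfolding sorted_wrt_map using xs(4) by (auto intro: sorted_wrt_mono_rel[rotated])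
    qed
    moreover have "0 \<le> omega (s # cs) (simple s) \<gamma> \<and> (omega (s # cs) (simple s) \<gamma> = 0 \<longrightarrow> form (simple s) \<gamma> = 0)"
      if g: "\<gamma> \<in> set (map (reflect s) (rseq xs))" for \<gamma>
    proof
      obtain \<delta> where d: "\<delta> \<in> inv_roots u" "\<gamma> = reflect s \<delta>" using g xs by auto
      have gi: "\<gamma> \<in> inv_roots (s \<otimes> u)" using inv g by simp
      then have gp: "\<gamma> \<in> pos_roots" by (rule inv_roots_pos)
      have gs: "supp (set (s # cs)) \<gamma>" using d paraD(2)[OF up] supp_reflect by auto
      have "\<gamma> \<noteq> simple s" using d reflect_simple_not_pos[OF s] inv_roots_pos s reflect_reflect by metis
      show "0 \<le> omega (s # cs) (simple s) \<gamma>" using omega_initial_nonneg[OF take.prems] gp pos_rootsD by blast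
      show "omega (s # cs) (simple s) \<gamma> = 0 \<longrightarrow> form (simple s) \<gamma> = 0"
      proof
        assume "omega (s # cs) (simple s) \<gamma> = 0"
        then have z: "(\<Sum>t\<in>set cs. cartan t s * \<gamma> t) = 0" using omega_initial[of s cs \<gamma>] take.prems by (simp add: letters_def)
        then have "\<gamma> s = 0" using coeff_zero[OF take.prems gs gp \<open>\<gamma> \<noteq> simple s\<close>] by simp
        then show "form (simple s) \<gamma> = 0" using form_simple_supp[OF take.prems gs] z form_sym by simp
      qed
    qed
    ultimately have "sorted_wrt (\<lambda>\<beta> \<gamma>. 0 \<le> omega (s # cs) \<beta> \<gamma> \<and> (omega (s # cs) \<beta> \<gamma> = 0 \<longrightarrow> form \<beta> \<gamma> = 0)) (rseq (s # xs))"
      by simp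
    moreover have "s # xs \<in> lists (set (s # cs))" "wd (s # xs) = s \<otimes> u" using xs by auto
    ultimately show ?case using inv by blast
  qed
  then show ?thesis using that by blast
qed

subsection \<open>Alignment\<close>

text \<open>A planar condition: \<open>omega\<close> says which of two positive roots comes first in
  sorting order, as in \<open>srt_word\<close>, and a root strictly between them may be an inversion
  only if the first one is.\<close>

definition aligned :: "'a list \<Rightarrow> 'a \<Rightarrow> bool"
  where "aligned cs w \<longleftrightarrow> (\<forall>\<beta>\<in>pos_roots. \<forall>\<gamma>\<in>pos_roots. \<forall>p q. 0 < p \<longrightarrow> 0 < q \<longrightarrow>
    (\<lambda>x. p * \<beta> x + q * \<gamma> x) \<in> inv_roots w \<longrightarrow> supp (set cs) \<beta> \<longrightarrow> supp (set cs) \<gamma> \<longrightarrow>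
    0 < omega cs \<beta> \<gamma> \<longrightarrow> \<beta> \<in> inv_roots w)"

lemma alignedI:
  assumes "\<And>\<beta> \<gamma> p q. \<lbrakk>\<beta> \<in> pos_roots; \<gamma> \<in> pos_roots; 0 < p; 0 < q;
    (\<lambda>x. p * \<beta> x + q * \<gamma> x) \<in> inv_roots w; supp (set cs) \<beta>; supp (set cs) \<gamma>; 0 < omega cs \<beta> \<gamma>\<rbrakk> \<Longrightarrow> \<beta> \<in> inv_roots w"
  shows "aligned cs w"
  using assms unfolding aligned_def by blast

lemma alignedD:
  assumes "aligned cs w" "\<beta> \<in> pos_roots" "\<gamma> \<in> pos_roots" "0 < p" "0 < q"
    "(\<lambda>x. p * \<beta> x + q * \<gamma> x) \<in> inv_roots w" "supp (set cs) \<beta>" "supp (set cs) \<gamma>" "0 < omega cs \<beta> \<gamma>"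
  shows "\<beta> \<in> inv_roots w"
  using assms unfolding aligned_def by blast

lemma supp_conic:
  assumes "supp K (\<lambda>x. p * \<beta> x + q * \<gamma> x)" "0 < p" "0 < q" "\<beta> \<in> pos_roots" "\<gamma> \<in> pos_roots"
  shows "supp K \<beta>" "supp K \<gamma>"
proof -
  have "\<beta> x = 0 \<and> \<gamma> x = 0" if "x \<notin> K" for x
  proof -
    have "p * \<beta> x + q * \<gamma> x = 0" using assms(1) that by (simp add: supp_def)
    moreover have "0 \<le> p * \<beta> x" "0 \<le> q * \<gamma> x" using assms pos_rootsD(2)[of _ x] by auto
    ultimately have "p * \<beta> x = 0 \<and> q * \<gamma> x = 0" by (simp add: add_nonneg_eq_0_iff)
    then show ?thesis using assms(2,3) by simp
  qed
  then show "supp K \<beta>" "supp K \<gamma>" by (auto simp: supp_def)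
qed

lemma pos_root_supp_singleton: "\<lbrakk>\<beta> \<in> pos_roots; s \<in> S; supp {s} \<beta>\<rbrakk> \<Longrightarrow> \<beta> = simple s"
  by (rule pos_root_eq_simple) (auto simp: supp_def)

text \<open>In the \<open>take\<close> case the reflection transports the whole configuration. The
  exceptional root is harmless: as \<beta> it is an inversion anyway, and as \<gamma> it would make
  \<open>omega\<close> nonpositive because \<open>s\<close> is initial.\<close>

lemma srt_aligned:
  assumes "srt cs w" "letters cs" shows "aligned cs w"
  using assms
proof (induction rule: srt.induct)
  case nil
  then show ?case by (simp add: aligned_def)
next
  case (skip cs w s)
  have wp: "w \<in> para (set cs)" using srt_para skip by simp
  show ?case
  proof (rule alignedI)
    fix \<beta> \<gamma> :: "'a \<Rightarrow> real" and p q :: real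
    assume *: "\<beta> \<in> pos_roots" "\<gamma> \<in> pos_roots" "0 < p" "0 < q" "(\<lambda>x. p * \<beta> x + q * \<gamma> x) \<in> inv_roots w"
      "0 < omega (s # cs) \<beta> \<gamma>"
    have "supp (set cs) (\<lambda>x. p * \<beta> x + q * \<gamma> x)" using paraD(2)[OF wp *(5)] .
    then have su: "supp (set cs) \<beta>" "supp (set cs) \<gamma>" using supp_conic * by blast+
    then have "0 < omega cs \<beta> \<gamma>" using omega_Cons_supp[of cs \<beta> \<gamma> s] skip.prems * by simp
    then show "\<beta> \<in> inv_roots w" using alignedD[OF skip.IH] skip.prems * su by simp
  qed
next
  case (take cs s u)
  have L: "letters (cs @ [s])" and s: "s \<in> S" using take.prems by auto
  have uc: "u \<in> carrier W" using srt_carrier[OF take.hyps(1) L] .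
  have al: "aligned (cs @ [s]) u" using take.IH L by simp
  show ?case
  proof (rule alignedI)
    fix \<beta> \<gamma> :: "'a \<Rightarrow> real" and p q :: real
    let ?\<delta> = "\<lambda>x. p * \<beta> x + q * \<gamma> x"
    assume *: "\<beta> \<in> pos_roots" "\<gamma> \<in> pos_roots" "0 < p" "0 < q" "?\<delta> \<in> inv_roots (s \<otimes> u)"
      "supp (set (s # cs)) \<beta>" "supp (set (s # cs)) \<gamma>" "0 < omega (s # cs) \<beta> \<gamma>"
    show "\<beta> \<in> inv_roots (s \<otimes> u)"
    proof (cases "\<beta> = simple s")
      case True
      then show ?thesis using inv_roots_gen_simple[OF uc s] take.hyps by simp
    next
      case False
      have "\<gamma> \<noteq> simple s"
      proof
        assume "\<gamma> = simple s"
        then have "omega (s # cs) \<beta> \<gamma> \<le> 0"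
          using omega_initial_nonneg[OF take.prems, of \<beta>] pos_rootsD(2)[OF *(1)] omega_antisym[of "s # cs" \<beta> \<gamma>] by simp
        then show False using * by simp
      qed
      have "?\<delta> \<noteq> simple s"
      proof
        assume "?\<delta> = simple s"
        then have "supp {s} ?\<delta>" by simp
        then have "supp {s} \<beta>" using supp_conic * by blast
        then show False using pos_root_supp_singleton * s False by blast
      qed
      then have "reflect s ?\<delta> \<in> inv_roots u"
        using inv_roots_gen_mult[OF uc s inv_roots_pos[OF *(5)]] * by simp
      then have "(\<lambda>x. p * reflect s \<beta> x + q * reflect s \<gamma> x) \<in> inv_roots u" by (simp add: reflect_lin)
      moreover have "reflect s \<beta> \<in> pos_roots" "reflect s \<gamma> \<in> pos_roots"
        using reflect_pos s * False \<open>\<gamma> \<noteq> simple s\<close> by auto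
      moreover have "supp (set (cs @ [s])) (reflect s \<beta>)" "supp (set (cs @ [s])) (reflect s \<gamma>)"
        using * supp_reflect[of s "insert s (set cs)"] by auto
      moreover have "0 < omega (cs @ [s]) (reflect s \<beta>) (reflect s \<gamma>)"
        using omega_rotate[of s cs \<beta> \<gamma>] take.prems * by (simp add: letters_def)
      ultimately have "reflect s \<beta> \<in> inv_roots u" using alignedD[OF al] *(3,4) by blast
      then show ?thesis using inv_roots_gen_mult[OF uc s *(1) False] by simp
    qed
  qed
qed

text \<open>The transport of \<open>srt_aligned\<close> is read backwards. Now \<open>r\<close> is
  final, so it is \<gamma> that may be the exceptional root.\<close>

lemma aligned_gen_mult:
  assumes "aligned (r # ds) w" "letters (r # ds)" "w \<in> carrier W" "simple r \<in> inv_roots w"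
  shows "aligned (ds @ [r]) (r \<otimes> w)"
proof (rule alignedI)
  have L: "letters (ds @ [r])" and r: "r \<in> S" using assms by auto
  fix \<beta> \<gamma> :: "'a \<Rightarrow> real" and p q :: real
  let ?\<delta> = "\<lambda>x. p * \<beta> x + q * \<gamma> x"
  assume *: "\<beta> \<in> pos_roots" "\<gamma> \<in> pos_roots" "0 < p" "0 < q" "?\<delta> \<in> inv_roots (r \<otimes> w)"
    "supp (set (ds @ [r])) \<beta>" "supp (set (ds @ [r])) \<gamma>" "0 < omega (ds @ [r]) \<beta> \<gamma>"
  have "\<beta> \<noteq> simple r"
  proof
    assume "\<beta> = simple r"
    then have "omega (ds @ [r]) \<beta> \<gamma> \<le> 0"
      using omega_final_nonneg[OF L, of \<gamma>] pos_rootsD(2)[OF *(2)] omega_antisym[of "ds @ [r]" \<beta> \<gamma>] by simp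
    then show False using * by simp
  qed
  then have rb: "reflect r \<beta> \<in> pos_roots" using reflect_pos r * by blast
  have "?\<delta> \<noteq> simple r" using * inv_roots_gen_simple[of w r] assms r by auto
  then have "reflect r ?\<delta> \<in> inv_roots w"
    using inv_roots_gen_mult[of w r ?\<delta>] inv_roots_pos[OF *(5)] * assms r by blast
  then have d: "(\<lambda>x. p * reflect r \<beta> x + q * reflect r \<gamma> x) \<in> inv_roots w" by (simp add: reflect_lin)
  have "reflect r \<beta> \<in> inv_roots w"
  proof (cases "\<gamma> = simple r")
    case True
    let ?\<epsilon> = "\<lambda>x. p * reflect r \<beta> x + q * reflect r \<gamma> x"
    \<comment> \<open>Here the reflection makes \<gamma> negative, so alignment of \<open>w\<close>
      cannot be applied. Instead \<open>reflect r \<beta>\<close> is a positive combination of two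
      inversions of \<open>w\<close>, and inversion sets are convex.\<close>
    have e: "reflect r \<beta> = (\<lambda>x. (1 / p) * ?\<epsilon> x + (q / p) * simple r x)"
      using *(3) r by (auto simp: True reflect_simple_self field_simps)
    have "rep (inv w) ?\<epsilon> x \<le> 0" "rep (inv w) (simple r) x \<le> 0" for x
      using d assms(3,4) not_pos_nonpos rep_roots[of "inv w"] pos_rootsD(1) by (auto simp: inv_roots_def)
    moreover have "rep (inv w) (reflect r \<beta>) = (\<lambda>x. (1 / p) * rep (inv w) ?\<epsilon> x + (q / p) * rep (inv w) (simple r) x)"
      by (subst e, rule rep_lin) (use assms in simp)
    ultimately have "rep (inv w) (reflect r \<beta>) x \<le> 0" for x
      using *(3,4) by (auto intro!: add_nonpos_nonpos mult_nonneg_nonpos divide_nonpos_pos)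
    then show ?thesis using nonpos_not_pos rep_roots[of "inv w"] assms(3) rb pos_rootsD(1) by (simp add: inv_roots_def)
  next
    case False
    then have rg: "reflect r \<gamma> \<in> pos_roots" using reflect_pos r * by blast
    have su: "supp (set (r # ds)) (reflect r \<beta>)" "supp (set (r # ds)) (reflect r \<gamma>)"
      using * supp_reflect[of r "insert r (set ds)"] by auto
    then have "0 < omega (r # ds) (reflect r \<beta>) (reflect r \<gamma>)"
      using omega_rotate[of r ds "reflect r \<beta>" "reflect r \<gamma>"] assms * r by (simp add: letters_def)
    then show ?thesis using alignedD[OF assms(1) rb rg *(3,4) d su] by simp
  qed
  then show "\<beta> \<in> inv_roots (r \<otimes> w)"
    using inv_roots_gen_mult[of w r \<beta>] * assms r \<open>\<beta> \<noteq> simple r\<close> by simp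
qed

lemma aligned_restr:
  assumes "aligned cs w" "inv_roots v = restr (set ds) w" "set ds \<subseteq> set cs"
    and "\<And>\<beta> \<gamma>. \<lbrakk>supp (set ds) \<beta>; supp (set ds) \<gamma>\<rbrakk> \<Longrightarrow> omega cs \<beta> \<gamma> = omega ds \<beta> \<gamma>"
  shows "aligned ds v"
proof (rule alignedI)
  fix \<beta> \<gamma> :: "'a \<Rightarrow> real" and p q :: real
  assume *: "\<beta> \<in> pos_roots" "\<gamma> \<in> pos_roots" "0 < p" "0 < q" "(\<lambda>x. p * \<beta> x + q * \<gamma> x) \<in> inv_roots v"
    "supp (set ds) \<beta>" "supp (set ds) \<gamma>" "0 < omega ds \<beta> \<gamma>"
  have "(\<lambda>x. p * \<beta> x + q * \<gamma> x) \<in> inv_roots w" using *(5) assms(2) by (simp add: restr_def)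
  then have "\<beta> \<in> inv_roots w"
    using alignedD[OF assms(1) *(1-4)] * assms(4) supp_mono[OF _ assms(3)] by simp
  then show "\<beta> \<in> inv_roots v" using assms(2) * by (simp add: restr_def)
qed

text \<open>In the expansion of \<open>u \<alpha>\<^sub>r\<close> into \<open>\<alpha>\<^sub>r\<close> and nonnegative multiples of the inversions preceding the
  \<open>k\<close>-th one, every summand contributes a nonpositive amount; if all contributions vanished, then
  the \<open>k\<close>-th letter would commute with \<open>r\<close>.\<close>

lemma omega_prefix_neg:
  assumes L: "letters (r # ds)" and xs: "xs \<in> lists (set ds)"
    and so: "sorted_wrt (\<lambda>\<beta> \<gamma>. 0 \<le> omega ds \<beta> \<gamma> \<and> (omega ds \<beta> \<gamma> = 0 \<longrightarrow> form \<beta> \<gamma> = 0)) (rseq xs)"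
    and pos: "set (rseq xs) \<subseteq> pos_roots" and su: "\<And>\<beta>. \<beta> \<in> set (rseq xs) \<Longrightarrow> supp (set ds) \<beta>"
    and k: "k < length xs" and c: "cartan r (xs ! k) \<noteq> 0"
  shows "omega (r # ds) (rseq xs ! k) (act (take k xs) (simple r)) < 0"
proof -
  define us where "us = take k xs"
  define \<beta> where "\<beta> = rseq xs ! k"
  define d where "d j = - cartan r (us ! j)" for j
  have lk: "length us = k" using k by (simp add: us_def)
  have r: "r \<in> S" using L by simp
  have ds: "set ds \<subseteq> S" using L lettersD by auto
  have usS: "us \<in> lists S" using xs ds by (auto simp: us_def dest: in_set_takeD)
  have usj: "us ! j \<in> set ds" if "j < k" for j using that xs k by (auto simp: us_def)
  have rj: "rseq us ! j = rseq xs ! j" if "j < k" for j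
    using that k by (simp add: us_def rseq_nth min_def)
  have d0: "0 \<le> d j" if "j < k" for j
    using cartan_nonpos[of r "us ! j"] r usj[OF that] ds L by (auto simp: d_def)
  have e: "act us (simple r) = (\<lambda>x. 1 * simple r x + 1 * (\<Sum>j<k. d j * (rseq us ! j) x))"
    using act_simple_expand[OF usS r] by (simp add: lk d_def)
  have \<beta>: "\<beta> \<in> set (rseq xs)" using k by (simp add: \<beta>_def)
  have rsu: "supp (set (r # ds)) \<beta>" using su[OF \<beta>] by (rule supp_mono) auto
  have oj: "omega (r # ds) \<beta> (rseq us ! j) = - omega ds (rseq xs ! j) \<beta>" if "j < k" for j
  proof -
    have "rseq xs ! j \<in> set (rseq xs)" using that k by simp
    then have "omega (r # ds) \<beta> (rseq xs ! j) = omega ds \<beta> (rseq xs ! j)"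
      using su \<beta> L by (intro omega_Cons_supp) auto
    then show ?thesis using rj[OF that] omega_antisym[of ds \<beta> "rseq xs ! j"] by simp
  qed
  have sj: "0 \<le> omega ds (rseq xs ! j) \<beta>" "omega ds (rseq xs ! j) \<beta> = 0 \<longrightarrow> form (rseq xs ! j) \<beta> = 0" if "j < k" for j
    using so that k unfolding sorted_wrt_iff_nth_less by (auto simp: \<beta>_def)
  have "omega (r # ds) \<beta> (act us (simple r)) = omega (r # ds) \<beta> (simple r) + (\<Sum>j<k. d j * omega (r # ds) \<beta> (rseq us ! j))"
    unfolding e omega_lin_right
    by (simp add: lin_sum[of "{..<k}" "omega (r # ds) \<beta>" d "\<lambda>j. rseq us ! j", OF finite_lessThan omega_lin_right])
  also have "(\<Sum>j<k. d j * omega (r # ds) \<beta> (rseq us ! j)) = - (\<Sum>j<k. d j * omega ds (rseq xs ! j) \<beta>)"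
    using oj by (simp flip: sum_negf)
  finally have o: "omega (r # ds) \<beta> (act us (simple r)) =
    - (omega (r # ds) (simple r) \<beta> + (\<Sum>j<k. d j * omega ds (rseq xs ! j) \<beta>))"
    using omega_antisym[of "r # ds" \<beta> "simple r"] by simp
  have n1: "0 \<le> omega (r # ds) (simple r) \<beta>"
    using omega_initial_nonneg[OF L] \<beta> pos pos_rootsD(2) by blast
  have n2: "0 \<le> d j * omega ds (rseq xs ! j) \<beta>" if "j < k" for j using d0 sj that by simp
  then have n3: "0 \<le> (\<Sum>j<k. d j * omega ds (rseq xs ! j) \<beta>)" by (intro sum_nonneg) auto
  have "omega (r # ds) \<beta> (act us (simple r)) \<noteq> 0"
  proof
    assume "omega (r # ds) \<beta> (act us (simple r)) = 0"
    then have z: "omega (r # ds) (simple r) \<beta> = 0" "(\<Sum>j<k. d j * omega ds (rseq xs ! j) \<beta>) = 0"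
      using o n1 n3 by linarith+
    have "form (simple r) \<beta> = 0"
    proof -
      have "(\<Sum>t\<in>set ds. cartan t r * \<beta> t) = 0" using z(1) omega_initial[of r ds \<beta>] L by (simp add: letters_def)
      moreover have "\<beta> r = 0" using su[OF \<beta>] suppD L by auto
      ultimately show ?thesis using form_simple_supp[OF L rsu] form_sym by simp
    qed
    moreover have "d j * form (rseq us ! j) \<beta> = 0" if j: "j < k" for j
    proof -
      have "\<forall>j\<in>{..<k}. d j * omega ds (rseq xs ! j) \<beta> = 0"
        using z(2) n2 by (subst (asm) sum_nonneg_eq_0_iff) auto
      then have "d j * omega ds (rseq xs ! j) \<beta> = 0" using j by blast
      then show ?thesis using sj(2)[OF j] rj[OF j] by auto
    qed
    then have "(\<Sum>j<k. d j * form (rseq us ! j) \<beta>) = 0" by (intro sum.neutral) blast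
    ultimately have "form (act us (simple r)) \<beta> = 0"
      unfolding e form_lin_left
      by (simp add: lin_sum[of "{..<k}" "\<lambda>v. form v \<beta>" d "\<lambda>j. rseq us ! j", OF finite_lessThan form_lin_left])
    moreover have "\<beta> = act us (simple (xs ! k))" using rseq_nth[OF k] by (simp add: \<beta>_def us_def)
    then have "form (act us (simple r)) \<beta> = form (simple r) (simple (xs ! k))" using form_act[OF usS] by simp
    moreover have "xs ! k \<in> S" using xs k ds by (auto simp: in_lists_conv_set)
    ultimately show False using c r by simp
  qed
  moreover have "omega (r # ds) \<beta> (act us (simple r)) \<le> 0" using o n1 n3 by simp
  ultimately show ?thesis by (simp add: \<beta>_def us_def)
qed

text \<open>If \<open>r\<close> is not a descent, the parabolic part \<open>v\<close> of
  \<open>w\<close> without \<open>r\<close> is sortable by induction, and it remains to see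
  \<open>v = w\<close>. A cover of \<open>v\<close> below \<open>w\<close> could only add the image
  of the simple root of \<open>r\<close> under \<open>v\<close>. Alignment then drops the letters of
  the sorting word of \<open>v\<close> from the end one by one, until the simple root of
  \<open>r\<close> itself would be an inversion of \<open>w\<close>.\<close>

lemma aligned_srt:
  assumes "letters cs" "w \<in> para (set cs)" "aligned cs w"
  shows "srt cs w"
  using assms
proof (induction "(len w, length cs)" arbitrary: w cs
    rule: wf_induct_rule[OF wf_lex_prod[OF wf_less_than wf_less_than]])
  case less: 1
  have wc: "w \<in> carrier W" using less.prems paraD by blast
  show ?case
  proof (cases cs)
    case Nil
    then show ?thesis using less.prems para_empty srt_Nil by simp
  next
    case (Cons r ds)
    have L: "letters (r # ds)" using less.prems Cons by simp
    have r: "r \<in> S" using L by simp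
    have dsS: "set ds \<subseteq> S" using L lettersD by auto
    show ?thesis
    proof (cases "simple r \<in> inv_roots w")
      case True
      have "srt (ds @ [r]) (r \<otimes> w)"
      proof (rule less.hyps)
        show "((len (r \<otimes> w), length (ds @ [r])), len w, length cs) \<in> less_than <*lex*> less_than"
          using len_gen_descent[OF wc r True] by simp
        show "aligned (ds @ [r]) (r \<otimes> w)" using aligned_gen_mult less.prems L wc True Cons by blast
        show "r \<otimes> w \<in> para (set (ds @ [r]))" using para_gen_mult[of w "set (r # ds)" r] less.prems Cons r by simp
      qed (use L in simp)
      then show ?thesis using srt_Cons[OF L wc] True Cons by simp
    next
      case False
      obtain v where v: "v \<in> para (set ds)" "inv_roots v = restr (set ds) w"
        using parabolic_part_exists[OF wc dsS] by blast
      have vc: "v \<in> carrier W" using v paraD by blast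
      have vw: "v \<preceq> w" using v by (auto simp: restr_def)
      have "aligned ds v"
        by (rule aligned_restr[of "r # ds" w]) (use less.prems Cons v L omega_Cons_supp in auto)
      moreover have "len v \<le> len w" using len_le_if_le wc vc vw by blast
      ultimately have sv: "srt ds v" using v L Cons by (intro less.hyps) (auto simp: le_less)
      have "v = w"
      proof (rule ccontr)
        assume "v \<noteq> w"
        then obtain q where q: "q \<in> S" "rep v (simple q) \<in> pos_roots" "rep v (simple q) \<in> inv_roots w"
          using le_cover[OF wc vc vw] by metis
        have vp: "v \<in> para (set (r # ds))" using v para_mono[of "set ds" "set (r # ds)"] by auto
        have "supp (set (r # ds)) (rep v (simple q))" using q paraD(2) less.prems Cons by blast
        then have "q \<in> set (r # ds)" using supp_rep[OF vp] by simp
        moreover have "q \<notin> set ds"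
        proof
          assume "q \<in> set ds"
          then have "supp (set ds) (rep v (simple q))" using supp_rep[OF v(1)] by simp
          then have "rep v (simple q) \<in> inv_roots v" using q v by (simp add: restr_def)
          then show False using inv_roots_mult_gen(2)[OF vc q(1,2)] by simp
        qed
        ultimately have "q = r" by simp
        obtain xs where xs: "xs \<in> lists (set ds)" "wd xs = v" "set (rseq xs) = inv_roots v"
          "sorted_wrt (\<lambda>\<beta> \<gamma>. 0 \<le> omega ds \<beta> \<gamma> \<and> (omega ds \<beta> \<gamma> = 0 \<longrightarrow> form \<beta> \<gamma> = 0)) (rseq xs)"
          using srt_word[OF sv] L by auto
        have xsS: "xs \<in> lists S" using xs(1) dsS by auto
        define P where "P k \<longleftrightarrow> act (take k xs) (simple r) \<in> inv_roots w" for k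
        have "P (length xs)" using q xs rep_wd[OF xsS] \<open>q = r\<close> by (simp add: P_def)
        \<comment> \<open>The shortest prefix that carries the simple root of \<open>r\<close> to an
          inversion of \<open>w\<close>. It is nonempty since \<open>r\<close> is not a descent, and
          alignment will remove its last letter.\<close>
        define k where "k = (LEAST k. P k)"
        have Pk: "P k" "k \<le> length xs" using \<open>P (length xs)\<close> unfolding k_def by (auto intro: LeastI Least_le)
        have "k \<noteq> 0" using Pk False by (cases k) (auto simp: P_def)
        then obtain j where j: "k = Suc j" by (cases k) auto
        have jl: "j < length xs" using j Pk by simp
        have nPj: "\<not> P j" using j not_less_Least[of j P] by (simp add: k_def)
        let ?u = "take j xs" and ?q = "xs ! j" and ?\<beta> = "rseq xs ! j"
        let ?\<gamma> = "act ?u (simple r)"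
        have uS: "?u \<in> lists (set ds)" using xs by (auto dest: in_set_takeD)
        have uS': "?u \<in> lists S" using uS dsS by auto
        have qS: "?q \<in> S" "?q \<in> set ds" using jl xs dsS by (auto simp: in_lists_conv_set)
        have b: "?\<beta> = act ?u (simple ?q)" using rseq_nth[OF jl] .
        have c0: "cartan r ?q \<le> 0" using cartan_nonpos r qS L by auto
        have "act (take k xs) (simple r) = act ?u (reflect ?q (simple r))"
          using jl j by (simp add: take_Suc_conv_app_nth)
        also have "\<dots> = (\<lambda>x. 1 * ?\<gamma> x + (- cartan r ?q) * ?\<beta> x)"
          unfolding reflect_eq act_lin b using r qS by simp
        finally have e: "(\<lambda>x. 1 * ?\<gamma> x + (- cartan r ?q) * ?\<beta> x) \<in> inv_roots w" using Pk by (simp add: P_def)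
        have c: "cartan r ?q \<noteq> 0"
        proof
          assume "cartan r ?q = 0"
          then have "?\<gamma> \<in> inv_roots w" using e by simp
          then show False using nPj by (simp add: P_def)
        qed
        have bi: "?\<beta> \<in> inv_roots v" using jl xs(3) by (metis length_rseq nth_mem)
        have "r \<notin> set ds" using L by simp
        then have "?\<gamma> r = 1" using act_support[OF uS] by (simp add: simple_def)
        moreover have "?\<gamma> \<in> roots"
          using rep_roots[OF wd_closed[OF uS'] simple_roots[OF r]] rep_wd[OF uS'] by simp
        ultimately have gp: "?\<gamma> \<in> pos_roots" using pos_if_coeff[of ?\<gamma> r] by simp
        have "omega (r # ds) ?\<beta> ?\<gamma> < 0"
        proof (rule omega_prefix_neg[OF L xs(1,4) _ _ jl c])
          show "set (rseq xs) \<subseteq> pos_roots" using xs(3) inv_roots_pos by blast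
          show "\<And>\<beta>. \<beta> \<in> set (rseq xs) \<Longrightarrow> supp (set ds) \<beta>" using xs(3) paraD(2)[OF v(1)] by blast
        qed
        then have "0 < omega (r # ds) ?\<gamma> ?\<beta>" using omega_antisym[of "r # ds" ?\<gamma> ?\<beta>] by simp
        moreover have bs: "supp (set (r # ds)) ?\<beta>" by (rule supp_mono[OF paraD(2)[OF v(1) bi]]) auto
        moreover have "supp (set (r # ds)) ?\<gamma>"
        proof -
          have "?\<gamma> x = 0" if "x \<notin> set (r # ds)" for x
            using act_support[OF uS, of x "simple r"] that by (simp add: simple_def)
          then show ?thesis by (simp add: supp_def)
        qed
        moreover have "aligned (r # ds) w" using less.prems Cons by simp
        ultimately have "?\<gamma> \<in> inv_roots w"
          using alignedD[of "r # ds" w ?\<gamma> ?\<beta> 1 "- cartan r ?q"] gp inv_roots_pos[OF bi] e c c0 by simp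
        then show False using nPj by (simp add: P_def)
      qed
      then show ?thesis using sv Cons by (simp add: srt.skip)
    qed
  qed
qed

text \<open>Alignment survives restriction because \<open>omega\<close> does not change on vectors
  supported on \<open>cs\<close> when the final letter is removed.\<close>

lemma srt_parabolic_part:
  assumes "srt (cs @ [s]) x" "letters (cs @ [s])" "v \<in> para (set cs)" "inv_roots v = restr (set cs) x"
  shows "srt cs v"
proof (rule aligned_srt)
  show "aligned cs v"
    by (rule aligned_restr[OF srt_aligned[OF assms(1,2)] assms(4)]) (use omega_snoc_supp assms in auto)
qed (use assms in auto)


subsection \<open>Deleting an inversion\<close>

text \<open>The hypothesis on the first letter makes a Cartan entry nonnegative as well as
  nonpositive; so this letter fixes the simple root, and the hypothesis passes to the remaining
  word.\<close>

lemma act_simple_fixed: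
  assumes "xs \<in> lists S" "q \<in> S" "q \<notin> set xs" "\<And>\<delta>. \<delta> \<in> set (rseq xs) \<Longrightarrow> 0 \<le> form (simple q) \<delta>"
  shows "act xs (simple q) = simple q"
  using assms
proof (induction xs)
  case (Cons a xs)
  have a: "a \<in> S" "a \<noteq> q" using Cons.hyps Cons.prems by auto
  have "0 \<le> cartan q a" using Cons.prems(3)[of "simple a"] a Cons.prems by simp
  moreover have "cartan q a \<le> 0" using cartan_nonpos a Cons.prems by auto
  ultimately have f: "reflect a (simple q) = simple q" using a Cons.prems by (simp add: reflect_eq)
  have "0 \<le> form (simple q) \<delta>" if "\<delta> \<in> set (rseq xs)" for \<delta>
    using Cons.prems(3)[of "reflect a \<delta>"] that form_reflect[OF a(1), of "simple q" \<delta>] f by simp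
  then have "act xs (simple q) = simple q" using Cons by auto
  then show ?case using f by simp
qed simp

text \<open>The sign condition says that \<beta> can stand last among the inversions. The recursion
  transports it until it is the simple root of the letter \<open>s\<close> being taken. Being first
  as well as last, it has zero \<open>omega\<close> with all other inversions; by
  \<open>coeff_zero\<close> these are fixed by \<open>s\<close> and do not involve it, so
  \<open>s\<close> can be skipped instead. The last conjunct exhibits \<beta> as a cover reflection:
  \<open>x \<otimes> q\<close> equals \<open>reflection_of \<beta> \<otimes> x\<close>.\<close>

lemma srt_delete:
  assumes "srt cs x" "letters cs" "\<beta> \<in> inv_roots x" "\<And>\<gamma>. \<gamma> \<in> inv_roots x \<Longrightarrow> 0 \<le> omega cs \<gamma> \<beta>"
  shows "srt cs (reflection_of \<beta> \<otimes> x) \<and> inv_roots (reflection_of \<beta> \<otimes> x) = inv_roots x - {\<beta>} \<and>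
    (\<exists>q\<in>S. rep x (simple q) = (\<lambda>z. - \<beta> z))"
  using assms
proof (induction arbitrary: \<beta> rule: srt.induct)
  case nil
  then show ?case by simp
next
  case (skip cs w s)
  have wp: "w \<in> para (set cs)" using srt_para skip by simp
  have "omega (s # cs) \<gamma> \<beta> = omega cs \<gamma> \<beta>" if "\<gamma> \<in> inv_roots w" for \<gamma>
    using omega_Cons_supp paraD(2)[OF wp] that skip.prems by simp
  then show ?case using skip.IH[of \<beta>] skip.prems by (auto intro: srt.skip)
next
  case (take cs s u)
  have L: "letters (cs @ [s])" and s: "s \<in> S" using take.prems by auto
  have up: "u \<in> para (set (s # cs))" using srt_para[OF take.hyps(1) L] by simp
  have uc: "u \<in> carrier W" using up paraD by blast
  have inv_su: "inv_roots (s \<otimes> u) = insert (simple s) (reflect s ` inv_roots u)"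
    using inv_roots_gen_mult_eq[OF uc s take.hyps(2)] .
  have supx: "supp (set (s # cs)) \<gamma>" if "\<gamma> \<in> inv_roots (s \<otimes> u)" for \<gamma>
    using that paraD(2) para_gen_mult[OF up _ s] by auto
  show ?case
  proof (cases "\<beta> = simple s")
    case True
    have *: "\<gamma> s = 0 \<and> reflect s \<gamma> = \<gamma>" if g: "\<gamma> \<in> inv_roots (s \<otimes> u)" "\<gamma> \<noteq> simple s" for \<gamma>
    proof -
      have "omega (s # cs) (simple s) \<gamma> \<le> 0" 
        using take.prems(3)[OF g(1)] True omega_antisym[of "s # cs" \<gamma> "simple s"] by simp
      then have "(\<Sum>t\<in>set cs. cartan t s * \<gamma> t) = 0"
        using omega_initial[of s cs \<gamma>] omega_initial_nonneg[OF take.prems(1), of \<gamma>] take.prems(1)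
          pos_rootsD(2)[OF inv_roots_pos[OF g(1)]] by (simp add: letters_def)
      then show ?thesis using coeff_zero[OF take.prems(1) supx[OF g(1)] inv_roots_pos[OF g(1)] g(2)] by simp
    qed
    have **: "reflect s \<gamma> = \<gamma> \<and> \<gamma> s = 0" if g: "\<gamma> \<in> inv_roots u" for \<gamma>
    proof -
      have "reflect s \<gamma> \<noteq> simple s"
        using inv_roots_pos[OF g] reflect_simple_not_pos[OF s] reflect_reflect[OF s, of \<gamma>] by metis
      then show ?thesis using *[of "reflect s \<gamma>"] g inv_su s by auto
    qed
    have ucs: "u \<in> para (set cs)"
    proof -
      have "supp (set cs) \<gamma>" if "\<gamma> \<in> inv_roots u" for \<gamma>
        using paraD(2)[OF up that] **[OF that] by (auto simp: supp_def)
      then show ?thesis using uc by (simp add: para_def)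
    qed
    have "srt cs u" using srt_insert[of cs s "[]" u] L ucs take.hyps by simp
    then have "srt (s # cs) u" by (rule srt.skip)
    moreover have "inv_roots u = inv_roots (s \<otimes> u) - {simple s}"
    proof -
      have "reflect s ` inv_roots u = inv_roots u" using ** by force
      then show ?thesis using inv_su take.hyps(2) by auto
    qed
    moreover have "rep u (simple s) = simple s"
    proof -
      obtain xs where xs: "xs \<in> lists (set cs \<inter> S)" "wd xs = u" "length xs = len u"
        using para_word[OF ucs] by blast
      have xsS: "xs \<in> lists S" using xs(1) by auto
      have "s \<notin> set xs" using xs(1) take.prems(1) by auto
      moreover have "form (simple s) \<delta> = 0" if "\<delta> \<in> set (rseq xs)" for \<delta>
      proof -
        have "\<delta> \<in> inv_roots u" using that inv_roots_rseq[OF xsS] xs by simp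
        then have r: "reflect s \<delta> = \<delta>" using ** by blast
        then have "reflect s \<delta> s = \<delta> s" by simp
        then show ?thesis using form_sym[of \<delta>] by (simp add: reflect_def)
      qed
      ultimately show ?thesis using act_simple_fixed[OF xsS s] rep_wd[OF xsS] xs by simp
    qed
    then have "rep (s \<otimes> u) (simple s) = (\<lambda>z. - simple s z)" using uc s by (simp add: rep_mult reflect_simple_self)
    ultimately show ?thesis using True s uc by auto
  next
    case False
    define \<gamma> where "\<gamma> = reflect s \<beta>"
    have b: "\<beta> = reflect s \<gamma>" using s by (simp add: \<gamma>_def)
    have br: "\<beta> \<in> roots" using take.prems(2) inv_roots_pos pos_rootsD by blast
    have gi: "\<gamma> \<in> inv_roots u"
      using inv_roots_gen_mult[OF uc s inv_roots_pos[OF take.prems(2)] False] take.prems(2) by (simp add: \<gamma>_def)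
    have "0 \<le> omega (cs @ [s]) \<delta> \<gamma>" if d: "\<delta> \<in> inv_roots u" for \<delta>
    proof -
      have di: "reflect s \<delta> \<in> inv_roots (s \<otimes> u)" using d inv_su by blast
      have "omega (cs @ [s]) (reflect s (reflect s \<delta>)) (reflect s \<beta>) = omega (s # cs) (reflect s \<delta>) \<beta>"
        using supx[OF di] supx[OF take.prems(2)] take.prems(1) by (intro omega_rotate) (auto simp: letters_def)
      then show ?thesis using take.prems(3)[OF di] s by (simp add: \<gamma>_def)
    qed
    then have IH: "srt (cs @ [s]) (reflection_of \<gamma> \<otimes> u)" "inv_roots (reflection_of \<gamma> \<otimes> u) = inv_roots u - {\<gamma>}"
      "\<exists>q\<in>S. rep u (simple q) = (\<lambda>z. - \<gamma> z)" using take.IH[OF L gi] by auto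
    have gr: "\<gamma> \<in> roots" using gi inv_roots_pos pos_rootsD by blast
    have tc: "reflection_of \<gamma> \<otimes> u \<in> carrier W" using gr uc by simp
    have "reflection_of \<beta> = s \<otimes> reflection_of \<gamma> \<otimes> s" using reflection_of_conj[OF gr, of s] b s by simp
    then have t: "reflection_of \<beta> \<otimes> (s \<otimes> u) = s \<otimes> (reflection_of \<gamma> \<otimes> u)" using s uc gr by (simp add: m_assoc)
    have ns: "simple s \<notin> inv_roots (reflection_of \<gamma> \<otimes> u)" using IH(2) take.hyps(2) by simp
    have "inv_roots (s \<otimes> (reflection_of \<gamma> \<otimes> u)) = insert (simple s) (reflect s ` (inv_roots u - {\<gamma>}))"
      using inv_roots_gen_mult_eq[OF tc s ns] IH(2) by simp
    also have "reflect s ` (inv_roots u - {\<gamma>}) = reflect s ` inv_roots u - {\<beta>}"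
    proof -
      have "inj (reflect s)" by (rule inj_on_inverseI[of _ "reflect s"]) (use s in simp)
      then show ?thesis using b by (simp add: image_set_diff)
    qed
    finally have "inv_roots (s \<otimes> (reflection_of \<gamma> \<otimes> u)) = inv_roots (s \<otimes> u) - {\<beta>}"
      using inv_su False by auto
    moreover have "srt (s # cs) (s \<otimes> (reflection_of \<gamma> \<otimes> u))" using IH(1) ns by (rule srt.take)
    moreover have "\<exists>q\<in>S. rep (s \<otimes> u) (simple q) = (\<lambda>z. - \<beta> z)"
    proof -
      obtain q where q: "q \<in> S" "rep u (simple q) = (\<lambda>z. - \<gamma> z)" using IH(3) by blast
      have "rep (s \<otimes> u) (simple q) = (\<lambda>z. - rep s \<gamma> z)"
        using q uc s rep_uminus[of s \<gamma>] rep_mult[of s u] by simp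
      then show ?thesis using q b s by auto
    qed
    ultimately show ?thesis using t by simp
  qed
qed

lemma srt_delete_final:
  assumes "srt (cs @ [s]) x" "letters (cs @ [s])" "simple s \<in> inv_roots x"
  shows "srt (cs @ [s]) (s \<otimes> x)" "\<exists>q\<in>S. rep x (simple q) = (\<lambda>z. - simple s z)"
proof -
  have "0 \<le> omega (cs @ [s]) \<gamma> (simple s)" if "\<gamma> \<in> inv_roots x" for \<gamma>
    using omega_final_nonneg[OF assms(2)] pos_rootsD(2) inv_roots_pos[OF that] by blast
  then show "srt (cs @ [s]) (s \<otimes> x)" "\<exists>q\<in>S. rep x (simple q) = (\<lambda>z. - simple s z)"
    using srt_delete[OF assms] assms(2) by auto
qed


subsection \<open>Joins of sortable elements\<close>

text \<open>The parabolic part of the join is still an upper bound.\<close>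

lemma para_lub:
  assumes "is_lub x y z" "x \<in> para J" "y \<in> para J" "J \<subseteq> S" shows "z \<in> para J"
proof -
  obtain v where v: "v \<in> para J" "inv_roots v = restr J z"
    using parabolic_part_exists[OF is_lubD(1)[OF assms(1)] assms(4)] by blast
  have "x \<preceq> v" "y \<preceq> v"
    unfolding v(2) restr_def using is_lubD(2,3)[OF assms(1)] paraD(2) assms(2,3) by blast+
  then have "z \<preceq> v" using is_lubD(4)[OF assms(1)] v paraD(1) by blast
  moreover have "v \<preceq> z" using v by (auto simp: restr_def)
  ultimately have "z = v" using inv_roots_inj v paraD(1) is_lubD(1)[OF assms(1)] by blast
  then show ?thesis using v by simp
qed

lemma srt_gen: "\<lbrakk>letters cs; s \<in> set cs\<rbrakk> \<Longrightarrow> srt cs s"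
proof -
  assume *: "letters cs" "s \<in> set cs"
  then obtain as bs where cs: "cs = as @ s # bs" by (meson split_list)
  have s: "s \<in> S" using * lettersD(2) by blast
  have "srt [s] (s \<otimes> \<one>)" by (rule srt.take) (simp_all add: srt_one)
  then have 1: "srt [s] s" using s by simp
  have "filter (\<lambda>x. x \<in> {s}) as = []" "filter (\<lambda>x. x \<in> {s}) bs = []"
    using * cs by (auto simp: letters_def filter_empty_conv)
  then have "filter (\<lambda>x. x \<in> {s}) cs = [s]" using cs by simp
  moreover have "s \<in> para {s}" using para_gen s by simp
  ultimately show ?thesis using srt_filter[OF *(1), of s "{s}"] 1 by simp
qed

lemma gen_below: "\<lbrakk>s \<in> S; simple s \<in> inv_roots w\<rbrakk> \<Longrightarrow> s \<preceq> w"
  by (simp add: inv_roots_gen)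

text \<open>If the first letter \<open>s\<close> lies below both elements or below neither, one step
  of the recursion applies to the join as well. The difficulty is the case where \<open>s\<close>
  lies below exactly one.\<close>

theorem srt_join:
  assumes "letters cs" "srt cs x" "srt cs y" "is_lub x y z"
  shows "srt cs z"
  using assms
proof (induction "(len z, length cs)" arbitrary: x y z cs
    rule: wf_induct_rule[OF wf_lex_prod[OF wf_less_than wf_less_than]])
  case less: 1
  note z = is_lubD[OF less.prems(4)]
  have c: "x \<in> carrier W" "y \<in> carrier W" using srt_carrier less.prems by auto
  show ?case
  proof (cases cs)
    case Nil
    then have "x = \<one>" "y = \<one>" using less.prems srt_Nil by auto
    then have "z = \<one>" using z(4)[of \<one>] inv_roots_inj[OF z(1), of \<one>] by simp
    then show ?thesis by (simp add: srt_one)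
  next
    case (Cons s ds)
    have L: "letters (s # ds)" and L': "letters (ds @ [s])" using less.prems Cons by auto
    have s: "s \<in> S" and dsS: "set ds \<subseteq> S" using L lettersD by auto
    have IH: "srt cs' z'" if "letters cs'" "srt cs' x'" "srt cs' y'" "is_lub x' y' z'"
      "len z' < len z \<or> len z' \<le> len z \<and> length cs' < length cs" for cs' x' y' z'
      by (rule less.hyps[OF _ that(1-4)]) (use that(5) in auto)
    have mixed: "srt (s # ds) z" if m: "srt (s # ds) x" "srt (s # ds) y" "is_lub x y z"
      "simple s \<in> inv_roots x" "simple s \<notin> inv_roots y" "x \<in> carrier W" "y \<in> carrier W" for x y
    proof -
      have sx: "srt (ds @ [s]) (s \<otimes> x)" using srt_Cons[OF L m(6)] m by simp
      have sy: "srt ds y" using srt_Cons[OF L m(7)] m by simp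
      have yp: "y \<in> para (set ds)" using srt_para sy L by simp
      have sz: "simple s \<in> inv_roots z" using is_lubD(2)[OF m(3)] m by blast
      \<comment> \<open>As \<open>s\<close> lies below \<open>x\<close>, replacing \<open>y\<close>
        by \<open>s \<or> y\<close> does not change the join with \<open>x\<close>, and afterwards
        both elements lie above \<open>s\<close>. What is needed is sortability of
        \<open>s \<otimes> z1\<close> for the rotated word, obtained from that of \<open>z1\<close>
        by deleting the final letter.\<close>
      obtain z1 where z1: "is_lub s y z1" "z1 \<preceq> z"
        using lub_exists[of s y z] gen_below[OF s sz] is_lubD[OF m(3)] m s by auto
      note z1D = is_lubD[OF z1(1)]
      have z1s: "simple s \<in> inv_roots z1" using z1D(2) inv_roots_gen[OF s] by simp
      have lz1: "len z1 \<le> len z" using len_le_if_le z1D(1) z(1) z1(2) by blast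
      have "srt (ds @ [s]) z1"
      proof (cases ds)
        case Nil
        then have "y = \<one>" using sy srt_Nil by simp
        then have "z1 \<preceq> s" using z1D(4)[of s] s by simp
        then have "z1 = s" using z1D inv_roots_inj[of z1 s] s by auto
        then show ?thesis using srt_gen[of "ds @ [s]" s] L' by simp
      next
        case (Cons r es)
        have Lr: "letters (r # es @ [s])" using L Cons by auto
        have r: "r \<in> S" "r \<noteq> s" using L Cons by auto
        show ?thesis
        proof (cases "simple r \<in> inv_roots y")
          case False
          have y1: "srt es y" using srt_Cons[of r es y] sy Cons False m L by simp
          then have yes: "y \<in> para (set es)" using srt_para[of es y] L Cons by simp
          have "srt (es @ [s]) y" using srt_insert[of es s "[]" y] Lr yes y1 by simp
          have "srt (es @ [s]) z1"
          proof (rule IH)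
            show "is_lub s y z1" by fact
            show "srt (es @ [s]) y" by fact
            show "len z1 < len z \<or> len z1 \<le> len z \<and> length (es @ [s]) < length cs"
              using lz1 \<open>cs = s # ds\<close> Cons by simp
            show "srt (es @ [s]) s" using srt_gen[of "es @ [s]" s] Lr by simp
          qed (use Lr z1(1) in auto)
          then show ?thesis using Cons by (simp add: srt.skip)
        next
          case True
          have y1: "srt (es @ [r]) (r \<otimes> y)" using srt_Cons[of r es y] sy Cons True m L by simp
          have ryp: "r \<otimes> y \<in> para (set (es @ [r]))" using srt_para[OF y1] L Cons by simp
          have y2: "srt (es @ [s, r]) (r \<otimes> y)"
            using srt_insert[of es s "[r]" "r \<otimes> y"] y1 ryp L Cons by (auto simp: letters_def)
          have z1r: "simple r \<in> inv_roots z1" using True z1D(3) by blast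
          \<comment> \<open>Left multiplication by \<open>r\<close> needs both elements above
            \<open>r\<close>, but \<open>s\<close> is not. The join of \<open>r\<close> and
            \<open>s\<close> gives the same \<open>z1\<close>, and its product with \<open>r\<close>
            is sortable by the rank two case.\<close>
          obtain w where w: "is_lub r s w" "w \<preceq> z1"
            using lub_exists[of r s z1] gen_below[OF r(1) z1r] gen_below[OF s z1s] z1D(1) s r by auto
          note wD = is_lubD[OF w(1)]
          have wr: "simple r \<in> inv_roots w" using wD(2) inv_roots_gen[OF r(1)] by simp
          have "w \<in> para {r, s}" using para_lub[OF w(1), of "{r, s}"] para_gen r s by simp
          then have rw: "r \<otimes> w \<in> para {s, r}" using r by (auto intro!: para_gen_mult simp: insert_commute)
          have "simple r \<notin> inv_roots (r \<otimes> w)" using inv_roots_gen_simple[OF wD(1) r(1)] wr by simp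
          then have "srt [s, r] (r \<otimes> w)" using srt_rank_two[of s r] r s rw by auto
          moreover have "filter (\<lambda>x. x \<in> {s, r}) (es @ [s, r]) = [s, r]"
            using L Cons by (auto simp: filter_empty_conv)
          ultimately have w2: "srt (es @ [s, r]) (r \<otimes> w)"
            using srt_filter[of "es @ [s, r]" "r \<otimes> w" "{s, r}"] rw L Cons by (auto simp: letters_def)
          have "is_lub y w z1"
          proof -
            have "z1 \<preceq> u" if "u \<in> carrier W" "y \<preceq> u" "w \<preceq> u" for u
              using that wD(3) z1D(4) by blast
            then show ?thesis using z1D w by (simp add: is_lub_def)
          qed
          then have lr: "is_lub (r \<otimes> y) (r \<otimes> w) (r \<otimes> z1)"
            using is_lub_gen_mult True wr wD(1) m r by blast
          have "len z1 = Suc (len (r \<otimes> z1))" using len_gen_descent z1D r z1r by blast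
          have "srt (es @ [s, r]) (r \<otimes> z1)"
          proof (rule IH[OF _ _ _ lr])
            show "srt (es @ [s, r]) (r \<otimes> y)" "srt (es @ [s, r]) (r \<otimes> w)" by fact+
            show "len (r \<otimes> z1) < len z \<or> len (r \<otimes> z1) \<le> len z \<and> length (es @ [s, r]) < length cs"
              using \<open>len z1 = Suc (len (r \<otimes> z1))\<close> lz1 by simp
            show "letters (es @ [s, r])" using L Cons by (auto simp: letters_def)
          qed
          then show ?thesis using srt_Cons[OF Lr z1D(1)] z1r Cons by simp
        qed
      qed
      then have z1': "srt (ds @ [s]) (s \<otimes> z1)" using srt_delete_final(1)[OF _ L' z1s] by blast
      have "is_lub x z1 z"
      proof -
        have "z \<preceq> u" if "u \<in> carrier W" "x \<preceq> u" "z1 \<preceq> u" for u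
          using that z1D(3) is_lubD(4)[OF m(3)] by blast
        then show ?thesis using is_lubD[OF m(3)] z1 by (simp add: is_lub_def)
      qed
      then have "is_lub (s \<otimes> x) (s \<otimes> z1) (s \<otimes> z)" using is_lub_gen_mult m z1D(1) z1s s by blast
      moreover have "len z = Suc (len (s \<otimes> z))" using len_gen_descent z(1) s sz by blast
      ultimately have "srt (ds @ [s]) (s \<otimes> z)" using sx z1' L' by - (rule IH[of _ "s \<otimes> x" "s \<otimes> z1"], auto)
      then show ?thesis using srt_Cons[OF L z(1)] sz by simp
    qed
    show ?thesis
    proof (cases "simple s \<in> inv_roots x"; cases "simple s \<in> inv_roots y")
      assume xy: "simple s \<in> inv_roots x" "simple s \<in> inv_roots y"
      have sz: "simple s \<in> inv_roots z" using xy z(2) by blast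
      have "srt (ds @ [s]) (s \<otimes> x)" "srt (ds @ [s]) (s \<otimes> y)"
        using srt_Cons[OF L c(1)] srt_Cons[OF L c(2)] xy less.prems Cons by auto
      moreover have "is_lub (s \<otimes> x) (s \<otimes> y) (s \<otimes> z)" using is_lub_gen_mult less.prems c s xy by blast
      moreover have "len z = Suc (len (s \<otimes> z))" using len_gen_descent z(1) s sz by blast
      ultimately have "srt (ds @ [s]) (s \<otimes> z)" using L' by - (rule IH[of _ "s \<otimes> x" "s \<otimes> y"], auto)
      then show ?thesis using srt_Cons[OF L z(1)] sz Cons by simp
    next
      assume xy: "simple s \<in> inv_roots x" "simple s \<notin> inv_roots y"
      then show ?thesis using mixed[of x y] less.prems Cons c by simp
    next
      assume xy: "simple s \<notin> inv_roots x" "simple s \<in> inv_roots y"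
      then show ?thesis using mixed[of y x] less.prems Cons c is_lub_commute by simp
    next
      assume xy: "simple s \<notin> inv_roots x" "simple s \<notin> inv_roots y"
      then have "srt ds x" "srt ds y" using srt_Cons[OF L c(1)] srt_Cons[OF L c(2)] less.prems Cons by auto
      then have "srt ds z" using less.prems(4) L Cons by - (rule IH[of _ x y], auto)
      then show ?thesis using Cons by (simp add: srt.skip)
    qed
  qed
qed

subsection \<open>Skips and cover reflections\<close>

text \<open>\<open>skipped cs w q \<gamma>\<close> says that \<open>\<gamma> = p \<alpha>\<^sub>q\<close>, where \<open>p\<close> is the prefix of the sorting word of \<open>w\<close> before the first
  skipped occurrence of \<open>q\<close>; all later inversions are orthogonal to \<open>\<gamma>\<close> from the right for the Euler
  form.  Up to signs, the vectors \<open>\<gamma>\<close> for all \<open>q\<close> form an exceptional sequence.\<close>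

definition skipped :: "'a list \<Rightarrow> 'a \<Rightarrow> 'a \<Rightarrow> ('a \<Rightarrow> real) \<Rightarrow> bool"
  where "skipped cs w q \<gamma> \<longleftrightarrow> \<gamma> \<in> roots \<and> supp (set cs) \<gamma> \<and>
    (\<exists>p xs. p \<in> carrier W \<and> xs \<in> lists S \<and> w = p \<otimes> wd xs \<and> \<gamma> = rep p (simple q) \<and> q \<notin> set xs \<and>
      (\<forall>\<delta>\<in>set (rseq xs). rep p \<delta> \<in> inv_roots w \<and> euler cs \<gamma> (rep p \<delta>) = 0))"

text \<open>By \<open>act_simple_expand\<close> the image of the simple root is \<gamma> plus a
  nonnegative combination of inversions. Read contrapositively: at a right descent \<open>q\<close>
  of \<open>w\<close> the skip vector is negative.\<close>

lemma skipped_expand: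
  assumes "skipped cs w q \<gamma>" "q \<in> S" "\<gamma> \<in> pos_roots"
  shows "rep w (simple q) \<in> pos_roots"
proof -
  obtain p xs where p: "p \<in> carrier W" "xs \<in> lists S" "w = p \<otimes> wd xs" "\<gamma> = rep p (simple q)" "q \<notin> set xs"
    "\<forall>\<delta>\<in>set (rseq xs). rep p \<delta> \<in> inv_roots w \<and> euler cs \<gamma> (rep p \<delta>) = 0"
    using assms(1) unfolding skipped_def by blast
  have "rep w (simple q) = rep p (act xs (simple q))" using p rep_wd[OF p(2)] by (simp add: rep_mult)
  also have "\<dots> = (\<lambda>x. 1 * \<gamma> x + 1 * rep p (\<lambda>x. \<Sum>j<length xs. - cartan q (xs ! j) * (rseq xs ! j) x) x)"
    unfolding act_simple_expand[OF p(2) assms(2)] p(4) by (rule rep_lin[OF p(1)])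
  also have "rep p (\<lambda>x. \<Sum>j<length xs. - cartan q (xs ! j) * (rseq xs ! j) x) =
    (\<lambda>x. \<Sum>j<length xs. - cartan q (xs ! j) * rep p (rseq xs ! j) x)"
    by (rule rep_sum[OF p(1)]) simp
  finally have e: "rep w (simple q) = (\<lambda>x. 1 * \<gamma> x + 1 * (\<Sum>j<length xs. - cartan q (xs ! j) * rep p (rseq xs ! j) x))" .
  have "0 \<le> rep w (simple q) x" for x
  proof -
    have "0 \<le> - cartan q (xs ! j) * rep p (rseq xs ! j) x" if j: "j < length xs" for j
    proof -
      have "xs ! j \<in> set xs" using j by simp
      then have "xs ! j \<in> S" "xs ! j \<noteq> q" using p(2,5) by auto
      then have "cartan q (xs ! j) \<le> 0" using cartan_nonpos assms(2) by metis
      moreover have "rseq xs ! j \<in> set (rseq xs)" using j by simp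
      then have "0 \<le> rep p (rseq xs ! j) x" using p(6) inv_roots_pos pos_rootsD(2) by blast
      ultimately show ?thesis by (simp add: mult_nonpos_nonneg)
    qed
    then have "0 \<le> (\<Sum>j<length xs. - cartan q (xs ! j) * rep p (rseq xs ! j) x)" by (intro sum_nonneg) auto
    then show ?thesis unfolding e using pos_rootsD(2)[OF assms(3), of x] by simp
  qed
  moreover have "w \<in> carrier W" using p by simp
  ultimately show ?thesis using rep_roots[OF _ simple_roots[OF assms(2)]] pos_rootsI by blast
qed

text \<open>The Euler form with a later inversion vanishes on one side, and on the other it is the
  coefficient at the final letter \<open>s\<close>, which is nonnegative. So the symmetric form is
  nonnegative there and \<open>act_simple_fixed\<close> applies.\<close>

lemma skipped_fixed:
  assumes "skipped (cs @ [s]) u q (simple s)" "q \<in> S" "letters (cs @ [s])" "u \<in> para (set (cs @ [s]))"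
  shows "rep u (simple q) = simple s"
proof -
  obtain p xs where p: "p \<in> carrier W" "xs \<in> lists S" "u = p \<otimes> wd xs" "simple s = rep p (simple q)" "q \<notin> set xs"
    "\<forall>\<delta>\<in>set (rseq xs). rep p \<delta> \<in> inv_roots u \<and> euler (cs @ [s]) (simple s) (rep p \<delta>) = 0"
    using assms(1) unfolding skipped_def by blast
  have "0 \<le> form (simple q) \<delta>" if d: "\<delta> \<in> set (rseq xs)" for \<delta>
  proof -
    have i: "rep p \<delta> \<in> inv_roots u" using p(6) d by blast
    have "form (simple q) \<delta> = form (simple s) (rep p \<delta>)" using rep_form[OF p(1), of "simple q" \<delta>] p(4) by simp
    also have "\<dots> = euler (cs @ [s]) (simple s) (rep p \<delta>) + euler (cs @ [s]) (rep p \<delta>) (simple s)"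
      using paraD(2)[OF assms(4) i] assms(3) lettersD[OF assms(3)] by (intro euler_form[symmetric]) auto
    also have "\<dots> = rep p \<delta> s"
      using p(6) d euler_final[of cs s "rep p \<delta>"] lettersD[OF assms(3)] by simp
    finally show ?thesis using pos_rootsD(2)[OF inv_roots_pos[OF i]] by simp
  qed
  then have "act xs (simple q) = simple q" using act_simple_fixed[OF p(2) assms(2) p(5)] by blast
  then show ?thesis using p rep_wd[OF p(2)] by (simp add: rep_mult)
qed

text \<open>At a \<open>skip\<close>, the vector for \<open>s\<close> is its own simple root, Euler
  orthogonal from the left to everything not involving \<open>s\<close> by
  \<open>euler_initial\<close>. At a \<open>take\<close>, all vectors are reflected and Euler
  products are preserved by \<open>euler_rotate\<close>. A vector that turns negative there was the
  simple root of \<open>s\<close>, and \<open>skipped_fixed\<close> identifies it with the image of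
  the simple root of \<open>q\<close>.\<close>

lemma skip_vectors:
  assumes "srt cs w" "letters cs"
  shows "\<exists>C. (\<forall>q\<in>set cs. skipped cs w q (C q) \<and> (C q \<notin> pos_roots \<longrightarrow> rep w (simple q) = C q)) \<and>
    (\<forall>q\<in>set cs. \<forall>q'\<in>set cs. q \<noteq> q' \<longrightarrow> euler cs (C q) (C q') = 0 \<or> euler cs (C q') (C q) = 0)"
  using assms
proof (induction rule: srt.induct)
  case nil
  then show ?case by simp
next
  case (skip cs w s)
  have L: "letters cs" and s: "s \<in> S" "s \<notin> set cs" using skip.prems by auto
  have wp: "w \<in> para (set cs)" using srt_para[OF skip.hyps(1) L] .
  obtain C where C: "\<And>q. q \<in> set cs \<Longrightarrow> skipped cs w q (C q)"
    "\<And>q. \<lbrakk>q \<in> set cs; C q \<notin> pos_roots\<rbrakk> \<Longrightarrow> rep w (simple q) = C q"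
    "\<And>q q'. \<lbrakk>q \<in> set cs; q' \<in> set cs; q \<noteq> q'\<rbrakk> \<Longrightarrow> euler cs (C q) (C q') = 0 \<or> euler cs (C q') (C q) = 0"
    using skip.IH[OF L] by blast
  define D where "D = C(s := simple s)"
  have Cs: "supp (set cs) (C q)" if "q \<in> set cs" for q using C(1)[OF that] by (simp add: skipped_def)
  have Ds: "D s = simple s" by (simp add: D_def)
  have DC: "D q = C q" if "q \<in> set cs" for q using that s by (auto simp: D_def)
  have es: "euler (s # cs) (simple s) v = 0" if "supp (set cs) v" for v
    using euler_initial[of s cs v] suppD[OF that] s L lettersD(1) by simp
  have sk_s: "skipped (s # cs) w s (simple s)"
  proof -
    obtain xs where xs: "xs \<in> lists (set cs \<inter> S)" "wd xs = w" "length xs = len w"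
      using para_word[OF wp] by blast
    have xsS: "xs \<in> lists S" using xs(1) by auto
    have "s \<notin> set xs" using xs(1) s by auto
    moreover have "\<forall>\<delta>\<in>set (rseq xs). rep \<one> \<delta> \<in> inv_roots w \<and> euler (s # cs) (simple s) (rep \<one> \<delta>) = 0"
      using inv_roots_rseq[OF xsS] xs es paraD(2)[OF wp] by simp
    moreover have "w = \<one> \<otimes> wd xs" "simple s = rep \<one> (simple s)" using xs paraD(1)[OF wp] by auto
    ultimately have "\<exists>p xs. p \<in> carrier W \<and> xs \<in> lists S \<and> w = p \<otimes> wd xs \<and> simple s = rep p (simple s) \<and> s \<notin> set xs \<and>
      (\<forall>\<delta>\<in>set (rseq xs). rep p \<delta> \<in> inv_roots w \<and> euler (s # cs) (simple s) (rep p \<delta>) = 0)"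
      using xsS one_closed by blast
    then show ?thesis unfolding skipped_def using simple_roots[OF s(1)] by simp
  qed
  have sk: "skipped (s # cs) w q (C q)" if q: "q \<in> set cs" for q
  proof -
    obtain p xs where p: "p \<in> carrier W" "xs \<in> lists S" "w = p \<otimes> wd xs" "C q = rep p (simple q)" "q \<notin> set xs"
      "\<forall>\<delta>\<in>set (rseq xs). rep p \<delta> \<in> inv_roots w \<and> euler cs (C q) (rep p \<delta>) = 0"
      using C(1)[OF q] unfolding skipped_def by blast
    have "\<forall>\<delta>\<in>set (rseq xs). rep p \<delta> \<in> inv_roots w \<and> euler (s # cs) (C q) (rep p \<delta>) = 0"
      using p(6) euler_Cons_supp[OF Cs[OF q] paraD(2)[OF wp] s(2)] by metis
    moreover have "C q \<in> roots" using C(1)[OF q] by (simp add: skipped_def)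
    moreover have "supp (set (s # cs)) (C q)" by (rule supp_mono[OF Cs[OF q]]) auto
    ultimately show ?thesis unfolding skipped_def using p by blast
  qed
  have "skipped (s # cs) w q (D q) \<and> (D q \<notin> pos_roots \<longrightarrow> rep w (simple q) = D q)" if "q \<in> set (s # cs)" for q
    using that sk_s sk C(2) DC s by (auto simp: Ds)
  moreover have "euler (s # cs) (D q) (D q') = 0 \<or> euler (s # cs) (D q') (D q) = 0"
    if q: "q \<in> set (s # cs)" "q' \<in> set (s # cs)" "q \<noteq> q'" for q q'
  proof -
    consider "q = s" "q' \<in> set cs" | "q' = s" "q \<in> set cs" | "q \<in> set cs" "q' \<in> set cs" using q by auto
    then show ?thesis
    proof cases
      case 1 then show ?thesis using es[OF Cs] Ds DC by simp
    next
      case 2 then show ?thesis using es[OF Cs] Ds DC by simp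
    next
      case 3
      then show ?thesis using C(3) q(3) euler_Cons_supp[OF Cs Cs s(2)] DC by metis
    qed
  qed
  ultimately show ?case by blast
next
  case (take cs s u)
  have L: "letters (cs @ [s])" and s: "s \<in> S" "s \<notin> set cs" using take.prems by auto
  have Lc: "distinct (s # cs)" "set (s # cs) \<subseteq> S" using lettersD[OF take.prems] by auto
  have up: "u \<in> para (set (cs @ [s]))" using srt_para[OF take.hyps(1) L] .
  have uc: "u \<in> carrier W" using up paraD by blast
  obtain C where C: "\<And>q. q \<in> set (cs @ [s]) \<Longrightarrow> skipped (cs @ [s]) u q (C q)"
    "\<And>q. \<lbrakk>q \<in> set (cs @ [s]); C q \<notin> pos_roots\<rbrakk> \<Longrightarrow> rep u (simple q) = C q"
    "\<And>q q'. \<lbrakk>q \<in> set (cs @ [s]); q' \<in> set (cs @ [s]); q \<noteq> q'\<rbrakk> \<Longrightarrow>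
      euler (cs @ [s]) (C q) (C q') = 0 \<or> euler (cs @ [s]) (C q') (C q) = 0"
    using take.IH[OF L] by blast
  define D where "D = (\<lambda>q. reflect s (C q))"
  have set_eq: "set (cs @ [s]) = set (s # cs)" by auto
  have Cs: "supp (set (s # cs)) (C q)" "C q \<in> roots" if "q \<in> set (s # cs)" for q
    using C(1)[of q] that unfolding set_eq skipped_def by auto
  have eu: "euler (s # cs) (reflect s v) (reflect s v') = euler (cs @ [s]) v v'"
    if "supp (set (s # cs)) v" "supp (set (s # cs)) v'" for v v'
    using euler_rotate[OF Lc, of "reflect s v" "reflect s v'"] that supp_reflect[of s "set (s # cs)"] s by simp
  have "skipped (s # cs) (s \<otimes> u) q (D q)" if q: "q \<in> set (s # cs)" for q
  proof -
    obtain p xs where p: "p \<in> carrier W" "xs \<in> lists S" "u = p \<otimes> wd xs" "C q = rep p (simple q)" "q \<notin> set xs"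
      "\<forall>\<delta>\<in>set (rseq xs). rep p \<delta> \<in> inv_roots u \<and> euler (cs @ [s]) (C q) (rep p \<delta>) = 0"
      using C(1)[of q] q unfolding set_eq skipped_def by blast
    have "rep (s \<otimes> p) \<delta> \<in> inv_roots (s \<otimes> u) \<and> euler (s # cs) (D q) (rep (s \<otimes> p) \<delta>) = 0" if d: "\<delta> \<in> set (rseq xs)" for \<delta>
    proof -
      have i: "rep p \<delta> \<in> inv_roots u" "euler (cs @ [s]) (C q) (rep p \<delta>) = 0" using p(6) d by auto
      have "supp (set (s # cs)) (rep p \<delta>)" using paraD(2)[OF up i(1)] by simp
      then show ?thesis
        using i inv_roots_gen_mult_eq[OF uc s(1) take.hyps(2)] eu[OF Cs(1)[OF q]] p(1) s(1) by (simp add: rep_mult D_def)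
    qed
    moreover have "s \<otimes> u = (s \<otimes> p) \<otimes> wd xs" "D q = rep (s \<otimes> p) (simple q)"
      using p s by (simp_all add: m_assoc rep_mult D_def)
    moreover have "D q \<in> roots" using rep_roots[of s "C q"] Cs(2)[OF q] s by (simp add: D_def)
    moreover have "supp (set (s # cs)) (D q)" using Cs(1)[OF q] supp_reflect[of s "set (s # cs)"] by (simp add: D_def)
    moreover have "s \<otimes> p \<in> carrier W" using p s by simp
    ultimately show ?thesis unfolding skipped_def using p(2,5) by blast
  qed
  moreover have "rep (s \<otimes> u) (simple q) = D q" if q: "q \<in> set (s # cs)" "D q \<notin> pos_roots" for q
  proof -
    have qS: "q \<in> S" using q Lc by auto
    have "rep u (simple q) = C q"
    proof (cases "C q \<in> pos_roots")
      case True
      then have "C q = simple s" using reflect_pos[OF s(1)] q(2) unfolding D_def by blast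
      moreover have "skipped (cs @ [s]) u q (C q)" using C(1)[of q] q set_eq by simp
      ultimately show ?thesis using skipped_fixed[of cs s u q] qS L up by simp
    next
      case False then show ?thesis using C(2)[of q] q set_eq by simp
    qed
    then show ?thesis using uc s by (simp add: rep_mult D_def)
  qed
  moreover have "euler (s # cs) (D q) (D q') = 0 \<or> euler (s # cs) (D q') (D q) = 0"
    if q: "q \<in> set (s # cs)" "q' \<in> set (s # cs)" "q \<noteq> q'" for q q'
    using C(3)[of q q'] q eu[OF Cs(1)[OF q(1)] Cs(1)[OF q(2)]] eu[OF Cs(1)[OF q(2)] Cs(1)[OF q(1)]]
    by (simp add: D_def)
  ultimately show ?case by blast
qed

text \<open>Deleting \<open>s\<close> shows that some descent \<open>p\<close> belongs to it. For
  another descent \<open>q\<close> with inversion \<beta>, the skip vectors are the negatives of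
  \<beta> and the simple root of \<open>s\<close>, so one of their two Euler products vanishes. The
  products sum to \<open>cartan p q\<close>, which is nonpositive, and one of them is the
  nonnegative coefficient of \<beta> at \<open>s\<close>; so this coefficient is zero.\<close>

lemma srt_final_cover:
  assumes "srt (cs @ [s]) x" "letters (cs @ [s])" "simple s \<in> inv_roots x"
    and q: "q \<in> S" "rep x (simple q) \<notin> pos_roots"
  shows "rep x (simple q) = (\<lambda>z. - simple s z) \<or> supp (set cs) (rep x (simple q))"
proof -
  let ?cs = "cs @ [s]"
  define \<beta> where "\<beta> = (\<lambda>z. - rep x (simple q) z)"
  have s: "s \<in> S" using assms by simp
  have xp: "x \<in> para (set ?cs)" using srt_para assms by blast
  have xc: "x \<in> carrier W" using xp paraD by blast
  obtain p where p: "p \<in> S" "rep x (simple p) = (\<lambda>z. - simple s z)"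
    using srt_delete_final(2)[OF assms(1-3)] by blast
  obtain C where C: "\<And>q. q \<in> set ?cs \<Longrightarrow> skipped ?cs x q (C q)"
    "\<And>q. \<lbrakk>q \<in> set ?cs; C q \<notin> pos_roots\<rbrakk> \<Longrightarrow> rep x (simple q) = C q"
    "\<And>q q'. \<lbrakk>q \<in> set ?cs; q' \<in> set ?cs; q \<noteq> q'\<rbrakk> \<Longrightarrow> euler ?cs (C q) (C q') = 0 \<or> euler ?cs (C q') (C q) = 0"
    using skip_vectors[OF assms(1,2)] by blast
  have C': "q \<in> set ?cs \<and> C q = rep x (simple q)" if q: "q \<in> S" "rep x (simple q) \<notin> pos_roots" for q
  proof -
    have r: "rep x (simple q) \<in> roots" using rep_roots[OF xc simple_roots[OF q(1)]] .
    have "q \<in> set ?cs"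
    proof (rule ccontr)
      assume "q \<notin> set ?cs"
      then have "rep x (simple q) q = 1" using rep_para[OF xp] by (simp add: simple_def)
      then show False using pos_if_coeff[OF r, of q] q(2) by simp
    qed
    moreover from this have "C q \<notin> pos_roots" using skipped_expand[OF C(1)] q by blast
    ultimately show ?thesis using C(2) by metis
  qed
  have r: "rep x (simple q) \<in> roots" using rep_roots[OF xc simple_roots[OF q(1)]] .
  then have bp: "\<beta> \<in> pos_roots" using not_pos_iff q(2) by (simp add: \<beta>_def)
  have "supp (set ?cs) (rep x (simple q))" using supp_rep[OF xp] C'[OF q] by simp
  then have su: "supp (set ?cs) \<beta>" by (simp add: supp_def \<beta>_def)
  have rb: "rep x (simple q) = (\<lambda>z. - \<beta> z)" by (simp add: \<beta>_def)
  have np: "rep x (simple p) \<notin> pos_roots" using p not_pos_uminus s by simp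
  show ?thesis
  proof (cases "p = q")
    case False
    have en: "euler ?cs (\<lambda>z. - u z) (\<lambda>z. - v z) = euler ?cs u v" for u v
      using euler_lin_left[of ?cs "-1" u 0 u "\<lambda>z. - v z"] euler_lin_right[of ?cs u "-1" v 0 v] by simp
    have "euler ?cs (C p) (C q) = 0 \<or> euler ?cs (C q) (C p) = 0"
      using C(3) C'[OF q] C'[OF p(1) np] False by blast
    then have 1: "euler ?cs (simple s) \<beta> = 0 \<or> euler ?cs \<beta> (simple s) = 0"
      using C'[OF q] C'[OF p(1) np] p(2) rb en by simp
    have fin: "euler ?cs \<beta> (simple s) = \<beta> s" using euler_final[of cs s \<beta>] lettersD[OF assms(2)] by simp
    have fo: "euler ?cs (simple s) \<beta> + euler ?cs \<beta> (simple s) = form (simple s) \<beta>"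
      using su lettersD[OF assms(2)] by (intro euler_form) auto
    have fn: "form (\<lambda>z. - u z) (\<lambda>z. - v z) = form u v" for u v by (simp add: form_def)
    have "form (simple s) \<beta> = form (rep x (simple p)) (rep x (simple q))" unfolding p(2) rb fn ..
    also have "\<dots> = cartan p q" using rep_form[OF xc] p(1) q(1) by simp
    also have "\<dots> \<le> 0" using cartan_nonpos p(1) q(1) False by blast
    finally have "form (simple s) \<beta> \<le> 0" .
    moreover have "0 \<le> \<beta> s" using bp pos_rootsD(2) by blast
    ultimately have "\<beta> s = 0" using 1 fin fo by linarith
    then have "supp (set cs) \<beta>" using su by (auto simp: supp_def)
    then show ?thesis by (simp add: supp_def rb)
  qed (use p in simp)
qed

text \<open>Climb from \<open>z\<close> to \<open>x\<close> by covers; the root added in the last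
  step is the one sought.\<close>

lemma ex_cover_above:
  assumes "x \<in> carrier W" "z \<in> carrier W" "z \<preceq> x" "z \<noteq> x"
  obtains q where "q \<in> S" "rep x (simple q) \<notin> pos_roots" "(\<lambda>t. - rep x (simple q) t) \<notin> inv_roots z"
proof -
  have "\<exists>q\<in>S. rep x (simple q) \<notin> pos_roots \<and> (\<lambda>t. - rep x (simple q) t) \<notin> inv_roots z"
    using assms(2-)
  proof (induction "len (inv z \<otimes> x)" arbitrary: z rule: less_induct)
    case less
    obtain q where q: "q \<in> S" "rep z (simple q) \<in> pos_roots" "rep z (simple q) \<in> inv_roots x"
      "len (inv z \<otimes> x) = Suc (len (inv (z \<otimes> q) \<otimes> x))"
      using le_cover[OF assms(1) less.prems] by blast
    note n = inv_roots_mult_gen[OF less.prems(1) q(1,2)]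
    show ?case
    proof (cases "z \<otimes> q = x")
      case True
      then have e: "rep x (simple q) = (\<lambda>t. - rep z (simple q) t)"
        using less.prems q(1) by (auto simp: rep_mult reflect_simple_self rep_uminus)
      show ?thesis using e n(2) q not_pos_uminus[OF q(2)] by (intro bexI[of _ q]) auto
    next
      case False
      have "z \<otimes> q \<preceq> x" using n(1) q less.prems by simp
      then obtain q' where "q' \<in> S" "rep x (simple q') \<notin> pos_roots" "(\<lambda>t. - rep x (simple q') t) \<notin> inv_roots (z \<otimes> q)"
        using less.hyps[of "z \<otimes> q"] q less.prems False by auto
      then show ?thesis using n(1) by blast
    qed
  qed
  then show ?thesis using that by blast
qed

text \<open>If the join of \<open>s\<close> and \<open>v\<close> were strictly below
  \<open>x\<close>, some cover reflection of \<open>x\<close> would not be an inversion of it. By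
  \<open>srt_final_cover\<close> that reflection is \<open>s\<close> or lies in the parabolic
  subgroup, and then it is an inversion of \<open>s\<close> or of \<open>v\<close>.\<close>

lemma srt_final_lub:
  assumes "srt (cs @ [s]) x" "letters (cs @ [s])" "simple s \<in> inv_roots x"
    and v: "v \<in> para (set cs)" "inv_roots v = restr (set cs) x"
  shows "is_lub s v x"
proof -
  have s: "s \<in> S" using assms by simp
  have xc: "x \<in> carrier W" using srt_carrier assms by blast
  have vc: "v \<in> carrier W" using v paraD by blast
  have vx: "v \<preceq> x" using v by (auto simp: restr_def)
  obtain z where z: "is_lub s v z" "z \<preceq> x"
    using lub_exists[of s v x] gen_below[OF s assms(3)] vx vc xc s by auto
  note zD = is_lubD[OF z(1)]
  have "z = x"
  proof (rule ccontr)
    assume "z \<noteq> x"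
    then obtain q where q: "q \<in> S" "rep x (simple q) \<notin> pos_roots" "(\<lambda>t. - rep x (simple q) t) \<notin> inv_roots z"
      using ex_cover_above[OF xc zD(1) z(2)] by blast
    let ?\<beta> = "\<lambda>t. - rep x (simple q) t"
    have r: "rep x (simple q) \<in> roots" using rep_roots[OF xc simple_roots[OF q(1)]] .
    have "rep (inv x) ?\<beta> = (\<lambda>t. - simple q t)" using rep_uminus xc by simp
    then have bi: "?\<beta> \<in> inv_roots x"
      using not_pos_iff[OF r] q(1,2) not_pos_uminus by (simp add: inv_roots_def)
    have "rep x (simple q) = (\<lambda>z. - simple s z) \<or> supp (set cs) (rep x (simple q))"
      using srt_final_cover[OF assms(1-3) q(1,2)] .
    then show False
    proof
      assume "rep x (simple q) = (\<lambda>z. - simple s z)"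
      then have "?\<beta> = simple s" by simp
      then show False using q(3) zD(2) inv_roots_gen[OF s] by auto
    next
      assume "supp (set cs) (rep x (simple q))"
      then have "?\<beta> \<in> restr (set cs) x" using bi by (simp add: restr_def supp_def)
      then show False using q(3) zD(3) v(2) by blast
    qed
  qed
  then show ?thesis using z by simp
qed

section \<open>Words for Coxeter elements and sorting words\<close>

text \<open>An element of the parabolic subgroup preserves the coordinate of a letter outside
  \<open>J\<close>. The vector \<open>v\<close>, chosen so that the part after \<open>s\<close>
  carries it to the simple root of \<open>s\<close>, has coordinate 1 at \<open>s\<close>, and its
  image under the whole word has coordinate -1.\<close>

lemma para_letters_subset:
  assumes "letters xs" "wd xs \<in> para J" shows "set xs \<subseteq> J"
proof
  fix s assume "s \<in> set xs"
  then obtain as bs where xs: "xs = as @ s # bs" by (meson split_list)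
  have S: "xs \<in> lists S" "as \<in> lists S" "bs \<in> lists S" "s \<in> S" using assms(1) xs by (auto simp: letters_def)
  have n: "s \<notin> set as" "s \<notin> set bs" using assms(1) xs by (auto simp: letters_def)
  show "s \<in> J"
  proof (rule ccontr)
    assume "s \<notin> J"
    define v where "v = rep (inv (wd bs)) (simple s)"
    have "v = act (rev bs) (simple s)" using S rep_wd[of "rev bs"] by (simp add: v_def inv_wd in_lists_conv_set)
    moreover have "rev bs \<in> lists (- {s})" using n by (auto simp: in_lists_conv_set)
    ultimately have v1: "v s = 1" using act_support[of "rev bs" "- {s}" s] by (simp add: simple_def)
    have "act bs v = simple s" using S rep_wd[of bs] rep_inv(2)[of "wd bs" "simple s"] by (simp add: v_def)
    then have "rep (wd xs) v = act as (\<lambda>x. - simple s x)"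
      using rep_wd[OF S(1)] S(4) by (simp add: xs reflect_simple_self)
    moreover have "as \<in> lists (- {s})" using n by (auto simp: in_lists_conv_set)
    ultimately have "rep (wd xs) v s = - 1" using act_support[of as "- {s}" s] by (simp add: simple_def)
    then show False using rep_para[OF assms(2) \<open>s \<notin> J\<close>, of v] v1 by simp
  qed
qed

text \<open>Every word with the same product contains all letters of \<open>xs\<close>, hence is at
  least as long.\<close>

lemma len_letters: 
  assumes "letters xs" shows "len (wd xs) = length xs"
proof -
  have xs: "xs \<in> lists S" using lettersD(2)[OF assms] by auto
  obtain ys where ys: "ys \<in> lists S" "wd ys = wd xs" "length ys = len (wd xs)"
    using ex_reduced[OF wd_closed[OF xs]] by blast
  have "wd xs \<in> para (set ys)" using word_para[of ys "set ys"] ys by (auto simp: in_lists_conv_set)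
  then have "set xs \<subseteq> set ys" using para_letters_subset assms by blast
  then have "card (set xs) \<le> length ys" using card_mono[of "set ys" "set xs"] card_length[of ys] by simp
  then show ?thesis using ys len_le[OF xs] distinct_card[OF lettersD(1)[OF assms]] by simp
qed

lemma reduced_word_coxeter_element:
  assumes "letters xs" "set xs = S"
  shows "reduced_word W S ys (wd xs) \<longleftrightarrow> letters ys \<and> set ys = S \<and> wd ys = wd xs"
proof
  assume "reduced_word W S ys (wd xs)"
  then have ys: "ys \<in> lists S" "wd ys = wd xs" "length ys = length xs"
    using len_letters[OF assms(1)] by (auto simp: reduced_word_def)
  have "wd xs \<in> para (set ys)" using word_para[of ys "set ys"] ys by (auto simp: in_lists_conv_set)
  then have "S \<subseteq> set ys" using para_letters_subset[OF assms(1)] assms(2) by blast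
  then have e: "set ys = S" using ys(1) by auto
  then have "card (set ys) = length ys" using assms ys distinct_card[of xs] lettersD by metis
  then have "distinct ys" by (rule card_distinct)
  then show "letters ys \<and> set ys = S \<and> wd ys = wd xs" using e ys by (simp add: letters_def)
next
  assume "letters ys \<and> set ys = S \<and> wd ys = wd xs"
  then show "reduced_word W S ys (wd xs)" using len_letters[of ys] by (auto simp: reduced_word_def)
qed

lemma commute_if_cartan_zero:
  assumes "s \<in> S" "a \<in> S" "cartan a s = 0" shows "s \<otimes> a = a \<otimes> s"
proof -
  have "reflect s (simple a) = simple a" using assms by (simp add: reflect_eq)
  then have "a = s \<otimes> a \<otimes> s" using reflection_of_conj[of "simple a" s] assms simple_roots by simp
  then have "a \<otimes> s = s \<otimes> a \<otimes> s \<otimes> s" by simp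
  then show ?thesis using assms by simp
qed

text \<open>The simple root of \<open>s\<close> occurs in the root sequence of \<open>ys\<close>, at
  the letter \<open>s\<close> because a letter absent from the prefix keeps its coordinate. The
  prefix therefore fixes this root, and the nonnegative sum in \<open>act_simple_expand\<close>
  vanishes. The entry for each prefix letter has coefficient 1 at that letter, since letters are
  distinct; so its Cartan entry with \<open>s\<close> is zero and it commutes with
  \<open>s\<close>.\<close>

lemma letters_first:
  assumes "letters (s # xs)" "letters ys" "wd (s # xs) = wd ys"
  obtains as bs where "ys = as @ s # bs" "\<forall>a\<in>set as. a \<otimes> s = s \<otimes> a" "wd (as @ bs) = wd xs"
proof -
  have S: "s \<in> S" "xs \<in> lists S" "ys \<in> lists S" using assms lettersD by auto
  have yc: "wd ys \<in> carrier W" using S by simp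
  have "s \<otimes> wd ys = wd xs" using assms(3)[symmetric] S by simp
  then have "len (s \<otimes> wd ys) < len (wd ys)"
    using len_letters[of xs] len_letters[of "s # xs"] assms by simp
  then have "simple s \<in> inv_roots (wd ys)" using simple_in_inv_roots_iff S yc by simp
  then have "simple s \<in> set (rseq ys)" using inv_roots_rseq[OF S(3)] len_letters[OF assms(2)] by simp
  then obtain i where i: "i < length ys" "rseq ys ! i = simple s" by (auto simp: in_set_conv_nth)
  define as where "as = take i ys"
  define bs where "bs = drop (Suc i) ys"
  have ys: "ys = as @ ys ! i # bs" using id_take_nth_drop[OF i(1)] by (simp add: as_def bs_def)
  have La: "letters as" "ys ! i \<notin> set as"
  proof -
    have "letters (as @ ys ! i # bs)" using assms(2) ys by simp
    then show "letters as" "ys ! i \<notin> set as" by (auto simp: letters_def)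
  qed
  have asS: "as \<in> lists S" using La lettersD by auto
  have e: "act as (simple (ys ! i)) = simple s" using rseq_nth[OF i(1)] i(2) by (simp add: as_def)
  have "as \<in> lists (- {ys ! i})" using La by (auto simp: in_lists_conv_set)
  then have "simple s (ys ! i) = 1" using act_support[of as "- {ys ! i}" "ys ! i" "simple (ys ! i)"] e
    by (simp add: simple_def)
  then have yi: "ys ! i = s" by (simp add: simple_def split: if_splits)
  have co: "cartan s (as ! j) = 0" if j: "j < length as" for j
  proof -
    let ?x = "as ! j"
    have sum0: "(\<Sum>l<length as. - cartan s (as ! l) * (rseq as ! l) ?x) = 0"
      using fun_cong[OF e, of ?x] fun_cong[OF act_simple_expand[OF asS S(1)], of ?x] yi by simp
    have nn: "0 \<le> - cartan s (as ! l) * (rseq as ! l) ?x" if l: "l < length as" for l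
    proof -
      have "as ! l \<in> S" "as ! l \<noteq> s" using nth_mem[OF l] asS La yi by (auto simp: in_lists_conv_set)
      then have "cartan s (as ! l) \<le> 0" using cartan_nonpos S(1) by metis
      moreover have "rseq as ! l \<in> inv_roots (wd as)" using l inv_roots_rseq[OF asS] len_letters[OF La(1)] by simp
      then have "0 \<le> (rseq as ! l) ?x" using inv_roots_pos pos_rootsD by blast
      ultimately show ?thesis by (simp add: mult_nonpos_nonneg)
    qed
    have "\<forall>l\<in>{..<length as}. - cartan s (as ! l) * (rseq as ! l) ?x = 0"
      using sum0 nn by (subst (asm) sum_nonneg_eq_0_iff) auto
    then have "cartan s (as ! j) * (rseq as ! j) ?x = 0" using j by auto
    moreover have "(rseq as ! j) ?x = 1"
    proof -
      have "?x \<notin> set (take j as)"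
        using j lettersD(1)[OF La(1)] by (auto simp: in_set_conv_nth nth_eq_iff_index_eq)
      then have "take j as \<in> lists (- {?x})" by (auto simp: in_lists_conv_set)
      then show ?thesis using rseq_nth[OF j] act_support[of "take j as" "- {?x}" ?x] by (simp add: simple_def)
    qed
    ultimately show ?thesis by simp
  qed
  have comm: "\<forall>a\<in>set as. a \<otimes> s = s \<otimes> a"
  proof
    fix a assume "a \<in> set as"
    then obtain j where "j < length as" "a = as ! j" by (auto simp: in_set_conv_nth)
    moreover have "a \<in> S" using \<open>a \<in> set as\<close> asS by auto
    ultimately show "a \<otimes> s = s \<otimes> a" using commute_if_cartan_zero[of a s] co S(1) by simp
  qed
  have bsS: "bs \<in> lists S" using S(3) by (auto simp: bs_def dest: in_set_dropD)
  have "wd as \<otimes> s = s \<otimes> wd as" if "as \<in> lists S" "\<forall>a\<in>set as. a \<otimes> s = s \<otimes> a" for as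
    using that
  proof (induction as)
    case (Cons a as)
    then have "a \<otimes> wd as \<otimes> s = a \<otimes> (s \<otimes> wd as)" using S(1) by (simp add: m_assoc)
    also have "\<dots> = (a \<otimes> s) \<otimes> wd as" using Cons.hyps S(1) by (simp add: m_assoc)
    also have "a \<otimes> s = s \<otimes> a" using Cons by simp
    also have "(s \<otimes> a) \<otimes> wd as = s \<otimes> (a \<otimes> wd as)" using Cons.hyps S(1) by (simp add: m_assoc)
    finally show ?case by simp
  qed (use S in simp)
  then have c: "wd as \<otimes> s = s \<otimes> wd as" using asS comm by blast
  have "wd ys = wd as \<otimes> (s \<otimes> wd bs)" using ys yi asS bsS S(1) wd_append[of as "s # bs"] by simp
  also have "\<dots> = (wd as \<otimes> s) \<otimes> wd bs" using asS bsS S(1) by (simp add: m_assoc)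
  also have "\<dots> = s \<otimes> wd (as @ bs)" using asS bsS S(1) c by (simp add: m_assoc wd_append)
  finally have "wd xs = wd (as @ bs)" using assms(3) S asS bsS by (simp add: wd_append)
  then show ?thesis using that ys yi comm by simp
qed

text \<open>\<open>letters_first\<close> brings the first letter of one word to the front of the
  other by commutations, under which \<open>srt\<close> is invariant; then both words take the same
  step of the recursion.\<close>

lemma srt_word_independent:
  assumes "letters xs" "letters ys" "set xs = set ys" "wd xs = wd ys" "w \<in> carrier W"
  shows "srt xs w \<longleftrightarrow> srt ys w"
  using assms
proof (induction "(len w, length xs)" arbitrary: w xs ys
    rule: wf_induct_rule[OF wf_lex_prod[OF wf_less_than wf_less_than]])
  case less: 1
  show ?case
  proof (cases xs)
    case Nil then show ?thesis using less.prems by simp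
  next
    case (Cons s xs')
    have L: "letters (s # xs')" using less.prems Cons by simp
    then have s: "s \<in> S" by simp
    obtain as bs where ab: "ys = as @ s # bs" "\<forall>a\<in>set as. a \<otimes> s = s \<otimes> a" "wd (as @ bs) = wd xs'"
      using letters_first[OF L less.prems(2)] less.prems Cons by metis
    have L': "letters (s # as @ bs)" using less.prems(2) ab by (auto simp: letters_def)
    have set_eq: "set xs' = set (as @ bs)" using less.prems(3) ab(1) Cons L L' by auto
    have "srt ys w \<longleftrightarrow> srt (s # as @ bs) w" using srt_move_to_front less.prems ab by simp
    also have "\<dots> \<longleftrightarrow> srt (s # xs') w"
    proof (cases "simple s \<in> inv_roots w")
      case True
      have S': "xs' \<in> lists S" "as @ bs \<in> lists S" using L L' lettersD(2)[of xs'] lettersD(2)[of "as @ bs"] by auto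
      have "wd (xs' @ [s]) = wd ((as @ bs) @ [s])"
        using wd_append[OF S'(1), of "[s]"] wd_append[OF S'(2), of "[s]"] ab s by simp
      moreover have "len w = Suc (len (s \<otimes> w))" using len_gen_descent less.prems s True by blast
      ultimately have "srt (xs' @ [s]) (s \<otimes> w) \<longleftrightarrow> srt ((as @ bs) @ [s]) (s \<otimes> w)"
      proof (intro less.hyps)
        show "letters ((as @ bs) @ [s])" using L' unfolding letters_Cons letters_snoc by blast
      qed (use L less.prems s set_eq in auto)
      then show ?thesis using srt_Cons[OF L less.prems(5)] srt_Cons[OF L' less.prems(5)] True by simp
    next
      case False
      have "srt xs' w \<longleftrightarrow> srt (as @ bs) w"
        using L L' less.prems s set_eq ab Cons by (intro less.hyps) auto
      then show ?thesis using srt_Cons[OF L less.prems(5)] srt_Cons[OF L' less.prems(5)] False by simp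
    qed
    finally show ?thesis using Cons by simp
  qed
qed

section \<open>Positions in the infinite word\<close>

lemma reduced_word_simps:
  assumes "w \<in> carrier W" "s \<in> S"
  shows "reduced_word W S (s # xs) w \<longleftrightarrow> simple s \<in> inv_roots w \<and> reduced_word W S xs (s \<otimes> w)"
proof
  assume "reduced_word W S (s # xs) w"
  then have xs: "xs \<in> lists S" "w = s \<otimes> wd xs" "Suc (length xs) = len w" by (auto simp: reduced_word_def)
  then have sw: "s \<otimes> w = wd xs" using assms by simp
  then have "len (s \<otimes> w) \<le> length xs" using len_le xs by simp
  then have "len w = Suc (len (s \<otimes> w))" using len_gen_left[OF assms] xs by auto
  then show "simple s \<in> inv_roots w \<and> reduced_word W S xs (s \<otimes> w)"
    using xs sw simple_in_inv_roots_iff[OF assms] by (auto simp: reduced_word_def)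
next
  assume *: "simple s \<in> inv_roots w \<and> reduced_word W S xs (s \<otimes> w)"
  then have "len w = Suc (len (s \<otimes> w))" using len_gen_descent assms by blast
  then show "reduced_word W S (s # xs) w" using * assms by (auto simp: reduced_word_def)
qed

lemma reduced_word_para:
  assumes "reduced_word W S xs w" "w \<in> para J" shows "set xs \<subseteq> J"
  using assms
proof (induction xs arbitrary: w)
  case (Cons a xs)
  have a: "a \<in> S" using Cons.prems by (simp add: reduced_word_def)
  have *: "simple a \<in> inv_roots w" "reduced_word W S xs (a \<otimes> w)"
    using reduced_word_simps[of w a xs] Cons.prems paraD(1) a by auto
  then have "a \<in> J" using simple_not_inv_para Cons.prems by blast
  then show ?case using Cons.IH[OF *(2)] para_gen_mult Cons.prems a by simp
qed simp

lemma in_letters_in_copy: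
  assumes "cs \<noteq> []"
  shows "x \<in> letters_in_copy cs ps k \<longleftrightarrow> (\<exists>j<length cs. x = cs ! j \<and> k * length cs + j \<in> set ps)"
proof
  assume "x \<in> letters_in_copy cs ps k"
  then obtain i where "x = cs ! (i mod length cs)" "i \<in> set ps" "i div length cs = k"
    by (auto simp: letters_in_copy_def)
  then show "\<exists>j<length cs. x = cs ! j \<and> k * length cs + j \<in> set ps"
    using assms by (intro exI[of _ "i mod length cs"]) auto
next
  assume "\<exists>j<length cs. x = cs ! j \<and> k * length cs + j \<in> set ps"
  then obtain j where j: "j < length cs" "x = cs ! j" "k * length cs + j \<in> set ps" by blast
  then have "(k * length cs + j) mod length cs = j" "(k * length cs + j) div length cs = k" using assms by auto
  then show "x \<in> letters_in_copy cs ps k" using j unfolding letters_in_copy_def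
    by (metis (mono_tags, lifting) mem_Collect_eq)
qed

text \<open>The positions of \<open>ds\<^sup>\<infinity>\<close> inside \<open>(s # ds)\<^sup>\<infinity>\<close>, for \<open>n = length ds\<close>.\<close>

definition lift_pos :: "nat \<Rightarrow> nat \<Rightarrow> nat"
  where "lift_pos n i = i div n * Suc n + Suc (i mod n)"

lemma lift_pos_div_mod:
  assumes "0 < n" shows "lift_pos n i div Suc n = i div n" "lift_pos n i mod Suc n = Suc (i mod n)"
proof -
  have lt: "Suc (i mod n) < Suc n" using assms by simp
  have "lift_pos n i = Suc (i mod n) + Suc n * (i div n)" by (simp add: lift_pos_def)
  then show "lift_pos n i div Suc n = i div n" "lift_pos n i mod Suc n = Suc (i mod n)"
    using lt by (simp_all only: div_mult_self2 mod_mult_self2 mod_less div_less)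
qed

lemma lift_pos_less:
  assumes "0 < n" "i < j" shows "lift_pos n i < lift_pos n j"
proof -
  have e: "lift_pos n i = i + i div n + 1" for i
    using mult_div_mod_eq[of n i] by (simp add: lift_pos_def algebra_simps)
  have "i div n \<le> j div n" using assms(2) by (simp add: div_le_mono)
  then show ?thesis using assms(2) by (simp add: e)
qed

lemma lift_pos_less_iff: "0 < n \<Longrightarrow> lift_pos n i < lift_pos n j \<longleftrightarrow> i < j"
  using lift_pos_less[of n i j] lift_pos_less[of n j i] by (cases i j rule: linorder_cases) auto

lemma ex_lift_pos:
  assumes "0 < n" "i mod Suc n \<noteq> 0"
  shows "\<exists>j. i = lift_pos n j"
proof
  let ?j = "i div Suc n * n + (i mod Suc n - 1)"
  have lt: "i mod Suc n - 1 < n" using assms mod_less_divisor[of "Suc n" i] by linarith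
  have "?j div n = i div Suc n" "?j mod n = i mod Suc n - 1" using lt assms(1) by auto
  then show "i = lift_pos n ?j" using assms(2) div_mult_mod_eq[of i "Suc n"] by (simp add: lift_pos_def)
qed

lemma ex_map_lift_pos:
  assumes "0 < n" "\<forall>i\<in>set ps. i mod Suc n \<noteq> 0"
  obtains qs where "ps = map (lift_pos n) qs"
proof -
  have "\<exists>qs. ps = map (lift_pos n) qs" using assms(2)
  proof (induction ps)
    case (Cons i ps)
    then obtain qs where "ps = map (lift_pos n) qs" by auto
    moreover obtain j where "i = lift_pos n j" using ex_lift_pos[OF assms(1)] Cons.prems by auto
    ultimately show ?case by (intro exI[of _ "j # qs"]) simp
  qed simp
  then show ?thesis using that by blast
qed

lemma reduced_positions_lift:
  assumes "ds \<noteq> []"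
  shows "reduced_positions W S (s # ds) w (map (lift_pos (length ds)) qs) \<longleftrightarrow> reduced_positions W S ds w qs"
proof -
  have n: "0 < length ds" using assms by simp
  have "map (\<lambda>i. (s # ds) ! (i mod length (s # ds))) (map (lift_pos (length ds)) qs) = map (\<lambda>i. ds ! (i mod length ds)) qs"
    using lift_pos_div_mod[OF n] by simp
  moreover have "sorted_wrt (<) (map (lift_pos (length ds)) qs) \<longleftrightarrow> sorted_wrt (<) qs"
    unfolding sorted_wrt_map lift_pos_less_iff[OF n] ..
  ultimately show ?thesis by (simp only: reduced_positions_def)
qed

lemma letters_in_copy_lift:
  assumes "ds \<noteq> []"
  shows "letters_in_copy (s # ds) (map (lift_pos (length ds)) qs) k = letters_in_copy ds qs k"
proof -
  have *: "x \<in> letters_in_copy cs ps k \<longleftrightarrow> (\<exists>i\<in>set ps. i div length cs = k \<and> x = cs ! (i mod length cs))" for x cs ps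
    by (auto simp: letters_in_copy_def)
  have "0 < length ds" using assms by simp
  then show ?thesis by (intro Set.set_eqI) (simp add: * lift_pos_div_mod)
qed

lemma nth_rotate_letter: "(s # ds) ! (Suc i mod Suc (length ds)) = (ds @ [s]) ! (i mod Suc (length ds))"
proof -
  have "i mod Suc (length ds) < Suc (length ds)" by simp
  then show ?thesis by (auto simp: mod_Suc nth_append less_Suc_eq)
qed

lemma reduced_positions_shift:
  assumes "w \<in> carrier W" "s \<in> S"
  shows "reduced_positions W S (s # ds) w (0 # map Suc qs) \<longleftrightarrow>
    simple s \<in> inv_roots w \<and> reduced_positions W S (ds @ [s]) (s \<otimes> w) qs"
proof -
  have "map (\<lambda>i. (s # ds) ! (i mod length (s # ds))) (0 # map Suc qs) =
    s # map (\<lambda>i. (ds @ [s]) ! (i mod length (ds @ [s]))) qs"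
    by (simp add: nth_rotate_letter)
  moreover have "sorted_wrt (<) (0 # map Suc qs) \<longleftrightarrow> sorted_wrt (<) qs" by (simp add: sorted_wrt_map)
  ultimately show ?thesis using reduced_word_simps[OF assms] by (auto simp only: reduced_positions_def)
qed

text \<open>Removing the first position moves the boundary between copies behind \<open>s\<close>:
  the occurrence of \<open>s\<close> in copy \<open>Suc k\<close> becomes the one in copy
  \<open>k\<close>, while all other letters keep their copy.\<close>

lemma letters_in_copy_shift:
  assumes "distinct (s # ds)"
  shows "x \<in> letters_in_copy (ds @ [s]) qs k \<longleftrightarrow>
    (if x = s then s \<in> letters_in_copy (s # ds) (0 # map Suc qs) (Suc k)
     else x \<in> letters_in_copy (s # ds) (0 # map Suc qs) k)"
proof -
  let ?n = "length ds"
  have 1: "x \<in> letters_in_copy (ds @ [s]) qs k \<longleftrightarrow>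
      (\<exists>j<?n. x = ds ! j \<and> k * Suc ?n + j \<in> set qs) \<or> (x = s \<and> k * Suc ?n + ?n \<in> set qs)"
  proof -
    have "x \<in> letters_in_copy (ds @ [s]) qs k \<longleftrightarrow>
      (\<exists>j<Suc ?n. x = (ds @ [s]) ! j \<and> k * Suc ?n + j \<in> set qs)"
      using in_letters_in_copy[of "ds @ [s]" x qs k] by simp
    also have "\<dots> \<longleftrightarrow> (\<exists>j<?n. x = (ds @ [s]) ! j \<and> k * Suc ?n + j \<in> set qs) \<or>
        (x = (ds @ [s]) ! ?n \<and> k * Suc ?n + ?n \<in> set qs)"
      unfolding less_Suc_eq by blast
    finally show ?thesis by (simp add: nth_append cong: conj_cong)
  qed
  have 2: "x \<in> letters_in_copy (s # ds) (0 # map Suc qs) k \<longleftrightarrow>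
      (x = s \<and> k * Suc ?n \<in> set (0 # map Suc qs)) \<or> (\<exists>j<?n. x = ds ! j \<and> k * Suc ?n + j \<in> set qs)" for x k
    unfolding in_letters_in_copy[of "s # ds", simplified] Ex_less_Suc2 by auto
  have eq: "Suc k * Suc ?n = Suc (k * Suc ?n + ?n)" by simp
  have "Suc i \<in> set (0 # map Suc qs) \<longleftrightarrow> i \<in> set qs" for i by auto
  then have "Suc k * Suc ?n \<in> set (0 # map Suc qs) \<longleftrightarrow> k * Suc ?n + ?n \<in> set qs" by (simp only: eq)
  moreover have "ds ! j \<noteq> s" if "j < ?n" for j using assms that by auto
  ultimately show ?thesis unfolding 1 2 by auto
qed

definition nested :: "'a list \<Rightarrow> nat list \<Rightarrow> bool"
  where "nested cs ps \<longleftrightarrow> (\<forall>k. letters_in_copy cs ps (Suc k) \<subseteq> letters_in_copy cs ps k)"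

lemma initial_letter_in_copy_0: "s \<in> letters_in_copy (s # ds) (0 # ps) 0"
  by (force simp: letters_in_copy_def)

text \<open>For \<open>s\<close> the inclusions are shifted by one copy. The inclusion lost in this
  way, of copy 1 in copy 0, holds because position 0 is used.\<close>

lemma nested_shift:
  assumes "distinct (s # ds)"
  shows "nested (s # ds) (0 # map Suc qs) \<longleftrightarrow> nested (ds @ [s]) qs"
proof
  assume n: "nested (s # ds) (0 # map Suc qs)"
  show "nested (ds @ [s]) qs"
    unfolding nested_def
  proof (intro allI subsetI)
    fix k x assume "x \<in> letters_in_copy (ds @ [s]) qs (Suc k)"
    then show "x \<in> letters_in_copy (ds @ [s]) qs k"
      using n unfolding letters_in_copy_shift[OF assms] nested_def by (auto split: if_splits)
  qed
next
  assume n: "nested (ds @ [s]) qs"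
  show "nested (s # ds) (0 # map Suc qs)"
    unfolding nested_def
  proof (intro allI subsetI)
    fix k x assume x: "x \<in> letters_in_copy (s # ds) (0 # map Suc qs) (Suc k)"
    show "x \<in> letters_in_copy (s # ds) (0 # map Suc qs) k"
    proof (cases "x = s")
      case False
      then show ?thesis using x n letters_in_copy_shift[OF assms, of x qs] unfolding nested_def by auto
    next
      case True
      show ?thesis
      proof (cases k)
        case 0 then show ?thesis using initial_letter_in_copy_0 True by simp
      next
        case (Suc k')
        then show ?thesis using x True n letters_in_copy_shift[OF assms, of s qs] unfolding nested_def by auto
      qed
    qed
  qed
qed

lemma srt_if_nested:
  assumes "letters cs" "cs \<noteq> []" "w \<in> carrier W" "reduced_positions W S cs w ps" "nested cs ps"
  shows "srt cs w"
  using assms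
proof (induction "(len w, length cs)" arbitrary: w cs ps
    rule: wf_induct_rule[OF wf_lex_prod[OF wf_less_than wf_less_than]])
  case less: 1
  obtain s ds where cs: "cs = s # ds" using less.prems by (cases cs) auto
  have L: "letters (s # ds)" and s: "s \<in> S" using less.prems cs by auto
  show ?case
  proof (cases "0 \<in> set ps")
    case True
    have so: "sorted_wrt (<) ps" using less.prems(4) by (simp add: reduced_positions_def)
    obtain p ps' where p: "ps = p # ps'" using True by (cases ps) auto
    then have "p = 0" "\<forall>i\<in>set ps'. 0 < i" using so True by auto
    then have ps: "ps = 0 # map Suc (map (\<lambda>i. i - 1) ps')" using p by (auto simp: map_idI)
    define qs where "qs = map (\<lambda>i. i - 1) ps'"
    have q: "simple s \<in> inv_roots w" "reduced_positions W S (ds @ [s]) (s \<otimes> w) qs"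
      using reduced_positions_shift[OF less.prems(3) s, of ds qs] less.prems(4) ps cs qs_def by simp_all
    have "nested (ds @ [s]) qs" using nested_shift[of s ds qs] less.prems(5) L ps cs qs_def lettersD by simp
    moreover have "len w = Suc (len (s \<otimes> w))" using len_gen_descent less.prems s q by blast
    ultimately have "srt (ds @ [s]) (s \<otimes> w)" using q L less.prems(3) s by (intro less.hyps[where ps = qs]) auto
    then show ?thesis using srt_Cons[OF L less.prems(3)] q cs by simp
  next
    case False
    have "k * Suc (length ds) \<notin> set ps" for k
    proof (induction k)
      case (Suc k)
      show ?case
      proof
        assume "Suc k * Suc (length ds) \<in> set ps"
        then have "s \<in> letters_in_copy cs ps (Suc k)" unfolding in_letters_in_copy[OF less.prems(2)]
          using cs by (intro exI[of _ 0]) auto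
        then have "s \<in> letters_in_copy cs ps k" using less.prems(5) by (auto simp: nested_def)
        then have "\<exists>j<length cs. s = cs ! j \<and> k * length cs + j \<in> set ps"
          by (rule iffD1[OF in_letters_in_copy[OF less.prems(2)]])
        then obtain j where j: "j < length cs" "s = cs ! j" "k * length cs + j \<in> set ps" by blast
        have d: "distinct cs" using less.prems lettersD by blast
        have "cs ! 0 = s" "0 < length cs" by (simp_all add: cs)
        note iffD1[OF nth_eq_iff_index_eq[OF d this(2) j(1)], OF trans[OF this(1) j(2)]]
        then have "k * Suc (length ds) \<in> set ps" using j(3) by (simp add: cs)
        then show False using Suc by simp
      qed
    qed (use False in simp)
    then have nm: "\<forall>i\<in>set ps. i mod Suc (length ds) \<noteq> 0" by (metis add.right_neutral div_mult_mod_eq)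
    show ?thesis
    proof (cases "ds = []")
      case True
      then have "ps = []" using nm by (cases ps) auto
      then have "w = \<one>" using less.prems(4) by (auto simp: reduced_positions_def reduced_word_def)
      then show ?thesis by (simp add: srt_one)
    next
      case False
      obtain qs where qs: "ps = map (lift_pos (length ds)) qs" using ex_map_lift_pos[OF _ nm] False by auto
      have "reduced_positions W S ds w qs" using reduced_positions_lift[OF False] less.prems(4) qs cs by simp
      moreover have "nested ds qs" using less.prems(5) letters_in_copy_lift[OF False] qs cs by (simp add: nested_def)
      ultimately have "srt ds w" using L False less.prems(3) cs by (intro less.hyps[where ps = qs]) auto
      then show ?thesis using cs by (simp add: srt.skip)
    qed
  qed
qed

lemma lexord_map:
  assumes "(xs, ys) \<in> lexord less_than" "\<And>i j. i < j \<Longrightarrow> f i < (f j :: nat)"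
  shows "(map f xs, map f ys) \<in> lexord less_than"
  using assms(1)
proof (induction xs arbitrary: ys)
  case Nil then show ?case by (cases ys) auto
next
  case (Cons x xs) then show ?case using assms(2) by (cases ys) auto
qed

text \<open>Lexicographic minimality is inherited. At a \<open>take\<close>, a competitor not
  starting at position 0 is larger. At a \<open>skip\<close>, no competitor uses \<open>s\<close>,
  because reduced words of parabolic elements use only letters of the parabolic.\<close>

lemma srt_sorting_positions:
  assumes "srt cs w" "letters cs"
  shows "\<exists>ps. sorting_positions W S cs w ps \<and> nested cs ps"
  using assms
proof (induction rule: srt.induct)
  case nil
  have "reduced_positions W S [] \<one> qs \<longleftrightarrow> qs = []" for qs
    by (auto simp: reduced_positions_def reduced_word_def)
  then have "sorting_positions W S [] \<one> []" by (simp add: sorting_positions_def)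
  moreover have "nested [] []" by (simp add: nested_def letters_in_copy_def)
  ultimately show ?case by blast
next
  case (skip ds w s)
  have L: "letters ds" and s: "s \<in> S" "s \<notin> set ds" using skip.prems by auto
  have wp: "w \<in> para (set ds)" using srt_para[OF skip.hyps(1) L] .
  obtain ps where ps: "sorting_positions W S ds w ps" "nested ds ps" using skip.IH[OF L] by blast
  have nm: "\<forall>i\<in>set qs. i mod Suc (length ds) \<noteq> 0" if "reduced_positions W S (s # ds) w qs" for qs
  proof
    fix i assume i: "i \<in> set qs"
    have "reduced_word W S (map (\<lambda>i. (s # ds) ! (i mod length (s # ds))) qs) w"
      using that by (simp only: reduced_positions_def)
    then have "set (map (\<lambda>i. (s # ds) ! (i mod length (s # ds))) qs) \<subseteq> set ds"
      using wp by (rule reduced_word_para)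
    then have "(s # ds) ! (i mod Suc (length ds)) \<in> set ds" using i by auto
    then show "i mod Suc (length ds) \<noteq> 0" using s by (metis nth_Cons_0)
  qed
  show ?case
  proof (cases "ds = []")
    \<comment> \<open>\<open>lift_pos\<close> requires a nonempty \<open>ds\<close>; here only the
      identity remains.\<close>
    case True
    then have w: "w = \<one>" using wp para_empty by simp
    have "reduced_positions W S (s # ds) w qs \<longleftrightarrow> qs = []" for qs
      by (auto simp: w reduced_positions_def reduced_word_def)
    then have "sorting_positions W S (s # ds) w []" by (simp add: sorting_positions_def)
    moreover have "nested (s # ds) []" by (simp add: nested_def letters_in_copy_def)
    ultimately show ?thesis by blast
  next
    case False
    have "sorting_positions W S (s # ds) w (map (lift_pos (length ds)) ps)"
      unfolding sorting_positions_def
    proof (intro conjI allI impI)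
      show "reduced_positions W S (s # ds) w (map (lift_pos (length ds)) ps)"
        using ps(1) reduced_positions_lift[OF False] by (simp add: sorting_positions_def)
      fix qs assume q: "reduced_positions W S (s # ds) w qs"
      obtain qs' where qs': "qs = map (lift_pos (length ds)) qs'" using ex_map_lift_pos[OF _ nm[OF q]] False by auto
      then have "reduced_positions W S ds w qs'" using q reduced_positions_lift[OF False] by simp
      then have "ps = qs' \<or> (ps, qs') \<in> lexord less_than" using ps(1) by (simp add: sorting_positions_def)
      then show "map (lift_pos (length ds)) ps = qs \<or> (map (lift_pos (length ds)) ps, qs) \<in> lexord less_than"
        using lexord_map[of ps qs' "lift_pos (length ds)"] lift_pos_less[of "length ds"] False qs' by auto
    qed
    moreover have "nested (s # ds) (map (lift_pos (length ds)) ps)"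
      using ps(2) letters_in_copy_lift[OF False] by (simp add: nested_def)
    ultimately show ?thesis by blast
  qed
next
  case (take ds s u)
  have L: "letters (ds @ [s])" and s: "s \<in> S" using take.prems by auto
  have uc: "u \<in> carrier W" using srt_carrier[OF take.hyps(1) L] .
  obtain ps where ps: "sorting_positions W S (ds @ [s]) u ps" "nested (ds @ [s]) ps" using take.IH[OF L] by blast
  have si: "simple s \<in> inv_roots (s \<otimes> u)" using inv_roots_gen_simple[OF uc s] take.hyps by simp
  have shift: "reduced_positions W S (s # ds) (s \<otimes> u) (0 # map Suc qs) \<longleftrightarrow> reduced_positions W S (ds @ [s]) u qs" for qs
    using reduced_positions_shift[of "s \<otimes> u" s ds qs] uc s si by simp
  have "sorting_positions W S (s # ds) (s \<otimes> u) (0 # map Suc ps)"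
    unfolding sorting_positions_def
  proof (intro conjI allI impI)
    show "reduced_positions W S (s # ds) (s \<otimes> u) (0 # map Suc ps)"
      using ps(1) shift by (simp add: sorting_positions_def)
    fix qs assume q: "reduced_positions W S (s # ds) (s \<otimes> u) qs"
    have "len (s \<otimes> u) = Suc (len (s \<otimes> (s \<otimes> u)))" using len_gen_descent[OF _ s si] uc s by simp
    then have "qs \<noteq> []" using q by (auto simp: reduced_positions_def reduced_word_def)
    then obtain q0 qs' where qs: "qs = q0 # qs'" by (cases qs) auto
    show "0 # map Suc ps = qs \<or> (0 # map Suc ps, qs) \<in> lexord less_than"
    proof (cases "q0 = 0")
      case False then show ?thesis using qs by simp
    next
      case True
      then have "\<forall>i\<in>set qs'. 0 < i" using q qs by (auto simp: reduced_positions_def)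
      then have "qs' = map Suc (map (\<lambda>i. i - 1) qs')" by (auto simp: map_idI)
      then obtain qs'' where qs'': "qs = 0 # map Suc qs''" using qs True by metis
      then have "reduced_positions W S (ds @ [s]) u qs''" using q shift by simp
      then have "ps = qs'' \<or> (ps, qs'') \<in> lexord less_than" using ps(1) by (simp add: sorting_positions_def)
      then show ?thesis using lexord_map[of ps qs'' Suc] qs'' by auto
    qed
  qed
  moreover have "nested (s # ds) (0 # map Suc ps)" using nested_shift ps(2) lettersD[OF take.prems] by blast
  ultimately show ?case by blast
qed

lemma sortable_iff_srt:
  assumes "letters cs" "set cs = S" "cs \<noteq> []" "w \<in> carrier W"
  shows "sortable W S (wd cs) w \<longleftrightarrow> srt cs w"
proof
  assume "sortable W S (wd cs) w"
  then obtain ds ps where d: "reduced_word W S ds (wd cs)" "sorting_positions W S ds w ps" "nested ds ps"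
    unfolding sortable_def nested_def by blast
  then have ds: "letters ds" "set ds = S" "wd ds = wd cs" using reduced_word_coxeter_element[OF assms(1,2)] by auto
  have "ds \<noteq> []" using ds assms by auto
  then have "srt ds w" using srt_if_nested[OF ds(1) _ assms(4), of ps] d by (simp add: sorting_positions_def)
  then show "srt cs w" using srt_word_independent[of ds cs w] ds assms by simp
next
  assume "srt cs w"
  then obtain ps where "sorting_positions W S cs w ps" "nested cs ps" using srt_sorting_positions assms by blast
  moreover have "reduced_word W S cs (wd cs)" using reduced_word_coxeter_element[OF assms(1,2)] assms by simp
  ultimately show "sortable W S (wd cs) w" unfolding sortable_def nested_def by blast
qed

lemma sortable_carrier:
  assumes "sortable W S c w" shows "w \<in> carrier W"
proof -
  obtain xs where "xs \<in> lists S" "wd xs = w"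
    using assms unfolding sortable_def sorting_positions_def reduced_positions_def reduced_word_def by blast
  then show ?thesis using wd_closed by blast
qed


section \<open>The bijection\<close>

lemma weak_le_iff: "\<lbrakk>v \<in> carrier W; w \<in> carrier W\<rbrakk> \<Longrightarrow> v \<sqsubseteq>\<^bsub>weak_order W S\<^esub> w \<longleftrightarrow> v \<preceq> w"
  by (simp add: weak_order_def inversions_subset_iff)

lemma least_Upper_iff:
  assumes "x \<in> carrier W" "y \<in> carrier W"
  shows "least (weak_order W S) z (Upper (weak_order W S) {x, y}) \<longleftrightarrow> is_lub x y z"
proof -
  have c: "carrier (weak_order W S) = carrier W" by (simp add: weak_order_def)
  have U: "u \<in> Upper (weak_order W S) {x, y} \<longleftrightarrow> u \<in> carrier W \<and> x \<preceq> u \<and> y \<preceq> u" for u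
  proof -
    have "u \<in> Upper (weak_order W S) {x, y} \<longleftrightarrow>
      u \<in> carrier W \<and> x \<sqsubseteq>\<^bsub>weak_order W S\<^esub> u \<and> y \<sqsubseteq>\<^bsub>weak_order W S\<^esub> u"
      unfolding Upper_def c using assms by blast
    then show ?thesis using weak_le_iff[of _ u] assms by metis
  qed
  have "least (weak_order W S) z (Upper (weak_order W S) {x, y}) \<longleftrightarrow>
    z \<in> Upper (weak_order W S) {x, y} \<and> (\<forall>u\<in>Upper (weak_order W S) {x, y}. z \<sqsubseteq>\<^bsub>weak_order W S\<^esub> u)"
    unfolding least_def using Upper_closed[of "weak_order W S" "{x, y}"] by blast
  then show ?thesis unfolding is_lub_def Ball_def U using weak_le_iff[of z] by metis
qed

lemma join_exists_iff:
  assumes "x \<in> carrier W" "y \<in> carrier W"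
  shows "join_exists W S x y \<longleftrightarrow> (\<exists>z. is_lub x y z)"
  using least_Upper_iff[OF assms] by (simp add: join_exists_def)

lemma join_eq:
  assumes "x \<in> carrier W" "y \<in> carrier W" "is_lub x y z"
  shows "x \<squnion>\<^bsub>weak_order W S\<^esub> y = z"
  unfolding join_def sup_def least_Upper_iff[OF assms(1,2)]
  using assms(3) is_lub_unique by (intro some_equality) auto

text \<open>A reflection negates its root and elements of the parabolic subgroup preserve
  coordinates outside \<open>J\<close>. Conversely, the root is an inversion of its own reflection,
  hence of the parabolic part of that; a word in \<open>J\<close> for this part writes the
  reflection as a conjugate inside the subgroup. This matches the intersection in
  \<open>parabolic_part\<close> with supports of roots.\<close>

lemma reflection_in_para_iff:
  assumes "\<beta> \<in> pos_roots" "J \<subseteq> S"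
  shows "reflection_of \<beta> \<in> para J \<longleftrightarrow> supp J \<beta>"
proof
  have r: "\<beta> \<in> roots" using assms pos_rootsD by blast
  have t: "rep (reflection_of \<beta>) \<beta> = (\<lambda>x. - \<beta> x)" using rep_reflection_of[OF r] root_norm[OF r] by auto
  show "supp J \<beta>" if "reflection_of \<beta> \<in> para J"
  proof -
    have "\<beta> x = 0" if "x \<notin> J" for x
      using rep_para[OF \<open>reflection_of \<beta> \<in> para J\<close> that, of \<beta>] t by simp
    then show ?thesis by (simp add: supp_def)
  qed
  show "reflection_of \<beta> \<in> para J" if su: "supp J \<beta>"
  proof -
    have tc: "reflection_of \<beta> \<in> carrier W" using r by simp
    have "inv (reflection_of \<beta>) = reflection_of \<beta>" using reflection_of_square[OF r] tc by (simp add: inv_equality)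
    then have "\<beta> \<in> inv_roots (reflection_of \<beta>)" using assms(1) t not_pos_uminus by (simp add: inv_roots_def)
    moreover obtain v where v: "v \<in> para J" "inv_roots v = restr J (reflection_of \<beta>)"
      using parabolic_part_exists[OF tc assms(2)] by blast
    ultimately have "\<beta> \<in> inv_roots v" using su by (simp add: restr_def)
    moreover obtain xs where xs: "xs \<in> lists (J \<inter> S)" "wd xs = v" "length xs = len v" using para_word[OF v(1)] by blast
    moreover have xsS: "xs \<in> lists S" using xs(1) by auto
    ultimately have "\<beta> \<in> set (rseq xs)" using inv_roots_rseq[OF xsS] by simp
    then obtain i where i: "i < length xs" "\<beta> = act (take i xs) (simple (xs ! i))"
      using rseq_nth by (metis in_set_conv_nth length_rseq)
    have us: "take i xs \<in> lists J" "take i xs \<in> lists S" "rev (take i xs) \<in> lists J" "rev (take i xs) \<in> lists S"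
      using xs(1) by (auto simp: in_lists_conv_set dest: in_set_takeD)
    have xi: "xs ! i \<in> J" "xs ! i \<in> S" using i xs(1) by (auto simp: in_lists_conv_set)
    have "\<beta> = rep (wd (take i xs)) (simple (xs ! i))" using i rep_wd us by simp
    then have "reflection_of \<beta> = wd (take i xs @ [xs ! i] @ rev (take i xs))"
      using reflection_of_rep[of "wd (take i xs)" "xs ! i"] us xi by (simp add: wd_append inv_wd m_assoc)
    moreover have "take i xs @ [xs ! i] @ rev (take i xs) \<in> lists J" using us xi by simp
    ultimately show ?thesis using word_para assms(2) by metis
  qed
qed

lemma parabolic_part_eq:
  assumes "x \<in> carrier W" "J \<subseteq> S" "v \<in> para J" "inv_roots v = restr J x"
  shows "parabolic_part W S J x = v"
proof -
  have gen: "generate W J = para J" using para_eq_generate assms(2) by simp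
  have vc: "v \<in> carrier W" using assms paraD by blast
  have e: "inversions W S v = inversions W S x \<inter> generate W J"
    unfolding inversions_eq[OF vc] inversions_eq[OF assms(1)] gen assms(4) restr_def
    using reflection_in_para_iff[OF inv_roots_pos assms(2)] by auto
  have "u = v" if "u \<in> para J" "inversions W S u = inversions W S v" for u
  proof -
    have uc: "u \<in> carrier W" using that paraD by blast
    have "u \<preceq> v" "v \<preceq> u" using inversions_subset_iff[OF uc vc] inversions_subset_iff[OF vc uc] that by auto
    then show ?thesis using inv_roots_inj[OF uc vc] by blast
  qed
  then show ?thesis unfolding parabolic_part_def e[symmetric] using assms(3)
    unfolding gen by (intro the_equality) blast+
qed

end

theorem theorem7p4:
  fixes W :: "('a, 'b) monoid_scheme" and S :: "'a set" and c s :: 'a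
  assumes "coxeter_system W S"
    and "finite S"
    and "coxeter_element W S c"
    and "initial_in W S s c"
  defines "L \<equiv> weak_order W S"
  defines "A \<equiv> {v. sortable W S c v \<and> join_exists W S s v}"
    and "B \<equiv> {x. sortable W S (s \<otimes>\<^bsub>W\<^esub> c \<otimes>\<^bsub>W\<^esub> s) x}"
    and "f \<equiv> (\<lambda>v. if s \<sqsubseteq>\<^bsub>L\<^esub> v then s \<otimes>\<^bsub>W\<^esub> v else s \<squnion>\<^bsub>L\<^esub> v)"
    and "g \<equiv> (\<lambda>x. if \<not> s \<sqsubseteq>\<^bsub>L\<^esub> x then s \<otimes>\<^bsub>W\<^esub> x else parabolic_part W S (S - {s}) x)"
  shows "bij_betw f A B \<and> (\<forall>x\<in>B. inv_into A f x = g x)"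
proof -
  interpret coxeter_system W S by fact
  obtain m where "coxeter_matrix S m"
    "\<forall>xs\<in>lists S. \<forall>ys\<in>lists S. word_prod W xs = word_prod W ys \<longleftrightarrow> equivclp (relator_step S m) xs ys"
    using presentation by blast
  then interpret finite_rank_coxeter_system W S m
    by unfold_locales (use assms(2) in auto)
  obtain xs where xs: "letters xs" "set xs = S" "wd xs = c"
    using assms(3) by (auto simp: coxeter_element_def letters_def)
  obtain cs where "reduced_word W S (s # cs) c" using assms(4) by (auto simp: initial_in_def)
  then have cs: "letters (s # cs)" "set (s # cs) = S" "wd (s # cs) = c"
    using reduced_word_coxeter_element[OF xs(1,2)] xs(3) by auto
  have s: "s \<in> S" and csS: "cs \<in> lists S" "set cs \<subseteq> S" using cs lettersD by auto
  have L: "letters (cs @ [s])" "set (cs @ [s]) = S" using cs by auto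
  have setcs: "set cs = S - {s}" using cs by auto
  \<comment> \<open>Conjugation by the initial letter rotates the word, so \<open>s\<close> is final
    for the target Coxeter element.\<close>
  have scs: "s \<otimes>\<^bsub>W\<^esub> c \<otimes>\<^bsub>W\<^esub> s = wd (cs @ [s])" using cs(3)[symmetric] s csS by (simp add: wd_append)
  have sort_c: "sortable W S c w \<longleftrightarrow> srt (s # cs) w" if "w \<in> carrier W" for w
    using sortable_iff_srt[OF cs(1,2)] cs(3) that by simp
  have sort_scs: "sortable W S (s \<otimes>\<^bsub>W\<^esub> c \<otimes>\<^bsub>W\<^esub> s) w \<longleftrightarrow> srt (cs @ [s]) w" if "w \<in> carrier W" for w
    using sortable_iff_srt[OF L] scs that by simp
  have le: "s \<sqsubseteq>\<^bsub>L\<^esub> w \<longleftrightarrow> simple s \<in> inv_roots w" if "w \<in> carrier W" for w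
    unfolding L_def using weak_le_iff[of s w] inv_roots_gen[OF s] s that by simp
  have A: "v \<in> A \<longleftrightarrow> v \<in> carrier W \<and> srt (s # cs) v \<and> (\<exists>z. is_lub s v z)" for v
  proof (cases "v \<in> carrier W")
    case True
    then show ?thesis using sort_c[of v] join_exists_iff[of s v] s by (simp add: A_def)
  next
    case False
    then show ?thesis using sortable_carrier[of c v] by (auto simp: A_def)
  qed
  have B: "x \<in> B \<longleftrightarrow> x \<in> carrier W \<and> srt (cs @ [s]) x" for x
  proof (cases "x \<in> carrier W")
    case True
    then show ?thesis using sort_scs[of x] by (simp add: B_def)
  next
    case False
    then show ?thesis using sortable_carrier[of "s \<otimes>\<^bsub>W\<^esub> c \<otimes>\<^bsub>W\<^esub> s" x] by (auto simp: B_def)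
  qed
  have fA: "f v \<in> B \<and> g (f v) = v" if vA: "v \<in> A" for v
  proof -
    obtain z where v: "v \<in> carrier W" "srt (s # cs) v" "is_lub s v z" using A[of v] vA by blast
    note zD = is_lubD[OF v(3)]
    show ?thesis
    proof (cases "simple s \<in> inv_roots v")
      case True
      then have fv: "f v = s \<otimes>\<^bsub>W\<^esub> v" using le v by (simp add: f_def)
      moreover have "srt (cs @ [s]) (s \<otimes>\<^bsub>W\<^esub> v)" using srt_Cons[OF cs(1) v(1)] v True by simp
      moreover have "simple s \<notin> inv_roots (s \<otimes>\<^bsub>W\<^esub> v)" using inv_roots_gen_simple v s True by simp
      ultimately show ?thesis using B le v(1) s by (simp add: g_def)
    next
      case False
      then have fv: "f v = z" using le v join_eq[of s v z] s by (simp add: f_def L_def)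
      have sv: "srt cs v" using srt_Cons[OF cs(1) v(1)] v False by simp
      then have vp: "v \<in> para (set cs)" using srt_para cs by simp
      have "srt (cs @ [s]) v" using srt_insert[of cs s "[]" v] sv vp L by simp
      then have sz: "srt (cs @ [s]) z" using srt_join[OF L(1) srt_gen[OF L(1)] _ v(3)] by simp
      \<comment> \<open>The only inversion of \<open>s\<close> is its simple root, which is not
        supported on \<open>cs\<close>; hence \<open>restr_lub\<close> returns the inversions of
        \<open>v\<close>.\<close>
      have "restr (set cs) s = {}" using cs(1) inv_roots_gen[OF s] by (auto simp: restr_def)
      then have "restr (set cs) z = restr (set cs) v" using restr_lub[OF v(3)] s v csS by simp
      also have "\<dots> = inv_roots v" using paraD(2)[OF vp] by (auto simp: restr_def)
      finally have "parabolic_part W S (S - {s}) z = v"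
        using parabolic_part_eq[OF zD(1), of "set cs" v] csS vp setcs by simp
      moreover have "simple s \<in> inv_roots z" using zD(2) inv_roots_gen[OF s] by simp
      ultimately show ?thesis using fv sz B le zD(1) by (simp add: g_def)
    qed
  qed
  have gB: "g x \<in> A \<and> f (g x) = x" if xB: "x \<in> B" for x
  proof -
    have x: "x \<in> carrier W" "srt (cs @ [s]) x" using B[of x] xB by auto
    show ?thesis
    proof (cases "simple s \<in> inv_roots x")
      case False
      then have gx: "g x = s \<otimes>\<^bsub>W\<^esub> x" using le x by (simp add: g_def)
      have sx: "simple s \<in> inv_roots (s \<otimes>\<^bsub>W\<^esub> x)" using inv_roots_gen_simple x s False by simp
      then have "is_lub s (s \<otimes>\<^bsub>W\<^esub> x) (s \<otimes>\<^bsub>W\<^esub> x)" using gen_below[OF s] x s by (simp add: is_lub_def)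
      moreover have "srt (s # cs) (s \<otimes>\<^bsub>W\<^esub> x)" using x False by (intro srt.take)
      ultimately have "s \<otimes>\<^bsub>W\<^esub> x \<in> A" using A x s by auto
      then show ?thesis using gx sx le x s by (simp add: f_def)
    next
      case True
      obtain v where v: "v \<in> para (set cs)" "inv_roots v = restr (set cs) x"
        using parabolic_part_exists[OF x(1) csS(2)] by blast
      have vc: "v \<in> carrier W" using v paraD by blast
      have gx: "g x = v" using le x True parabolic_part_eq[OF x(1) csS(2) v] setcs by (simp add: g_def)
      have lub: "is_lub s v x" using srt_final_lub[OF x(2) L(1) True v] .
      have "srt (s # cs) v" using srt_parabolic_part[OF x(2) L(1) v] by (rule srt.skip)
      then have "v \<in> A" using A lub vc by blast
      moreover have "simple s \<notin> inv_roots v" using simple_not_inv_para[OF v(1)] cs by simp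
      ultimately show ?thesis using gx le vc join_eq[OF _ vc lub] s by (simp add: f_def L_def)
    qed
  qed
  have bij: "bij_betw f A B"
    by (rule bij_betw_byWitness[where f' = g]) (use fA gB in auto)
  moreover have "inv_into A f x = g x" if "x \<in> B" for x
    using bij gB[OF that] by (intro inv_into_f_eq) (auto simp: bij_betw_def)
  ultimately show ?thesis by blast
qed

end
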